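(* Let $f\in\mathcal{L}_{q,2}$ and let $c_n=\int_0^\infty \psi_n(y)f(y)\,d_qy$ ($n=0,1,2,\ldots$) be its Fourier coefficients with respect to the functions $\psi_n$. Then $$f(x)=\sum_{n=0}^\infty c_n\psi_n(x)\qquad\text{for all }x\in\mathbb{R}_q^+ .$$
   Context: Fix $0<q<1$ and put $\mathbb{R}_q^+=\{q^n: n\in\mathbb{Z}\}$. For a function $f$ on $\mathbb{R}_q^+$, $\Lambda_q^{-1}f(x)=f(q^{-1}x)$, $D_qf(x)=\frac{f(x)-f(qx)}{(1-q)x}$, and $$\Delta_q f(x)=\frac1{x^2}\Big[f(q^{-1}x)-\frac{1+q}{q}f(x)+\frac1q f(qx)\Big].$$ Values at $0$ are limits along $\mathbb{R}_q^+$: $f(0)=\lim_{n\to\infty}f(q^n)$ and $f'(0)=\lim_{n\to\infty}\frac{f(q^n)-f(0)}{q^n}$. Jackson's integral is $\int_0^b f(x)\,d_qx=(1-q)\sum_{n\ge0}bq^nf(bq^n)$ for $b\in\mathbb{R}_q^+$, and $\int_0^\infty f(x)\,d_qx=(1-q)\sum_{n\in\mathbb{Z}}q^nf(q^n)$. $L^2(\mathbb{R}_q^+)$ is the Hilbert space of functions $f$ on $\mathbb{R}_q^+$ with $\int_0^\infty|f(x)|^2d_qx<\infty$. Potential and solutions: $x\mapsto q(x)$ is a given real-valued function on $\mathbb{R}_q^+$ (the symbol $q$ with an argument is this function; without argument it is the number $q$), and $Lf(x)=q(x)f(x)-\Delta_qf(x)$. Fix $\alpha\in\mathbb{R}$.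 It is assumed that for every $\lambda\in\mathbb{C}$ the equation $\Delta_qf(x)+[\lambda-q(x)]f(x)=0$ on $\mathbb{R}_q^+$ has solutions $\phi(x)=\phi(x,\lambda)$ and $\theta(x)=\theta(x,\lambda)$ with $$\phi(0)=\tfrac{\sqrt q}{1-q}\sin\alpha,\quad \phi'(0)=-\tfrac{\sqrt q}{1-q}\cos\alpha,\quad \theta(0)=\tfrac{\sqrt q}{1-q}\cos\alpha,\quad \theta'(0)=\tfrac{\sqrt q}{1-q}\sin\alpha .$$ The $q$-Wronskian is $W_x(F,G)=\frac{(1-q)^2}{q}\big[F(x)\Lambda_q^{-1}D_qG(x)-G(x)\Lambda_q^{-1}D_qF(x)\big]$. Function $m$: for non-real $\lambda$, $b\in\mathbb{R}_q^+$ and $\beta\in\mathbb{R}$ let $$l(\lambda;b,\beta)=-\frac{\theta(b,\lambda)\cos\beta+\Lambda_q^{-1}D_q\theta(b,\lambda)\sin\beta}{\phi(b,\lambda)\cos\beta+\Lambda_q^{-1}D_q\phi(b,\lambda)\sin\beta}.$$ For fixed $\lambda,b$, as $\beta$ varies, $l$ describes a circle $C_b$; as $b\to\infty$ these nested circles converge to a limit-point or a limit-circle. $m(\lambda)$ is the limit-point, or a point of the limit-circle obtained as $m(\lambda)=\lim_j l(\lambda;b_j,\beta_j)$ with $b_j\to\infty$ in $\mathbb{R}_q^+$ and real $\beta_j$, the sequences $(b_j),(\beta_j)$ being the same for all non-real $\lambda$. Standing assumption: $m$ forms a single analytic function whose only singularities are poles on the real axis (they are then simple). Denote these poles by $\lambda_0,\lambda_1,\ldots$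 and the residues by $r_0,r_1,\ldots$. Put $\psi(x,\lambda)=\theta(x,\lambda)+m(\lambda)\phi(x,\lambda)$ and $\psi_n(x)=\sqrt{r_n}\,\phi(x,\lambda_n)$. $\mathcal{L}_{q,2}$ is the space of all $f\in L^2(\mathbb{R}_q^+)$ such that: (i) $Lf\in L^2(\mathbb{R}_q^+)$; (ii) $f(0),f'(0)$ exist and $f(0)\cos\alpha+f'(0)\sin\alpha=0$; (iii) $\lim_{x\to\infty}W_x(\psi(\cdot,\lambda),f)=0$ for every non-real $\lambda$ (limit along $\mathbb{R}_q^+$). *)

theory Defs
  imports "HOL-Complex_Analysis.Complex_Analysis"
begin

text \<open>
  Functions on the \<open>q\<close>-lattice are represented by functions on all of \<^typ>\<open>real\<close>; only their
  values at the points of \<open>q_lattice q\<close>, which is closed under multiplication and division by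
  \<open>q\<close>, are ever used.
\<close>

definition q_lattice :: "real \<Rightarrow> real set" where
  "q_lattice q = range (\<lambda>n::int. q powi n)"

definition q_deriv :: "real \<Rightarrow> (real \<Rightarrow> complex) \<Rightarrow> real \<Rightarrow> complex" where
  "q_deriv q f x = (f x - f (q * x)) / complex_of_real ((1 - q) * x)"

definition shifted_q_deriv :: "real \<Rightarrow> (real \<Rightarrow> complex) \<Rightarrow> real \<Rightarrow> complex" where
  "shifted_q_deriv q f x = q_deriv q f (x / q)"

definition q_laplace :: "real \<Rightarrow> (real \<Rightarrow> complex) \<Rightarrow> real \<Rightarrow> complex" where
  "q_laplace q f x = (1 / complex_of_real (x\<^sup>2)) *
     (f (x / q) - complex_of_real ((1 + q) / q) * f x + complex_of_real (1 / q) * f (q * x))"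

definition has_values_at_0 :: "real \<Rightarrow> (real \<Rightarrow> complex) \<Rightarrow> complex \<Rightarrow> complex \<Rightarrow> bool" where
  "has_values_at_0 q f a b \<longleftrightarrow>
     (\<lambda>n. f (q ^ n)) \<longlonglongrightarrow> a \<and> (\<lambda>n. (f (q ^ n) - a) / complex_of_real (q ^ n)) \<longlonglongrightarrow> b"

definition jackson_integral :: "real \<Rightarrow> (real \<Rightarrow> complex) \<Rightarrow> complex" where
  "jackson_integral q f =
     complex_of_real (1 - q) * (\<Sum>\<^sub>\<infinity>n::int. complex_of_real (q powi n) * f (q powi n))"

definition q_L2 :: "real \<Rightarrow> (real \<Rightarrow> complex) set" where
  "q_L2 q = {f. (\<lambda>n::int. q powi n * (cmod (f (q powi n)))\<^sup>2) summable_on UNIV}"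

text \<open>Here \<open>V\<close> is the potential.\<close>

definition SL_operator :: "real \<Rightarrow> (real \<Rightarrow> real) \<Rightarrow> (real \<Rightarrow> complex) \<Rightarrow> real \<Rightarrow> complex" where
  "SL_operator q V f x = complex_of_real (V x) * f x - q_laplace q f x"

definition SL_solution ::
    "real \<Rightarrow> (real \<Rightarrow> real) \<Rightarrow> complex \<Rightarrow> (real \<Rightarrow> complex) \<Rightarrow> bool" where
  "SL_solution q V \<mu> f \<longleftrightarrow>
     (\<forall>x\<in>q_lattice q. q_laplace q f x + (\<mu> - complex_of_real (V x)) * f x = 0)"

definition q_wronskian ::
    "real \<Rightarrow> (real \<Rightarrow> complex) \<Rightarrow> (real \<Rightarrow> complex) \<Rightarrow> real \<Rightarrow> complex" where
  "q_wronskian q F G x = complex_of_real ((1 - q)\<^sup>2 / q) *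
     (F x * shifted_q_deriv q G x - G x * shifted_q_deriv q F x)"

definition weyl_l ::
    "real \<Rightarrow> (real \<Rightarrow> complex \<Rightarrow> complex) \<Rightarrow> (real \<Rightarrow> complex \<Rightarrow> complex)
      \<Rightarrow> complex \<Rightarrow> real \<Rightarrow> real \<Rightarrow> complex" where
  "weyl_l q \<theta> \<phi> \<mu> b \<beta> =
     - ((\<theta> b \<mu> * complex_of_real (cos \<beta>)
           + shifted_q_deriv q (\<lambda>x. \<theta> x \<mu>) b * complex_of_real (sin \<beta>))
        / (\<phi> b \<mu> * complex_of_real (cos \<beta>)
           + shifted_q_deriv q (\<lambda>x. \<phi> x \<mu>) b * complex_of_real (sin \<beta>)))"

text \<open>The circles \<open>{weyl_l q \<theta> \<phi> \<mu> b \<beta> | \<beta>}\<close> shrink to the point \<open>z\<close> as \<open>b\<close> tends to infinity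
  along the lattice.\<close>

definition weyl_limit_point ::
    "real \<Rightarrow> (real \<Rightarrow> complex \<Rightarrow> complex) \<Rightarrow> (real \<Rightarrow> complex \<Rightarrow> complex)
      \<Rightarrow> complex \<Rightarrow> complex \<Rightarrow> bool" where
  "weyl_limit_point q \<theta> \<phi> \<mu> z \<longleftrightarrow>
     uniform_limit UNIV (\<lambda>k \<beta>. weyl_l q \<theta> \<phi> \<mu> (q powi (- int k)) \<beta>) (\<lambda>_. z) sequentially"

definition weyl_m_function ::
    "real \<Rightarrow> (real \<Rightarrow> complex \<Rightarrow> complex) \<Rightarrow> (real \<Rightarrow> complex \<Rightarrow> complex)
      \<Rightarrow> (complex \<Rightarrow> complex) \<Rightarrow> bool" where
  "weyl_m_function q \<theta> \<phi> m \<longleftrightarrow>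
     (\<exists>(b :: nat \<Rightarrow> real) (\<beta> :: nat \<Rightarrow> real).
        range b \<subseteq> q_lattice q \<and> filterlim b at_top sequentially \<and>
        (\<forall>\<mu>. \<mu> \<notin> \<real> \<longrightarrow>
           weyl_limit_point q \<theta> \<phi> \<mu> (m \<mu>) \<or>
           (\<lambda>j. weyl_l q \<theta> \<phi> \<mu> (b j) (\<beta> j)) \<longlonglongrightarrow> m \<mu>))"

definition weyl_psi ::
    "(real \<Rightarrow> complex \<Rightarrow> complex) \<Rightarrow> (real \<Rightarrow> complex \<Rightarrow> complex)
      \<Rightarrow> (complex \<Rightarrow> complex) \<Rightarrow> complex \<Rightarrow> real \<Rightarrow> complex" where
  "weyl_psi \<theta> \<phi> m \<mu> x = \<theta> x \<mu> + m \<mu> * \<phi> x \<mu>"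

text \<open>The residues of \<open>m\<close> are in fact positive reals, so that \<^const>\<open>csqrt\<close> is the usual root.\<close>

definition eigenfun ::
    "(real \<Rightarrow> complex \<Rightarrow> complex) \<Rightarrow> (complex \<Rightarrow> complex) \<Rightarrow> complex \<Rightarrow> real \<Rightarrow> complex" where
  "eigenfun \<phi> m \<mu> x = csqrt (residue m \<mu>) * \<phi> x \<mu>"

definition SL_domain ::
    "real \<Rightarrow> (real \<Rightarrow> real) \<Rightarrow> real \<Rightarrow> (complex \<Rightarrow> real \<Rightarrow> complex) \<Rightarrow> (real \<Rightarrow> complex) set" where
  "SL_domain q V \<alpha> \<psi> = {f \<in> q_L2 q.
     SL_operator q V f \<in> q_L2 q \<and>
     (\<exists>f0 f1. has_values_at_0 q f f0 f1 \<and>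
        f0 * complex_of_real (cos \<alpha>) + f1 * complex_of_real (sin \<alpha>) = 0) \<and>
     (\<forall>\<mu>. \<mu> \<notin> \<real> \<longrightarrow>
        (\<lambda>k. q_wronskian q (\<psi> \<mu>) f (q powi (- int k))) \<longlonglongrightarrow> 0)}"

end

theory Submission
  imports Defs
begin

text \<open>Sampling at the points \<open>q powi n\<close> turns the equation into a three-term recurrence on the integers,
  that is, an eigenvalue problem for a Jacobi operator in the space of sequences that are square
  summable for the weight \<open>w n = (1 - q) q powi n\<close>. The origin is the end \<open>n \<longlonglongrightarrow> \<infinity>\<close>; it is regular, because
  \<open>w\<close> is summable there and solutions have boundary values. Infinity is the end \<open>n \<longlonglongrightarrow> -\<infinity>\<close>, where either
  the limit-point or the limit-circle case may occur. The basic tool is the Wronskian: its increments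
  are \<open>(z - z') w u v\<close> for solutions \<open>u\<close>, \<open>v\<close> with parameters \<open>z\<close>, \<open>z'\<close>, so that Wronskians are
  the same thing as inner products over a tail of the lattice (\<open>green\<close>).

  \<^emph>\<open>Orthonormality.\<close> The solution \<open>theta + l phi\<close>, with \<open>l\<close> on the Weyl circle at a cut, satisfies a
  real boundary condition there, and this computes its squared norm up to the cut as
  \<open>- Im l / Im z\<close>. In the limit this bounds the norm of \<open>psi\<close> (\<open>psi_norm\<close>). Moreover the distance from \<open>m\<close> to \<open>l\<close> is controlled by the
  norm of \<open>phi\<close> up to the cut (\<open>circle_distance\<close>), which is strong enough to make the Wronskian of two
  functions \<open>psi\<close> vanish at infinity, without distinguishing the two cases. The result is
  \<open>(z - z') \<langle>psi z, psi z'\<rangle> = m z' - m z\<close> (\<open>pairing_psi_psi\<close>). Taking residues at poles of \<open>m\<close> in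
  both variables gives the orthogonality relations (\<open>pairing_phi_phi\<close>).

  \<^emph>\<open>Completeness.\<close> Let \<open>g\<close> be square summable and orthogonal to all eigenfunctions. The resolvent
  \<open>F z = \<langle>G n z, g\<rangle>\<close>, where \<open>G\<close> is the Green function at a fixed index \<open>n\<close>, is holomorphic off the real
  axis. The same Wronskian identities bound the square of the norm of \<open>G n z\<close> by \<open>- Im (G n z n) / Im z\<close>,
  so that \<open>F\<close> is bounded by a multiple of \<open>1 / \<bar>Im z\<bar>\<close> (\<open>green_fun_bound\<close>). At a real point \<open>F\<close> has at
  worst a simple pole, whose residue is a multiple of \<open>\<langle>phi, g\<rangle>\<close> at an eigenvalue and zero elsewhere.
  Hence \<open>F\<close> continues to an entire function, and its growth forces it to vanish
  (\<open>entire_Im_bound_zero\<close>). Applying the recurrence to the Green function gives a point mass, so \<open>g = 0\<close>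
  (\<open>eigfun_complete\<close>).

  \<^emph>\<open>Expansion.\<close> Bessel's inequality for \<open>f\<close> and for point masses makes the Fourier series of \<open>f\<close>
  converge at every index, and the difference between \<open>f\<close> and the sum is square summable and
  orthogonal to the eigenfunctions (\<open>fourier_remainder\<close>), hence zero.\<close>

section \<open>Holomorphic functions near the real axis\<close>

lemma eventually_vertical:
  assumes "open U" "z \<in> U"
  shows "\<forall>\<^sub>F y in at (0::real). z + \<i> * of_real y \<in> U"
  using assms
  by (intro topological_tendstoD[where l = z]) (auto intro!: tendsto_eq_intros)

lemma tendsto_along_line:
  assumes "f holomorphic_on U" "open U" "z \<in> U"
  shows "((\<lambda>y. f (z + c * of_real y)) \<longlongrightarrow> f z) (at (0::real))"
proof -
  have "isCont f z"
    using assms holomorphic_on_imp_continuous_on continuous_on_eq_continuous_at by blast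
  moreover have "((\<lambda>y. z + c * of_real y) \<longlongrightarrow> z) (at (0::real))"
    by (auto intro!: tendsto_eq_intros)
  ultimately show ?thesis using isCont_tendsto_compose by blast
qed

text \<open>Every identity at a real point is obtained as the limit of an identity at nonreal points, along
  a vertical line.\<close>
lemma limits_eq:
  fixes f g :: "real \<Rightarrow> complex"
  assumes "(f \<longlongrightarrow> a) (at 0)" "(g \<longlongrightarrow> b) (at 0)" "\<forall>\<^sub>F y in at 0. f y = g y"
  shows "a = b"
  using tendsto_unique[OF _ Lim_transform_eventually[OF assms(1,3)] assms(2)] by simp

lemma reflection_real:
  assumes P: "P holomorphic_on ball (of_real x) d"
    and refl: "\<And>z. z \<in> ball (of_real x) d \<Longrightarrow> z \<notin> \<real> \<Longrightarrow> P (cnj z) = cnj (P z)"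
    and t: "complex_of_real t \<in> ball (of_real x) d"
  shows "P (of_real t) \<in> \<real>"
proof -
  let ?t = "complex_of_real t"
  have 1: "((\<lambda>y. P (?t + \<i> * of_real y)) \<longlongrightarrow> P ?t) (at (0::real))"
    by (rule tendsto_along_line[OF P open_ball t])
  have "((\<lambda>y. cnj (P (?t + \<i> * of_real y))) \<longlongrightarrow> cnj (P ?t)) (at (0::real))"
    by (intro tendsto_intros 1)
  moreover have "((\<lambda>y. P (?t + (- \<i>) * of_real y)) \<longlongrightarrow> P ?t) (at (0::real))"
    by (rule tendsto_along_line[OF P open_ball t])
  moreover have "\<forall>\<^sub>F y in at (0::real). cnj (P (?t + \<i> * of_real y)) = P (?t + (- \<i>) * of_real y)"
    using eventually_vertical[OF open_ball t] eventually_neq_at_within[of 0]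
  proof eventually_elim
    case (elim y)
    then have "?t + \<i> * of_real y \<notin> \<real>" by (auto simp: complex_is_Real_iff)
    from refl[OF elim(1) this] show ?case by simp
  qed
  ultimately have "cnj (P ?t) = P ?t"
    by (rule limits_eq)
  then show ?thesis by (metis Reals_cnj_iff)
qed

text \<open>\<open>P\<close> is real on the real axis, so \<open>Im (P z)\<close> is at most a multiple of \<open>\<bar>Im z\<bar>\<close>. The product is, up to
  the factor \<open>(cmod (z - x))\<^sup>2\<close>, the imaginary part of \<open>P z / (z - x)\<close>: a function with a simple pole
  at \<open>x\<close> becomes harmless after division of its imaginary part by \<open>Im z\<close> and multiplication by this
  factor.\<close>
lemma reflection_Im_bound:
  assumes d: "0 < d" and P: "P holomorphic_on ball (of_real x) d"
    and refl: "\<And>z. z \<in> ball (of_real x) d \<Longrightarrow> z \<notin> \<real> \<Longrightarrow> P (cnj z) = cnj (P z)"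
  obtains e B where "0 < e" "e \<le> d"
    "\<And>z. z \<in> ball (of_real x) e \<Longrightarrow> \<bar>Im (P z * cnj (z - of_real x))\<bar> \<le> B * \<bar>Im z\<bar>"
proof -
  let ?S = "cball (complex_of_real x) (d / 2)"
  have S: "?S \<subseteq> ball (of_real x) d" using d by auto
  have "continuous_on ?S P"
    using P S holomorphic_on_imp_continuous_on holomorphic_on_subset by blast
  then obtain B1 where B1: "\<And>z. z \<in> ?S \<Longrightarrow> cmod (P z) \<le> B1"
    by (metis compact_cball compact_continuous_image compact_imp_bounded bounded_iff imageI)
  have "continuous_on ?S (deriv P)"
    using holomorphic_deriv[OF P] S holomorphic_on_imp_continuous_on holomorphic_on_subset by blast
  then obtain B2 where B2: "\<And>z. z \<in> ?S \<Longrightarrow> cmod (deriv P z) \<le> B2"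
    by (metis compact_cball compact_continuous_image compact_imp_bounded bounded_iff imageI)
  have "\<bar>Im (P z * cnj (z - of_real x))\<bar> \<le> (B2 * d + B1) * \<bar>Im z\<bar>"
    if z: "z \<in> ball (of_real x) (d / 2)" for z
  proof -
    let ?t = "complex_of_real (Re z)"
    have "\<bar>Re (z - of_real x)\<bar> \<le> cmod (z - of_real x)" by (rule abs_Re_le_cmod)
    then have zx: "\<bar>Re z - x\<bar> < d / 2" using z by (simp add: dist_norm norm_minus_commute)
    then have t: "?t \<in> ?S" by (simp add: dist_norm abs_minus_commute flip: of_real_diff)
    have "cmod (P z - P ?t) \<le> B2 * cmod (z - ?t)"
    proof (rule field_differentiable_bound[OF convex_cball _ B2])
      fix y assume "y \<in> ?S"
      then have "y \<in> ball (of_real x) d" using S by blast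
      then have "P field_differentiable at y"
        using P holomorphic_on_imp_differentiable_at by blast
      then show "(P has_field_derivative deriv P y) (at y within ?S)"
        by (simp add: DERIV_deriv_iff_field_differentiable has_field_derivative_at_within)
    qed (use z t in auto)
    moreover have "z - ?t = \<i> * of_real (Im z)" by (simp add: complex_eq_iff)
    ultimately have "cmod (P z - P ?t) \<le> B2 * \<bar>Im z\<bar>" by (simp add: norm_mult)
    moreover have "Im (P ?t) = 0"
      using reflection_real[OF P refl, of "Re z"] t S complex_is_Real_iff by blast
    ultimately have I: "\<bar>Im (P z)\<bar> \<le> B2 * \<bar>Im z\<bar>"
      using abs_Im_le_cmod[of "P z - P ?t"] by simp
    have "\<bar>Im (P z * cnj (z - of_real x))\<bar> = \<bar>Im (P z) * (Re z - x) - Re (P z) * Im z\<bar>"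
      by (simp add: algebra_simps)
    also have "\<dots> \<le> \<bar>Im (P z)\<bar> * \<bar>Re z - x\<bar> + \<bar>Re (P z)\<bar> * \<bar>Im z\<bar>"
      by (metis abs_mult abs_triangle_ineq4)
    also have "\<dots> \<le> (B2 * \<bar>Im z\<bar>) * d + B1 * \<bar>Im z\<bar>"
    proof (intro add_mono mult_mono)
      show "\<bar>Re z - x\<bar> \<le> d" using zx d by linarith
      show "0 \<le> B2 * \<bar>Im z\<bar>" using I by linarith
      show "\<bar>Re (P z)\<bar> \<le> B1" using B1[of z] abs_Re_le_cmod[of "P z"] z by auto
      then show "0 \<le> B1" by linarith
    qed (use I in auto)
    finally show ?thesis by (simp add: algebra_simps)
  qed
  then show thesis using that[of "d / 2" "B2 * d + B1"] d by simp
qed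

text \<open>The local extensions agree where they overlap, because each is the limit of \<open>F\<close> along vertical lines.\<close>
lemma glue_across_reals:
  assumes F: "F holomorphic_on - \<real>"
    and loc: "\<And>x::real. \<exists>d H. 0 < d \<and> H holomorphic_on ball (of_real x) d \<and>
      (\<forall>z \<in> ball (of_real x) d - \<real>. H z = F z)"
  obtains G where "G holomorphic_on UNIV" "\<And>z. z \<notin> \<real> \<Longrightarrow> G z = F z"
proof -
  obtain d H where d: "\<And>x::real. 0 < d x"
    and H: "\<And>x. H x holomorphic_on ball (of_real x) (d x)"
    and eq: "\<And>x z. z \<in> ball (of_real x) (d x) - \<real> \<Longrightarrow> H x z = F z"
    using loc by metis
  define G where "G z = (if z \<in> \<real> then H (Re z) z else F z)" for z
  have G_eq: "G z = H x z" if z: "z \<in> ball (of_real x) (d x)" for x z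
  proof (cases "z \<in> \<real>")
    case True
    define t where "t = Re z"
    have zt: "z = of_real t" using True by (simp add: t_def complex_is_Real_iff complex_eq_iff)
    have ball: "z \<in> ball (of_real t) (d t)" using d zt by simp
    have "((\<lambda>y. H t (z + \<i> * of_real y)) \<longlongrightarrow> H t z) (at (0::real))"
      by (rule tendsto_along_line[OF H open_ball ball])
    moreover have "((\<lambda>y. H x (z + \<i> * of_real y)) \<longlongrightarrow> H x z) (at (0::real))"
      by (rule tendsto_along_line[OF H open_ball z])
    moreover have "\<forall>\<^sub>F y in at (0::real). H t (z + \<i> * of_real y) = H x (z + \<i> * of_real y)"
      using eventually_vertical[OF open_ball z] eventually_vertical[OF open_ball ball]
        eventually_neq_at_within[of 0]
    proof eventually_elim
      case (elim y)
      then have "z + \<i> * of_real y \<notin> \<real>" using zt by (auto simp: complex_is_Real_iff)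
      with elim eq show ?case by (metis DiffI)
    qed
    ultimately have "H t z = H x z"
      by (rule limits_eq)
    then show ?thesis using True by (simp add: G_def t_def)
  qed (use z eq in \<open>auto simp: G_def\<close>)
  have "G field_differentiable at z" for z
  proof (cases "z \<in> \<real>")
    case True
    then obtain x where x: "z = of_real x" by (auto elim: Reals_cases)
    have "G holomorphic_on ball (of_real x) (d x)"
      by (rule holomorphic_transform[OF H[of x]]) (simp add: G_eq)
    then show ?thesis
      by (rule holomorphic_on_imp_differentiable_at) (use x d in auto)
  next
    case False
    have op: "open (- \<real> :: complex set)" using closed_complex_Reals by auto
    have "G holomorphic_on - \<real>"
      by (rule holomorphic_transform[OF F]) (auto simp: G_def)
    then show ?thesis
      by (rule holomorphic_on_imp_differentiable_at[OF _ op]) (use False in auto)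
  qed
  then have "G holomorphic_on UNIV" by (simp add: holomorphic_on_open field_differentiable_def)
  moreover have "G z = F z" if "z \<notin> \<real>" for z using that by (simp add: G_def)
  ultimately show thesis using that by blast
qed

text \<open>Multiplying by \<open>z\<^sup>2 - R\<^sup>2\<close> cancels the possible singularities at \<open>\<plusminus>R\<close> of the bound on the circle of
  radius \<open>R\<close>, which leaves a bound of order \<open>R\<close> there; at a fixed point the factor is of order \<open>R\<^sup>2\<close>.\<close>
lemma entire_Im_bound_zero:
  assumes F: "F holomorphic_on UNIV"
    and bd: "\<And>z. z \<notin> \<real> \<Longrightarrow> cmod (F z) \<le> C / \<bar>Im z\<bar>"
  shows "F z = 0"
proof (rule ccontr)
  assume nz: "F z \<noteq> 0"
  have C: "0 \<le> C" using order.trans[OF norm_ge_zero bd[of \<i>]] by (simp add: complex_is_Real_iff)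
  \<comment> \<open>So large that \<open>z\<close> lies in the disc of radius \<open>R / 2\<close> and that the bounds below contradict each other.\<close>
  define R where "R = 2 * cmod z + 8 * C / (3 * cmod (F z)) + 1"
  have "8 * C / (3 * cmod (F z)) \<ge> 0" using C by simp
  then have R: "0 < R" "2 * cmod z \<le> R" "8 * C / (3 * cmod (F z)) < R"
    unfolding R_def using norm_ge_zero[of z] by linarith+
  \<comment> \<open>On the circle of radius \<open>R\<close> the factor is \<open>w (w - cnj w)\<close>, which absorbs the bound.\<close>
  let ?h = "\<lambda>w. (w\<^sup>2 - of_real (R\<^sup>2)) * F w"
  have "cmod (?h z) \<le> 2 * R * C"
  proof (rule maximum_modulus_frontier[of ?h "ball 0 R"])
    show "?h holomorphic_on interior (ball 0 R)"
      by (intro holomorphic_intros holomorphic_on_subset[OF F]) auto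
    show "continuous_on (closure (ball 0 R)) ?h"
      by (intro continuous_intros continuous_on_subset[OF holomorphic_on_imp_continuous_on[OF F]]) auto
    fix w :: complex assume "w \<in> frontier (ball 0 R)"
    then have w: "cmod w = R" using R by (simp add: frontier_ball)
    have "of_real (R\<^sup>2) = w * cnj w" by (simp add: w complex_norm_square[symmetric] flip: of_real_power)
    then have e: "w\<^sup>2 - of_real (R\<^sup>2) = w * (2 * \<i> * of_real (Im w))"
      by (simp add: power2_eq_square complex_eq_iff algebra_simps)
    show "cmod (?h w) \<le> 2 * R * C"
    proof (cases "w \<in> \<real>")
      case True
      then have "w\<^sup>2 - of_real (R\<^sup>2) = 0" by (simp only: e complex_is_Real_iff) simp
      then show ?thesis using R C by simp
    next
      case False
      then have "\<bar>Im w\<bar> > 0" by (simp add: complex_is_Real_iff)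
      have "cmod (?h w) = R * (2 * \<bar>Im w\<bar>) * cmod (F w)"
        by (simp only: e norm_mult w) simp
      also have "\<dots> \<le> R * (2 * \<bar>Im w\<bar>) * (C / \<bar>Im w\<bar>)"
        using R by (intro mult_left_mono bd False) auto
      finally show ?thesis using \<open>\<bar>Im w\<bar> > 0\<close> by simp
    qed
  qed (use R norm_ge_zero[of z] in auto)
  moreover have "R\<^sup>2 * (3 / 4) \<le> cmod (z\<^sup>2 - of_real (R\<^sup>2))"
  proof -
    have "(cmod z)\<^sup>2 \<le> (R / 2)\<^sup>2" using R by (intro power_mono) auto
    moreover have "cmod (of_real (R\<^sup>2)) - cmod (z\<^sup>2) \<le> cmod (z\<^sup>2 - of_real (R\<^sup>2))"
      by (metis norm_minus_commute norm_triangle_ineq2)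
    moreover have "cmod (of_real (R\<^sup>2)) = R\<^sup>2" by (simp add: norm_power)
    moreover have "(R / 2)\<^sup>2 = R\<^sup>2 / 4" by (simp add: power_divide)
    ultimately show ?thesis by (simp only: norm_power)
  qed
  ultimately have "R\<^sup>2 * (3 / 4) * cmod (F z) \<le> 2 * R * C"
    unfolding norm_mult by (meson mult_right_mono norm_ge_zero order.trans)
  then have "R * (R * (3 * cmod (F z))) \<le> R * (8 * C)" by (simp add: power2_eq_square algebra_simps)
  then have "R * (3 * cmod (F z)) \<le> 8 * C" using R by simp
  moreover have "8 * C < R * (3 * cmod (F z))" using R(3) nz by (simp add: field_simps)
  ultimately show False by simp
qed

text \<open>A pole of order at least two would violate the growth condition already along the vertical line
  through \<open>a\<close>.\<close>
lemma simple_pole_real: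
  assumes mero: "m meromorphic_on UNIV" and pole: "is_pole m a"
    and growth: "((\<lambda>y. of_real y ^ 2 * m (a + \<i> * of_real y)) \<longlongrightarrow> 0) (at (0::real))"
  obtains d M where "0 < d" "M holomorphic_on ball a d" "M a = residue m a" "residue m a \<noteq> 0"
    "\<And>z. z \<in> ball a d - {a} \<Longrightarrow> m z = M z / (z - a)"
proof -
  have "isolated_singularity_at m a"
    using mero by (intro meromorphic_on_isolated_singularity meromorphic_on_subset[OF mero]) auto
  then obtain r0 where r0: "r0 > 0" "m analytic_on ball a r0 - {a}"
    unfolding isolated_singularity_at_def by blast
  define g where "g = zor_poly m a"
  define k where "k = nat (- zorder m a)"
  have "zorder m a < 0 \<and> g a \<noteq> 0 \<and> (\<exists>r. r>0 \<and> cball a r \<subseteq> ball a r0 \<and> g holomorphic_on cball a r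
    \<and> (\<forall>w\<in>cball a r - {a}. m w  = g w / (w-a) ^ k \<and> g w \<noteq>0))"
    unfolding g_def k_def
    by (rule zorder_exist_pole) (use r0 pole analytic_imp_holomorphic in auto)
  then obtain r where k: "k > 0" and ga: "g a \<noteq> 0" and r: "r > 0" "g holomorphic_on cball a r"
    "\<And>w. w \<in> cball a r - {a} \<Longrightarrow> m w  = g w / (w-a) ^ k"
    unfolding k_def by auto
  have g: "g holomorphic_on ball a r" using r(2) ball_subset_cball holomorphic_on_subset by blast
  have "a \<in> ball a r" using r(1) by simp
  have "k = 1"
  proof (rule ccontr)
    assume "k \<noteq> 1"
    then obtain j where j: "k = j + 2" using k by (metis One_nat_def Suc_1 Suc_leI le_antisym add.commute le_Suc_ex not_less_eq_eq)
    have "((\<lambda>y. of_real y ^ j * (of_real y ^ 2 * m (a + \<i> * of_real y))) \<longlongrightarrow> of_real 0 ^ j * 0) (at (0::real))"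
      by (intro tendsto_intros growth)
    moreover have "\<forall>\<^sub>F y in at (0::real). of_real y ^ j * (of_real y ^ 2 * m (a + \<i> * of_real y))
        = g (a + \<i> * of_real y) / \<i> ^ k"
      using eventually_vertical[OF open_ball \<open>a \<in> ball a r\<close>] eventually_neq_at_within[of 0]
    proof eventually_elim
      case (elim y)
      then have "m (a + \<i> * of_real y) = g (a + \<i> * of_real y) / (\<i> * of_real y) ^ k"
        using r(3)[of "a + \<i> * of_real y"] by auto
      then show ?case using elim by (simp add: j power_mult_distrib power_add power2_eq_square)
    qed
    ultimately have "((\<lambda>y. g (a + \<i> * of_real y) / \<i> ^ k) \<longlongrightarrow> 0) (at (0::real))"
      using Lim_transform_eventually by fastforce
    moreover have "((\<lambda>y. g (a + \<i> * of_real y) / \<i> ^ k) \<longlongrightarrow> g a / \<i> ^ k) (at (0::real))"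
      by (intro tendsto_intros tendsto_along_line[OF g]) (use r in auto)
    ultimately have "g a / \<i> ^ k = 0" using tendsto_unique at_neq_bot by blast
    then show False using ga by simp
  qed
  then have eq: "m z = g z / (z - a)" if "z \<in> ball a r - {a}" for z using r(3)[of z] that by simp
  have "residue m a = residue (\<lambda>z. g z / (z - a)) a"
    by (intro residue_cong refl eventually_mono[OF eventually_at_in_open[of "ball a r" a]] eq)
       (use r in auto)
  also have "\<dots> = g a" by (rule residue_simple[OF open_ball _ g]) (use r in auto)
  finally have "g a = residue m a" by simp
  then show thesis using that[OF r(1) g _ _ eq] ga by simp
qed

lemma Im_divide_shift:
  assumes "z \<noteq> of_real x"
  shows "(cmod (z - of_real x))\<^sup>2 * Im (p / (z - of_real x)) = Im (p * cnj (z - of_real x))"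
proof -
  have "of_real ((cmod (z - of_real x))\<^sup>2) * (p / (z - of_real x)) = p * cnj (z - of_real x)"
    unfolding complex_norm_square using assms by simp
  then have "Im (of_real ((cmod (z - of_real x))\<^sup>2) * (p / (z - of_real x))) = Im (p * cnj (z - of_real x))"
    by (simp only:)
  then show ?thesis by (simp only: Im_complex_of_real Re_complex_of_real times_complex.sel)
qed

section \<open>Weighted square summable families\<close>

definition sq_summable :: "('i \<Rightarrow> real) \<Rightarrow> ('i \<Rightarrow> complex) \<Rightarrow> bool" where
  "sq_summable w u \<longleftrightarrow> (\<lambda>i. w i * (cmod (u i))\<^sup>2) summable_on UNIV"

definition sq_norm :: "('i \<Rightarrow> real) \<Rightarrow> ('i \<Rightarrow> complex) \<Rightarrow> real" where
  "sq_norm w u = (\<Sum>\<^sub>\<infinity>i. w i * (cmod (u i))\<^sup>2)"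

text \<open>The pairing is bilinear, without conjugation, so that pairings of holomorphic families are
  holomorphic. For the real-valued eigenfunctions it agrees with the inner product.\<close>
definition pairing :: "('i \<Rightarrow> real) \<Rightarrow> ('i \<Rightarrow> complex) \<Rightarrow> ('i \<Rightarrow> complex) \<Rightarrow> complex" where
  "pairing w u v = (\<Sum>\<^sub>\<infinity>i. of_real (w i) * (u i * v i))"

locale weight =
  fixes w :: "'i \<Rightarrow> real"
  assumes w_nonneg: "0 \<le> w i"
begin

lemma sum_le_sq_norm:
  assumes "sq_summable w u" "finite F"
  shows "(\<Sum>i\<in>F. w i * (cmod (u i))\<^sup>2) \<le> sq_norm w u"
  unfolding sq_norm_def
  by (rule finite_sum_le_infsum)
     (use assms w_nonneg in \<open>auto simp: sq_summable_def\<close>)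

lemma sq_norm_nonneg: "0 \<le> sq_norm w u"
  unfolding sq_norm_def by (rule infsum_nonneg) (simp add: w_nonneg)

lemma sq_summable_boundI:
  assumes "\<And>F. finite F \<Longrightarrow> (\<Sum>i\<in>F. w i * (cmod (u i))\<^sup>2) \<le> B"
  shows "sq_summable w u" "sq_norm w u \<le> B"
proof -
  show s: "sq_summable w u"
    unfolding sq_summable_def
    by (rule nonneg_bdd_above_summable_on)
       (use assms w_nonneg in \<open>auto intro!: bdd_aboveI2[where M = B]\<close>)
  show "sq_norm w u \<le> B"
    unfolding sq_norm_def
    by (rule infsum_le_finite_sums) (use s assms in \<open>auto simp: sq_summable_def\<close>)
qed

lemma sq_summable_mono:
  assumes "sq_summable w v" "\<And>i. cmod (u i) \<le> cmod (v i)"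
  shows "sq_summable w u" "sq_norm w u \<le> sq_norm w v"
proof -
  have "(\<Sum>i\<in>F. w i * (cmod (u i))\<^sup>2) \<le> sq_norm w v" if "finite F" for F
    by (rule order.trans[OF sum_mono sum_le_sq_norm[OF assms(1) that]])
       (use assms(2) w_nonneg in \<open>auto intro!: mult_left_mono power_mono\<close>)
  then show "sq_summable w u" "sq_norm w u \<le> sq_norm w v"
    using sq_summable_boundI by blast+
qed

lemma sum_cauchy_schwarz:
  "(\<Sum>i\<in>F. w i * (cmod (u i) * cmod (v i)))
     \<le> sqrt (\<Sum>i\<in>F. w i * (cmod (u i))\<^sup>2) * sqrt (\<Sum>i\<in>F. w i * (cmod (v i))\<^sup>2)"
proof -
  have "(\<Sum>i\<in>F. \<bar>sqrt (w i) * cmod (u i)\<bar> * \<bar>sqrt (w i) * cmod (v i)\<bar>)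
          \<le> L2_set (\<lambda>i. sqrt (w i) * cmod (u i)) F * L2_set (\<lambda>i. sqrt (w i) * cmod (v i)) F"
    by (rule L2_set_mult_ineq)
  moreover have "\<bar>sqrt (w i) * cmod (u i)\<bar> * \<bar>sqrt (w i) * cmod (v i)\<bar>
      = w i * (cmod (u i) * cmod (v i))" for i
    using w_nonneg[of i] by (simp add: abs_mult algebra_simps)
  ultimately show ?thesis
    by (simp only: L2_set_def power_mult_distrib real_sqrt_pow2[OF w_nonneg])
qed

lemma pairing_summable:
  assumes u: "sq_summable w u" and v: "sq_summable w v"
  shows "(\<lambda>i. cmod (of_real (w i) * (u i * v i))) summable_on UNIV"
proof (rule nonneg_bdd_above_summable_on)
  show "bdd_above (sum (\<lambda>i. norm (complex_of_real (w i) * (u i * v i))) ` {F. F \<subseteq> UNIV \<and> finite F})"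
  proof (rule bdd_aboveI2)
    fix F :: "'i set" assume "F \<in> {F. F \<subseteq> UNIV \<and> finite F}"
    then have F: "finite F" by simp
    have "(\<Sum>i\<in>F. norm (complex_of_real (w i) * (u i * v i)))
        = (\<Sum>i\<in>F. w i * (cmod (u i) * cmod (v i)))"
      by (simp add: norm_mult w_nonneg)
    also have "\<dots> \<le> sqrt (sq_norm w u) * sqrt (sq_norm w v)"
      by (rule order.trans[OF sum_cauchy_schwarz])
         (intro mult_mono real_sqrt_le_mono sum_le_sq_norm u v F,
          auto intro!: sum_nonneg simp: w_nonneg sq_norm_nonneg)
    finally show "(\<Sum>i\<in>F. norm (complex_of_real (w i) * (u i * v i)))
      \<le> sqrt (sq_norm w u) * sqrt (sq_norm w v)" .
  qed
qed auto

lemma pairing_minus_sum_le: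
  assumes u: "sq_summable w u" and v: "sq_summable w v" and F: "finite F"
  shows "cmod (pairing w u v - (\<Sum>i\<in>F. of_real (w i) * (u i * v i)))
    \<le> sqrt (sq_norm w u) * sqrt (sq_norm w v - (\<Sum>i\<in>F. w i * (cmod (v i))\<^sup>2))"
proof -
  let ?t = "\<lambda>i. complex_of_real (w i) * (u i * v i)"
  have abs: "(\<lambda>i. cmod (?t i)) summable_on UNIV" using u v by (rule pairing_summable)
  then have abs': "(\<lambda>i. cmod (?t i)) summable_on - F"
    by (rule summable_on_subset_banach) auto
  have "pairing w u v = infsum ?t F + infsum ?t (- F)"
    unfolding pairing_def using infsum_Un_disjoint[of ?t F "- F"] abs' F
    by (simp add: abs_summable_summable summable_on_finite)
  then have "cmod (pairing w u v - sum ?t F) = cmod (infsum ?t (- F))"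
    using F by simp
  also have "\<dots> \<le> infsum (\<lambda>i. cmod (?t i)) (- F)"
    using abs' by (rule norm_infsum_bound)
  also have "\<dots> \<le> sqrt (sq_norm w u) * sqrt (sq_norm w v - (\<Sum>i\<in>F. w i * (cmod (v i))\<^sup>2))"
  proof (rule infsum_le_finite_sums[OF abs'])
    fix G assume G: "finite G" "G \<subseteq> - F"
    have "(\<Sum>i\<in>G. w i * (cmod (v i))\<^sup>2) + (\<Sum>i\<in>F. w i * (cmod (v i))\<^sup>2)
        = (\<Sum>i\<in>G \<union> F. w i * (cmod (v i))\<^sup>2)"
      by (rule sum.union_disjoint[symmetric]) (use G F in auto)
    also have "\<dots> \<le> sq_norm w v" using v G F by (intro sum_le_sq_norm) auto
    finally have vG: "(\<Sum>i\<in>G. w i * (cmod (v i))\<^sup>2) \<le> sq_norm w v - (\<Sum>i\<in>F. w i * (cmod (v i))\<^sup>2)"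
      by simp
    have "(\<Sum>i\<in>G. cmod (?t i)) = (\<Sum>i\<in>G. w i * (cmod (u i) * cmod (v i)))"
      by (simp add: norm_mult w_nonneg)
    also have "\<dots> \<le> sqrt (\<Sum>i\<in>G. w i * (cmod (u i))\<^sup>2) * sqrt (\<Sum>i\<in>G. w i * (cmod (v i))\<^sup>2)"
      by (rule sum_cauchy_schwarz)
    also have "\<dots> \<le> sqrt (sq_norm w u) * sqrt (sq_norm w v - (\<Sum>i\<in>F. w i * (cmod (v i))\<^sup>2))"
      using vG by (intro mult_mono real_sqrt_le_mono sum_le_sq_norm u G)
        (auto intro!: sum_nonneg simp: w_nonneg sq_norm_nonneg)
    finally show "(\<Sum>i\<in>G. cmod (?t i))
      \<le> sqrt (sq_norm w u) * sqrt (sq_norm w v - (\<Sum>i\<in>F. w i * (cmod (v i))\<^sup>2))" .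
  qed
  finally show ?thesis .
qed

lemma cauchy_schwarz:
  assumes "sq_summable w u" "sq_summable w v"
  shows "cmod (pairing w u v) \<le> sqrt (sq_norm w u) * sqrt (sq_norm w v)"
  using pairing_minus_sum_le[OF assms, of "{}"] by simp

lemma pairing_commute: "pairing w u v = pairing w v u"
  by (simp add: pairing_def mult.commute)

lemma pairing_cnj:
  assumes "sq_summable w u"
  shows "pairing w u (\<lambda>i. cnj (u i)) = of_real (sq_norm w u)"
proof -
  have "((\<lambda>i. w i * (cmod (u i))\<^sup>2) has_sum sq_norm w u) UNIV"
    using assms by (simp add: sq_summable_def sq_norm_def)
  then have "((\<lambda>i. complex_of_real (w i * (cmod (u i))\<^sup>2)) has_sum of_real (sq_norm w u)) UNIV"
    by (rule has_sum_of_real)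
  moreover have "complex_of_real (w i * (cmod (u i))\<^sup>2) = of_real (w i) * (u i * cnj (u i))" for i
    by (simp only: of_real_mult complex_norm_square)
  ultimately show ?thesis unfolding pairing_def by (simp only: infsumI)
qed

lemma small_tail:
  assumes "sq_summable w v" "0 < e"
  obtains F where "finite F" "sq_norm w v - (\<Sum>i\<in>F. w i * (cmod (v i))\<^sup>2) < e"
proof -
  have "((\<lambda>i. w i * (cmod (v i))\<^sup>2) has_sum sq_norm w v) UNIV"
    using assms(1) by (simp add: sq_summable_def sq_norm_def)
  then have "eventually (\<lambda>F. dist (\<Sum>i\<in>F. w i * (cmod (v i))\<^sup>2) (sq_norm w v) < e)
      (finite_subsets_at_top UNIV)"
    unfolding has_sum_def using assms(2) by (rule tendstoD)
  then obtain F where "finite F" "dist (\<Sum>i\<in>F. w i * (cmod (v i))\<^sup>2) (sq_norm w v) < e"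
    by (auto simp: eventually_finite_subsets_at_top)
  then show thesis using that[of F] by (auto simp: dist_real_def)
qed

text \<open>Against a fixed \<open>v\<close>, one finite set of indices serves all \<open>u\<close> with a common bound. Both the weak limit
  and the holomorphy of pairings rest on this.\<close>
lemma uniform_approx:
  assumes v: "sq_summable w v" and e: "0 < e"
  obtains F where "finite F"
    "\<And>u. sq_summable w u \<Longrightarrow> sq_norm w u \<le> B \<Longrightarrow>
       cmod (pairing w u v - (\<Sum>i\<in>F. of_real (w i) * (u i * v i))) < e"
proof -
  \<comment> \<open>The estimate divides by the bound, and \<open>B\<close> may be zero.\<close>
  define B' where "B' = max B 1"
  have B': "B' > 0" by (simp add: B'_def)
  obtain F where F: "finite F" "sq_norm w v - (\<Sum>i\<in>F. w i * (cmod (v i))\<^sup>2) < e\<^sup>2 / B'"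
    using small_tail[OF v, of "e\<^sup>2 / B'"] e B' by auto
  have "cmod (pairing w u v - (\<Sum>i\<in>F. of_real (w i) * (u i * v i))) < e"
    if u: "sq_summable w u" and b: "sq_norm w u \<le> B" for u
  proof -
    have "cmod (pairing w u v - (\<Sum>i\<in>F. of_real (w i) * (u i * v i)))
      \<le> sqrt (sq_norm w u) * sqrt (sq_norm w v - (\<Sum>i\<in>F. w i * (cmod (v i))\<^sup>2))"
      by (rule pairing_minus_sum_le[OF u v F(1)])
    also have "\<dots> \<le> sqrt B' * sqrt (sq_norm w v - (\<Sum>i\<in>F. w i * (cmod (v i))\<^sup>2))"
      using b sum_le_sq_norm[OF v F(1)] by (intro mult_right_mono) (auto simp: B'_def)
    also have "\<dots> < sqrt B' * sqrt (e\<^sup>2 / B')"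
      using F(2) B' by (intro mult_strict_left_mono real_sqrt_less_mono) auto
    also have "\<dots> = e" using B' e by (simp add: real_sqrt_divide)
    finally show ?thesis .
  qed
  with F(1) show thesis using that by blast
qed

lemma bounded_pointwise_limit:
  assumes Fl: "Fl \<noteq> bot"
    and bd: "eventually (\<lambda>j. sq_summable w (X j) \<and> sq_norm w (X j) \<le> B j) Fl"
    and B: "(B \<longlongrightarrow> C) Fl"
    and lim: "\<And>i. ((\<lambda>j. X j i) \<longlongrightarrow> Y i) Fl"
  shows "sq_summable w Y" "sq_norm w Y \<le> C"
proof -
  have "(\<Sum>i\<in>F. w i * (cmod (Y i))\<^sup>2) \<le> C" if F: "finite F" for F
  proof (rule tendsto_le[OF Fl B])
    show "((\<lambda>j. \<Sum>i\<in>F. w i * (cmod (X j i))\<^sup>2) \<longlongrightarrow> (\<Sum>i\<in>F. w i * (cmod (Y i))\<^sup>2)) Fl"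
      by (intro tendsto_intros lim)
    show "\<forall>\<^sub>F j in Fl. (\<Sum>i\<in>F. w i * (cmod (X j i))\<^sup>2) \<le> B j"
      using bd by eventually_elim (use sum_le_sq_norm[OF _ F] in force)
  qed
  then show "sq_summable w Y" "sq_norm w Y \<le> C" using sq_summable_boundI by blast+
qed

text \<open>The families in this proof are only known to be bounded and to converge at each index. By
  \<open>uniform_approx\<close> that is enough for pairings against a fixed sequence.\<close>
lemma weak_limit:
  assumes Fl: "Fl \<noteq> bot"
    and bd: "eventually (\<lambda>j. sq_summable w (X j) \<and> sq_norm w (X j) \<le> B) Fl"
    and lim: "\<And>i. ((\<lambda>j. X j i) \<longlongrightarrow> Y i) Fl"
    and v: "sq_summable w v"
  shows "((\<lambda>j. pairing w (X j) v) \<longlongrightarrow> pairing w Y v) Fl"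
proof (rule tendstoI)
  fix e :: real assume e: "e > 0"
  note Y = bounded_pointwise_limit[OF Fl bd tendsto_const lim]
  obtain F where F: "finite F"
    "\<And>u. sq_summable w u \<Longrightarrow> sq_norm w u \<le> B \<Longrightarrow>
       cmod (pairing w u v - (\<Sum>i\<in>F. of_real (w i) * (u i * v i))) < e / 3"
    using uniform_approx[OF v, of "e / 3" B] e by (auto simp del: less_divide_eq_numeral1)
  have "((\<lambda>j. \<Sum>i\<in>F. of_real (w i) * (X j i * v i)) \<longlongrightarrow> (\<Sum>i\<in>F. of_real (w i) * (Y i * v i))) Fl"
    by (intro tendsto_intros lim)
  then have "\<forall>\<^sub>F j in Fl. dist (\<Sum>i\<in>F. of_real (w i) * (X j i * v i))
      (\<Sum>i\<in>F. of_real (w i) * (Y i * v i)) < e / 3"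
    using e by (intro tendstoD) auto
  with bd show "\<forall>\<^sub>F j in Fl. dist (pairing w (X j) v) (pairing w Y v) < e"
  proof eventually_elim
    case (elim j)
    have "dist (pairing w (X j) v) (\<Sum>i\<in>F. of_real (w i) * (X j i * v i)) < e / 3"
      "dist (\<Sum>i\<in>F. of_real (w i) * (Y i * v i)) (pairing w Y v) < e / 3"
      using F(2)[of "X j"] F(2)[OF Y] elim by (auto simp: dist_norm norm_minus_commute)
    with elim(2) show ?case
      by (meson dist_triangle_third)
  qed
qed

text \<open>The norm bounds for \<open>psi\<close> and for the Green function hold off the real axis only; continuity carries
  them to real points.\<close>
lemma bound_extends_to_reals:
  assumes U: "open U"
    and hol: "\<And>i. (\<lambda>z. X z i) holomorphic_on U"
    and bd: "\<And>z F. z \<in> U \<Longrightarrow> z \<notin> \<real> \<Longrightarrow> finite F \<Longrightarrow> (\<Sum>i\<in>F. w i * (cmod (X z i))\<^sup>2) \<le> B"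
    and z: "z \<in> U"
  shows "sq_summable w (X z)" "sq_norm w (X z) \<le> B"
proof -
  have "(\<Sum>i\<in>F. w i * (cmod (X z i))\<^sup>2) \<le> B" if F: "finite F" for F
  proof (rule tendsto_upperbound)
    show "((\<lambda>y. \<Sum>i\<in>F. w i * (cmod (X (z + \<i> * of_real y) i))\<^sup>2)
        \<longlongrightarrow> (\<Sum>i\<in>F. w i * (cmod (X z i))\<^sup>2)) (at (0::real))"
      by (intro tendsto_intros tendsto_along_line[OF hol U z])
    have "\<forall>\<^sub>F y in at (0::real). y \<noteq> - Im z"
      by (cases "Im z = 0")
         (auto simp: eventually_at_filter
               intro!: eventually_mono[OF t1_space_nhds[of 0 "- Im z"]])
    with eventually_vertical[OF U z]
    show "\<forall>\<^sub>F y in at (0::real). (\<Sum>i\<in>F. w i * (cmod (X (z + \<i> * of_real y) i))\<^sup>2) \<le> B"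
    proof eventually_elim
      case (elim y)
      then have "z + \<i> * of_real y \<notin> \<real>" by (auto simp: complex_is_Real_iff)
      with elim bd F show ?case by blast
    qed
  qed simp
  then show "sq_summable w (X z)" "sq_norm w (X z) \<le> B" using sq_summable_boundI by blast+
qed

lemma pairing_holomorphic:
  assumes U: "open U"
    and hol: "\<And>i. (\<lambda>z. X z i) holomorphic_on U"
    and bd: "\<And>z F. z \<in> U \<Longrightarrow> z \<notin> \<real> \<Longrightarrow> finite F \<Longrightarrow> (\<Sum>i\<in>F. w i * (cmod (X z i))\<^sup>2) \<le> B"
    and v: "sq_summable w v"
  shows "(\<lambda>z. pairing w (X z) v) holomorphic_on U"
proof -
  obtain F where F: "\<And>k. finite (F k)"
    "\<And>k u. sq_summable w u \<Longrightarrow> sq_norm w u \<le> B \<Longrightarrow>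
       cmod (pairing w u v - (\<Sum>i\<in>F k. of_real (w i) * (u i * v i))) < inverse (Suc k)"
  proof -
    have "\<exists>F. finite F \<and> (\<forall>u. sq_summable w u \<longrightarrow> sq_norm w u \<le> B \<longrightarrow>
       cmod (pairing w u v - (\<Sum>i\<in>F. of_real (w i) * (u i * v i))) < inverse (Suc k))" for k
      using uniform_approx[OF v, of "inverse (Suc k)" B] by (metis inverse_positive_iff_positive of_nat_0_less_iff zero_less_Suc)
    then show thesis using that by metis
  qed
  have "uniform_limit U (\<lambda>k z. \<Sum>i\<in>F k. of_real (w i) * (X z i * v i))
      (\<lambda>z. pairing w (X z) v) sequentially"
  proof (rule uniform_limitI)
    fix e :: real assume "e > 0"
    with reals_Archimedean obtain k0 where k0: "inverse (real (Suc k0)) < e" by blast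
    show "\<forall>\<^sub>F k in sequentially. \<forall>z\<in>U.
        dist (\<Sum>i\<in>F k. of_real (w i) * (X z i * v i)) (pairing w (X z) v) < e"
      using eventually_ge_at_top[of k0]
    proof eventually_elim
      case (elim k)
      then have "inverse (real (Suc k)) \<le> inverse (real (Suc k0))"
        by (intro le_imp_inverse_le) auto
      with k0 have e: "inverse (real (Suc k)) < e" by linarith
      show ?case
      proof
        fix z assume z: "z \<in> U"
        have "sq_summable w (X z)" "sq_norm w (X z) \<le> B"
          using bound_extends_to_reals[OF U hol bd z] by blast+
        then have "cmod (pairing w (X z) v - (\<Sum>i\<in>F k. of_real (w i) * (X z i * v i))) < inverse (Suc k)"
          by (rule F(2))
        then show "dist (\<Sum>i\<in>F k. of_real (w i) * (X z i * v i)) (pairing w (X z) v) < e"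
          using e by (simp add: dist_norm norm_minus_commute)
      qed
    qed
  qed
  then have lim: "\<exists>d>0. cball z d \<subseteq> U \<and> uniform_limit (cball z d)
      (\<lambda>k z. \<Sum>i\<in>F k. of_real (w i) * (X z i * v i)) (\<lambda>z. pairing w (X z) v) sequentially"
    if "z \<in> U" for z
    using that U by (meson open_contains_cball uniform_limit_on_subset)
  show ?thesis
    by (rule holomorphic_uniform_sequence[OF U _ lim]) (intro holomorphic_intros hol)
qed

text \<open>The bound is the form in which a norm of the type \<open>- Im m / Im z\<close> appears after multiplication by
  \<open>(cmod (z - x))\<^sup>2\<close>, if \<open>m\<close> has at most a simple pole at \<open>x\<close> and \<open>P z = (z - x) m z\<close>. By reflection
  it stays bounded as \<open>z\<close> approaches the real axis.\<close>
lemma pairing_holomorphic_near_real: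
  assumes d: "0 < d" and P: "P holomorphic_on ball (of_real x) d"
    and refl: "\<And>z. z \<in> ball (of_real x) d \<Longrightarrow> z \<notin> \<real> \<Longrightarrow> P (cnj z) = cnj (P z)"
    and hol: "\<And>i. (\<lambda>z. X z i) holomorphic_on ball (of_real x) d"
    and bd: "\<And>z. z \<in> ball (of_real x) d \<Longrightarrow> z \<notin> \<real> \<Longrightarrow> sq_summable w (X z) \<and>
      sq_norm w (X z) \<le> - Im (P z * cnj (z - of_real x)) / Im z"
  obtains e where "0 < e" "e \<le> d" "sq_summable w (X (of_real x))"
    "\<And>v. sq_summable w v \<Longrightarrow> (\<lambda>z. pairing w (X z) v) holomorphic_on ball (of_real x) e"
proof -
  obtain e B where e: "0 < e" "e \<le> d"
    and B: "\<And>z. z \<in> ball (of_real x) e \<Longrightarrow> \<bar>Im (P z * cnj (z - of_real x))\<bar> \<le> B * \<bar>Im z\<bar>"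
    using reflection_Im_bound[OF d P refl] by blast
  have sub: "ball (complex_of_real x) e \<subseteq> ball (of_real x) d" using e by auto
  have hol': "(\<lambda>z. X z i) holomorphic_on ball (of_real x) e" for i
    by (rule holomorphic_on_subset[OF hol sub])
  have bd': "(\<Sum>i\<in>F. w i * (cmod (X z i))\<^sup>2) \<le> B"
    if z: "z \<in> ball (of_real x) e" "z \<notin> \<real>" and F: "finite F" for z F
  proof -
    have zd: "z \<in> ball (of_real x) d" using z sub by blast
    have Im: "\<bar>Im z\<bar> > 0" using z by (simp add: complex_is_Real_iff)
    have "(\<Sum>i\<in>F. w i * (cmod (X z i))\<^sup>2) \<le> sq_norm w (X z)"
      using sum_le_sq_norm bd[OF zd z(2)] F by blast
    also have "\<dots> \<le> - Im (P z * cnj (z - of_real x)) / Im z" using bd[OF zd z(2)] by blast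
    also have "\<dots> \<le> \<bar>- Im (P z * cnj (z - of_real x)) / Im z\<bar>" by (rule abs_ge_self)
    also have "\<dots> = \<bar>Im (P z * cnj (z - of_real x))\<bar> / \<bar>Im z\<bar>"
      by (simp only: abs_divide abs_minus_cancel)
    also have "\<dots> \<le> B * \<bar>Im z\<bar> / \<bar>Im z\<bar>"
      by (intro divide_right_mono B z) simp
    finally show ?thesis using Im by simp
  qed
  have "sq_summable w (X (of_real x))"
    by (rule bound_extends_to_reals(1)[OF open_ball hol' bd']) (use e in auto)
  moreover have "(\<lambda>z. pairing w (X z) v) holomorphic_on ball (of_real x) e" if "sq_summable w v" for v
    by (rule pairing_holomorphic[OF open_ball hol' bd' that])
  ultimately show thesis using that e by blast
qed

lemma sq_summable_lin:
  assumes u: "sq_summable w u" and v: "sq_summable w v"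
  shows "sq_summable w (\<lambda>i. u i + c * v i)"
proof -
  have "w i * (cmod (u i + c * v i))\<^sup>2 \<le> 2 * (w i * (cmod (u i))\<^sup>2) + 2 * (cmod c)\<^sup>2 * (w i * (cmod (v i))\<^sup>2)" for i
  proof -
    have "(cmod (u i + c * v i))\<^sup>2 \<le> (cmod (u i) + cmod c * cmod (v i))\<^sup>2"
      by (intro power_mono) (metis norm_mult norm_triangle_ineq, simp)
    also have "\<dots> \<le> 2 * (cmod (u i))\<^sup>2 + 2 * (cmod c * cmod (v i))\<^sup>2"
      using sum_squares_bound[of "cmod (u i)" "cmod c * cmod (v i)"] by (simp add: power2_sum)
    finally have "w i * (cmod (u i + c * v i))\<^sup>2
        \<le> w i * (2 * (cmod (u i))\<^sup>2 + 2 * (cmod c * cmod (v i))\<^sup>2)"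
      using w_nonneg by (rule mult_left_mono)
    also have "\<dots> = 2 * (w i * (cmod (u i))\<^sup>2) + 2 * (cmod c)\<^sup>2 * (w i * (cmod (v i))\<^sup>2)"
      by (simp add: power_mult_distrib algebra_simps)
    finally show ?thesis .
  qed
  moreover have "(\<lambda>i. 2 * (w i * (cmod (u i))\<^sup>2) + 2 * (cmod c)\<^sup>2 * (w i * (cmod (v i))\<^sup>2)) summable_on UNIV"
    using u v unfolding sq_summable_def
    by (intro summable_on_add summable_on_cmult_right)
  ultimately show ?thesis
    unfolding sq_summable_def
    by (elim summable_on_comparison_test) (auto simp: w_nonneg)
qed

lemma sq_summable_cnj: "sq_summable w u \<Longrightarrow> sq_summable w (\<lambda>i. cnj (u i))"
  by (simp add: sq_summable_def)

lemma sq_summable_cmult: "sq_summable w u \<Longrightarrow> sq_summable w (\<lambda>i. c * u i)"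
  using summable_on_cmult_right[of "\<lambda>i. w i * (cmod (u i))\<^sup>2" UNIV "(cmod c)\<^sup>2"]
  by (simp add: sq_summable_def norm_mult power_mult_distrib mult.left_commute)

lemma pairing_cmult: "pairing w (\<lambda>i. c * u i) v = c * pairing w u v"
  unfolding pairing_def infsum_cmult_right'[symmetric] by (simp add: mult_ac)

lemma pairing_cmult_right: "pairing w u (\<lambda>i. c * v i) = c * pairing w u v"
  by (subst (1 2) pairing_commute) (rule pairing_cmult)

lemma sq_norm_cmult: "sq_norm w (\<lambda>i. c * u i) = (cmod c)\<^sup>2 * sq_norm w u"
  unfolding sq_norm_def infsum_cmult_right'[symmetric]
  by (simp add: norm_mult power_mult_distrib mult_ac)

lemma pairing_lin:
  assumes x: "sq_summable w x" and u: "sq_summable w u" and v: "sq_summable w v"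
  shows "pairing w x (\<lambda>i. u i + c * v i) = pairing w x u + c * pairing w x v"
proof -
  have "pairing w x (\<lambda>i. u i + c * v i)
      = (\<Sum>\<^sub>\<infinity>i. of_real (w i) * (x i * u i) + c * (of_real (w i) * (x i * v i)))"
    unfolding pairing_def by (simp add: algebra_simps)
  also have "\<dots> = pairing w x u + c * pairing w x v"
    unfolding pairing_def
    by (simp only: infsum_add[OF abs_summable_summable[OF pairing_summable[OF x u]]
          summable_on_cmult_right[OF abs_summable_summable[OF pairing_summable[OF x v]]]]
        infsum_cmult_right')
  finally show ?thesis .
qed

lemma pairing_single:
  "pairing w u (\<lambda>i. if i = x then 1 else 0) = of_real (w x) * u x"
proof -
  have "pairing w u (\<lambda>i. if i = x then 1 else 0)
      = (\<Sum>\<^sub>\<infinity>i\<in>{x}. of_real (w i) * u i)"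
    unfolding pairing_def by (rule infsum_cong_neutral) auto
  then show ?thesis by simp
qed

lemma single_summable: "sq_summable w (\<lambda>i. if i = x then 1 else 0)"
proof -
  have "(\<Sum>i\<in>F. w i * (cmod (if i = x then 1 else 0))\<^sup>2) \<le> w x" if "finite F" for F
  proof -
    have "(\<Sum>i\<in>F. w i * (cmod (if i = x then 1 else 0))\<^sup>2) = (\<Sum>i\<in>F. if i = x then w i else 0)"
      by (rule sum.cong) auto
    then show ?thesis using that w_nonneg[of x] by (simp add: sum.delta)
  qed
  then show ?thesis by (rule sq_summable_boundI(1))
qed

lemma sq_norm_minus_projection:
  assumes e: "sq_summable w e" "\<And>i. cnj (e i) = e i" "pairing w e e = 1"
    and g: "sq_summable w g"
  shows "sq_norm w (\<lambda>i. g i - pairing w e g * e i) = sq_norm w g - (cmod (pairing w e g))\<^sup>2"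
proof -
  define c where "c = pairing w e g"
  let ?h = "\<lambda>i. g i + (- c) * e i"
  have h: "sq_summable w ?h" by (rule sq_summable_lin[OF g e(1)])
  have 0: "pairing w ?h e = 0"
    using pairing_lin[OF e(1) g e(1), of "- c"] e(3) by (simp add: pairing_commute c_def)
  have "pairing w e (\<lambda>i. cnj (g i)) = cnj c"
    unfolding c_def pairing_def infsum_cnj[symmetric] by (simp add: e(2))
  have "of_real (sq_norm w ?h) = pairing w ?h (\<lambda>i. cnj (g i) + (- cnj c) * e i)"
    using pairing_cnj[OF h] by (simp add: e(2))
  also have "\<dots> = pairing w (\<lambda>i. cnj (g i)) ?h"
    using pairing_lin[OF h sq_summable_cnj[OF g] e(1), of "- cnj c"] 0 by (simp add: pairing_commute)
  also have "\<dots> = of_real (sq_norm w g) - c * cnj c"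
    using pairing_lin[OF sq_summable_cnj[OF g] g e(1), of "- c"] pairing_cnj[OF g]
      \<open>pairing w e (\<lambda>i. cnj (g i)) = cnj c\<close>
    by (simp add: pairing_commute)
  also have "\<dots> = of_real (sq_norm w g - (cmod c)\<^sup>2)"
    by (simp only: of_real_diff complex_norm_square)
  finally have "sq_norm w ?h = sq_norm w g - (cmod c)\<^sup>2" by (simp only: of_real_eq_iff)
  then show ?thesis by (simp add: c_def)
qed

end

section \<open>Orthonormal systems\<close>

locale orthonormal = weight +
  fixes e :: "nat \<Rightarrow> 'a \<Rightarrow> complex"
  assumes e_summable: "sq_summable w (e k)"
    and e_real: "cnj (e k i) = e k i"
    and e_pairing: "pairing w (e k) (e j) = (if k = j then 1 else 0)"
    and weight_pos: "0 < w i"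
begin

lemma remainder:
  assumes f: "sq_summable w f"
  defines "R \<equiv> \<lambda>n i. f i - (\<Sum>k<n. pairing w (e k) f * e k i)"
  shows "sq_summable w (R n)"
    and "pairing w (e k) (R n) = (if k < n then 0 else pairing w (e k) f)"
    and "sq_norm w (R n) = sq_norm w f - (\<Sum>k<n. (cmod (pairing w (e k) f))\<^sup>2)"
proof -
  have "sq_summable w (R n) \<and> (\<forall>k. pairing w (e k) (R n) = (if k < n then 0 else pairing w (e k) f))
      \<and> sq_norm w (R n) = sq_norm w f - (\<Sum>k<n. (cmod (pairing w (e k) f))\<^sup>2)"
  proof (induction n)
    case 0
    then show ?case using f by (simp add: R_def)
  next
    case (Suc n)
    have R: "R (Suc n) = (\<lambda>i. R n i - pairing w (e n) (R n) * e n i)"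
      using Suc.IH by (auto simp: R_def algebra_simps)
    have R': "R (Suc n) = (\<lambda>i. R n i + (- pairing w (e n) (R n)) * e n i)"
      by (simp add: R)
    have "sq_norm w (R (Suc n)) = sq_norm w (R n) - (cmod (pairing w (e n) (R n)))\<^sup>2"
      unfolding R using Suc.IH by (intro sq_norm_minus_projection) (auto simp: e_summable e_real e_pairing)
    moreover have "pairing w (e k) (R (Suc n)) = (if k < Suc n then 0 else pairing w (e k) f)" for k
      unfolding R' using Suc.IH by (subst pairing_lin) (auto simp: e_summable e_pairing less_Suc_eq)
    moreover have "sq_summable w (R (Suc n))"
      unfolding R' using Suc.IH by (intro sq_summable_lin e_summable) auto
    ultimately show ?case using Suc.IH by simp
  qed
  then show "sq_summable w (R n)"
    "pairing w (e k) (R n) = (if k < n then 0 else pairing w (e k) f)"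
    "sq_norm w (R n) = sq_norm w f - (\<Sum>k<n. (cmod (pairing w (e k) f))\<^sup>2)"
    by auto
qed

lemma bessel:
  assumes f: "sq_summable w f"
  shows "summable (\<lambda>k. (cmod (pairing w (e k) f))\<^sup>2)"
proof (rule summableI_nonneg_bounded)
  show "(\<Sum>k<n. (cmod (pairing w (e k) f))\<^sup>2) \<le> sq_norm w f" for n
    using remainder(3)[OF f, of n] sq_norm_nonneg[of "\<lambda>i. f i - (\<Sum>k<n. pairing w (e k) f * e k i)"]
    by simp
qed simp

lemma bessel_pointwise: "summable (\<lambda>k. (cmod (e k x))\<^sup>2)"
proof -
  have "summable (\<lambda>k. (cmod (of_real (w x) * e k x))\<^sup>2)"
    using bessel[OF single_summable, of x] by (simp only: pairing_single)
  then have "summable (\<lambda>k. (w x)\<^sup>2 * (cmod (e k x))\<^sup>2)"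
    by (simp add: norm_mult power_mult_distrib)
  then show ?thesis using weight_pos[of x] by (simp add: summable_cmult_iff)
qed

text \<open>Bessel's inequality for \<open>f\<close> and for the point masses makes the Fourier series converge at each
  index. The remainder \<open>g\<close> is the weak limit of the partial remainders; hence it is square summable and
  orthogonal to the system.\<close>
lemma fourier_remainder:
  assumes f: "sq_summable w f"
  obtains g where "sq_summable w g" "\<And>k. pairing w (e k) g = 0"
    "\<And>x. (\<lambda>k. pairing w (e k) f * e k x) sums (f x - g x)"
proof -
  let ?c = "\<lambda>k. pairing w (e k) f"
  define R where "R n i = f i - (\<Sum>k<n. ?c k * e k i)" for n i
  define g where "g i = f i - (\<Sum>k. ?c k * e k i)" for i
  have R: "sq_summable w (R n)" "pairing w (e k) (R n) = (if k < n then 0 else ?c k)"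
    "sq_norm w (R n) \<le> sq_norm w f" for n k
    using remainder(1)[OF f, of n] remainder(2)[OF f, of k n] remainder(3)[OF f, of n] sum_nonneg[of "{..<n}" "\<lambda>k. (cmod (?c k))\<^sup>2"]
    unfolding R_def by auto
  have summable: "summable (\<lambda>k. ?c k * e k i)" for i
  proof (rule summable_comparison_test')
    show "summable (\<lambda>k. (cmod (?c k))\<^sup>2 + (cmod (e k i))\<^sup>2)"
      by (intro summable_add bessel f bessel_pointwise)
    show "norm (?c k * e k i) \<le> (cmod (?c k))\<^sup>2 + (cmod (e k i))\<^sup>2" for k
      using sum_squares_bound[of "cmod (?c k)" "cmod (e k i)"]
        mult_nonneg_nonneg[OF norm_ge_zero[of "?c k"] norm_ge_zero[of "e k i"]]
      unfolding norm_mult by linarith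
  qed
  have lim: "(\<lambda>n. R n i) \<longlonglongrightarrow> g i" for i
    unfolding R_def g_def by (intro tendsto_intros summable_LIMSEQ summable)
  have bd: "\<forall>\<^sub>F n in sequentially. sq_summable w (R n) \<and> sq_norm w (R n) \<le> sq_norm w f"
    using R by simp
  have "sq_summable w g"
    by (rule bounded_pointwise_limit(1)[OF _ bd tendsto_const lim]) simp
  moreover have "pairing w (e k) g = 0" for k
  proof -
    have "(\<lambda>n. pairing w (R n) (e k)) \<longlonglongrightarrow> pairing w g (e k)"
      by (rule weak_limit[OF _ bd lim e_summable]) simp
    moreover have "(\<lambda>n. pairing w (R n) (e k)) \<longlonglongrightarrow> 0"
      by (rule tendsto_eventually, rule eventually_mono[OF eventually_gt_at_top[of k]])
         (subst pairing_commute, simp add: R)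
    ultimately show ?thesis using LIMSEQ_unique by (subst pairing_commute) blast
  qed
  moreover have "(\<lambda>k. ?c k * e k x) sums (f x - g x)" for x
    using summable_sums[OF summable] by (simp add: g_def)
  ultimately show thesis using that by blast
qed

end

section \<open>Three-term recurrences with a regular end\<close>

definition wronskian :: "(int \<Rightarrow> real) \<Rightarrow> (int \<Rightarrow> complex) \<Rightarrow> (int \<Rightarrow> complex) \<Rightarrow> int \<Rightarrow> complex" where
  "wronskian a u v n = of_real (a n) * (u n * v (n - 1) - v n * u (n - 1))"

definition solution ::
    "(int \<Rightarrow> real) \<Rightarrow> (int \<Rightarrow> real) \<Rightarrow> (int \<Rightarrow> real) \<Rightarrow> complex \<Rightarrow> (int \<Rightarrow> complex) \<Rightarrow> bool" where
  "solution a w b z u \<longleftrightarrow> (\<forall>n. of_real (a n) * u (n - 1) + of_real (a (n + 1)) * u (n + 1)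
     = (of_real (b n) - z * of_real (w n)) * u n)"

definition tail :: "int \<Rightarrow> (int \<Rightarrow> complex) \<Rightarrow> int \<Rightarrow> complex" where
  "tail n u k = (if n \<le> k then u k else 0)"

lemma wronskian_swap: "wronskian a v u n = - wronskian a u v n"
  by (simp add: wronskian_def algebra_simps)

lemma wronskian_same: "wronskian a u u n = 0"
  by (simp add: wronskian_def)

lemma wronskian_cnj: "wronskian a (\<lambda>k. cnj (u k)) (\<lambda>k. cnj (v k)) n = cnj (wronskian a u v n)"
  by (simp add: wronskian_def)

lemma wronskian_lin_left:
  "wronskian a (\<lambda>k. u k + c * v k) x n = wronskian a u x n + c * wronskian a v x n"
  by (simp add: wronskian_def algebra_simps)

lemma wronskian_lin_right:
  "wronskian a x (\<lambda>k. u k + c * v k) n = wronskian a x u n + c * wronskian a x v n"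
  by (simp add: wronskian_def algebra_simps)

text \<open>Two forms of the Pluecker relation in the plane: between four vectors, and as the expansion of one
  vector in two others.\<close>
lemma wronskian_pluecker:
  "wronskian a u v n * wronskian a x y n
     = wronskian a u x n * wronskian a v y n - wronskian a u y n * wronskian a v x n"
  by (simp add: wronskian_def algebra_simps)

lemma wronskian_expand:
  "u n * wronskian a x y n = x n * wronskian a u y n + y n * wronskian a x u n"
  by (simp add: wronskian_def algebra_simps)

lemma wronskian_step:
  assumes "solution a w b z u" "solution a w b z' v"
  shows "wronskian a u v n - wronskian a u v (n + 1) = (z - z') * (of_real (w n) * (u n * v n))"
proof -
  have u: "of_real (a n) * u (n - 1) + of_real (a (n + 1)) * u (n + 1)
     = (of_real (b n) - z * of_real (w n)) * u n"
    and v: "of_real (a n) * v (n - 1) + of_real (a (n + 1)) * v (n + 1)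
     = (of_real (b n) - z' * of_real (w n)) * v n"
    using assms by (auto simp: solution_def)
  have "wronskian a u v n - wronskian a u v (n + 1)
      = u n * (of_real (a n) * v (n - 1) + of_real (a (n + 1)) * v (n + 1))
        - v n * (of_real (a n) * u (n - 1) + of_real (a (n + 1)) * u (n + 1))"
    by (simp add: wronskian_def algebra_simps)
  then show ?thesis unfolding u v by (simp add: algebra_simps)
qed

lemma solution_lin:
  assumes "solution a w b z u" "solution a w b z v"
  shows "solution a w b z (\<lambda>k. u k + c * v k)"
proof -
  have "of_real (a n) * (u (n - 1) + c * v (n - 1)) + of_real (a (n + 1)) * (u (n + 1) + c * v (n + 1))
    = (of_real (a n) * u (n - 1) + of_real (a (n + 1)) * u (n + 1))
      + c * (of_real (a n) * v (n - 1) + of_real (a (n + 1)) * v (n + 1))" for n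
    by (simp add: algebra_simps)
  then show ?thesis
    using assms unfolding solution_def by (simp only: distrib_left mult.left_commute) simp
qed

lemma tail_cnj: "tail n (\<lambda>k. cnj (u k)) = (\<lambda>k. cnj (tail n u k))"
  by (auto simp: tail_def)

locale regular_end =
  fixes a w b :: "int \<Rightarrow> real"
  assumes w_pos: "0 < w n"
    and w_summable: "w summable_on {0..}"
begin

sublocale weight w
  by unfold_locales (use w_pos less_imp_le in blast)

abbreviation "sol \<equiv> solution a w b"
abbreviation "W \<equiv> wronskian a"

definition bounded_at_end :: "(int \<Rightarrow> complex) \<Rightarrow> bool" where
  "bounded_at_end u \<longleftrightarrow> bounded (u ` {0..})"

lemma bounded_at_endD:
  assumes "bounded_at_end u"
  obtains B where "0 < B" "\<And>k. n \<le> k \<Longrightarrow> cmod (u k) \<le> B"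
proof -
  have "bounded (u ` ({0..} \<union> {n..<0}))"
    unfolding image_Un using assms by (auto simp: bounded_at_end_def finite_imp_bounded)
  moreover have "{n..} \<subseteq> {0..} \<union> {n..<0}" by auto
  ultimately have "bounded (u ` {n..})" by (meson bounded_subset image_mono)
  then show thesis using that unfolding bounded_pos by auto
qed

lemma bounded_at_end_lin:
  assumes "bounded_at_end u" "bounded_at_end v"
  shows "bounded_at_end (\<lambda>k. u k + c * v k)"
proof -
  obtain B where B: "\<And>k. 0 \<le> k \<Longrightarrow> cmod (u k) \<le> B"
    using bounded_at_endD[OF assms(1), of 0] by blast
  obtain C where C: "\<And>k. 0 \<le> k \<Longrightarrow> cmod (v k) \<le> C"
    using bounded_at_endD[OF assms(2), of 0] by blast
  have "cmod (u k + c * v k) \<le> B + cmod c * C" if "0 \<le> k" for k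
    by (rule order.trans[OF norm_triangle_ineq])
       (use B[OF that] C[OF that] in \<open>auto simp: norm_mult intro!: add_mono mult_left_mono\<close>)
  then show ?thesis unfolding bounded_at_end_def bounded_iff by auto
qed

lemma w_summable_tail: "w summable_on {n..}"
proof -
  have "w summable_on ({0..} \<union> {n..<0})"
    by (cases "n < 0") (auto intro!: summable_on_Un_disjoint w_summable)
  then show ?thesis
    by (rule summable_on_subset_banach) auto
qed

lemma tail_norm_le:
  assumes "\<And>k. n \<le> k \<Longrightarrow> cmod (u k) \<le> B"
  shows "sq_summable w (tail n u)" "sq_norm w (tail n u) \<le> B\<^sup>2 * infsum w {n..}"
proof -
  have "(\<Sum>i\<in>F. w i * (cmod (tail n u i))\<^sup>2) \<le> B\<^sup>2 * infsum w {n..}" if F: "finite F" for F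
  proof -
    have "(\<Sum>i\<in>F. w i * (cmod (tail n u i))\<^sup>2) = (\<Sum>i\<in>F \<inter> {n..}. w i * (cmod (tail n u i))\<^sup>2)"
      by (rule sum.mono_neutral_right) (use F in \<open>auto simp: tail_def\<close>)
    also have "\<dots> \<le> (\<Sum>i\<in>F \<inter> {n..}. w i * B\<^sup>2)"
      by (rule sum_mono) (use assms w_nonneg in \<open>auto simp: tail_def intro!: mult_left_mono power_mono\<close>)
    also have "\<dots> = B\<^sup>2 * sum w (F \<inter> {n..})"
      by (simp add: sum_distrib_left mult.commute)
    also have "\<dots> \<le> B\<^sup>2 * infsum w {n..}"
      by (intro mult_left_mono finite_sum_le_infsum w_summable_tail) (use F w_nonneg in auto)
    finally show ?thesis .
  qed
  then show "sq_summable w (tail n u)" "sq_norm w (tail n u) \<le> B\<^sup>2 * infsum w {n..}"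
    using sq_summable_boundI by blast+
qed

lemma tail_sq_summable: "bounded_at_end u \<Longrightarrow> sq_summable w (tail n u)"
  by (metis bounded_at_endD tail_norm_le(1))

text \<open>Green's formula, by telescoping from \<open>n\<close> towards the regular end.\<close>
lemma green:
  assumes u: "sol z u" "bounded_at_end u" and v: "sol z' v" "bounded_at_end v"
    and L: "(W u v \<longlongrightarrow> L) at_top"
  shows "W u v n = L + (z - z') * pairing w (tail n u) (tail n v)"
proof -
  let ?t = "\<lambda>k. of_real (w k) * (u k * v k)"
  let ?T = "\<lambda>k. of_real (w k) * (tail n u k * tail n v k)"
  have "?T summable_on UNIV"
    using pairing_summable[OF tail_sq_summable[OF u(2), of n] tail_sq_summable[OF v(2), of n]]
    by (rule abs_summable_summable)
  then have "(?T has_sum pairing w (tail n u) (tail n v)) UNIV"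
    by (simp add: pairing_def)
  then have "(?t has_sum pairing w (tail n u) (tail n v)) {n..}"
    by (subst (asm) has_sum_cong_neutral[where T = "{n..}" and g = ?t]) (auto simp: tail_def)
  moreover have "bij_betw (\<lambda>k. n + int k) UNIV {n..}"
    by (rule bij_betwI[where g = "\<lambda>k. nat (k - n)"]) auto
  ultimately have "((\<lambda>k. ?t (n + int k)) has_sum pairing w (tail n u) (tail n v)) UNIV"
    by (subst has_sum_reindex_bij_betw)
  then have "(\<lambda>k. ?t (n + int k)) sums pairing w (tail n u) (tail n v)"
    by (rule has_sum_imp_sums)
  then have "(\<lambda>K. (z - z') * (\<Sum>k<K. ?t (n + int k)))
      \<longlonglongrightarrow> (z - z') * pairing w (tail n u) (tail n v)"
    unfolding sums_def by (intro tendsto_intros)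
  moreover have "(z - z') * (\<Sum>k<K. ?t (n + int k)) = W u v n - W u v (n + int K)" for K
  proof (induction K)
    case (Suc K)
    have "(z - z') * ?t (n + int K) = W u v (n + int K) - W u v (n + int K + 1)"
      using wronskian_step[OF u(1) v(1), of "n + int K"] by simp
    moreover have "n + int (Suc K) = n + int K + 1" by simp
    ultimately show ?case using Suc.IH by (simp only: sum.lessThan_Suc distrib_left) simp
  qed simp
  moreover have "(\<lambda>K. W u v n - W u v (n + int K)) \<longlonglongrightarrow> W u v n - L"
  proof -
    have "filterlim (\<lambda>K. n + int K) at_top sequentially"
      unfolding filterlim_at_top
    proof
      fix Z
      show "\<forall>\<^sub>F K in sequentially. Z \<le> n + int K"
        using eventually_ge_at_top[of "nat (Z - n)"] by eventually_elim linarith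
    qed
    then show ?thesis by (intro tendsto_intros filterlim_compose[OF L])
  qed
  ultimately have "W u v n - L = (z - z') * pairing w (tail n u) (tail n v)"
    using LIMSEQ_unique by simp
  then show ?thesis by (simp add: algebra_simps)
qed

end

text \<open>The limits of the Wronskians encode the boundary values at the regular end: \<open>\<phi>\<close> and \<open>\<theta>\<close> have
  boundary values that do not depend on the parameter, and these are normalised.\<close>
locale regular_pair = regular_end +
  fixes \<phi> \<theta> :: "complex \<Rightarrow> int \<Rightarrow> complex"
  assumes phi_sol: "sol z (\<phi> z)" and theta_sol: "sol z (\<theta> z)"
    and phi_bounded: "bounded_at_end (\<phi> z)" and theta_bounded: "bounded_at_end (\<theta> z)"
    and phi_phi: "(W (\<phi> z) (\<phi> z') \<longlongrightarrow> 0) at_top"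
    and theta_theta: "(W (\<theta> z) (\<theta> z') \<longlongrightarrow> 0) at_top"
    and phi_theta: "(W (\<phi> z) (\<theta> z') \<longlongrightarrow> 1) at_top"
begin

lemma W_phi_theta: "W (\<phi> z) (\<theta> z) n = 1"
  using green[OF phi_sol phi_bounded theta_sol theta_bounded phi_theta] by simp

lemma solution_coordinates:
  assumes u: "sol z u" "bounded_at_end u"
    and "(W u (\<theta> z) \<longlongrightarrow> \<alpha>) at_top" "(W (\<phi> z) u \<longlongrightarrow> \<beta>) at_top"
  shows "u n = \<phi> z n * \<alpha> + \<theta> z n * \<beta>"
  using wronskian_expand[of u n a "\<phi> z" "\<theta> z"]
    green[OF u theta_sol theta_bounded assms(3), of n] green[OF phi_sol phi_bounded u assms(4), of n]
  by (simp add: W_phi_theta)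

text \<open>Expanding \<open>U y\<close> in the solutions \<open>\<phi> z\<close> and \<open>\<theta> z\<close> gives a Volterra equation over the tail of the
  lattice, whose kernel carries the factor \<open>y - z\<close>. For \<open>y\<close> close to \<open>z\<close> it bounds \<open>U y\<close> uniformly on the
  tail; therefore \<open>U y\<close> tends to \<open>U z\<close>, and the equation itself then exhibits the limit of the
  difference quotient.\<close>
lemma solution_holomorphic:
  assumes sol: "\<And>z. sol z (U z)" and bd: "\<And>z. bounded_at_end (U z)"
    and alpha: "\<And>z z'. (W (U z) (\<theta> z') \<longlongrightarrow> \<alpha>) at_top"
    and beta: "\<And>z z'. (W (\<phi> z') (U z) \<longlongrightarrow> \<beta>) at_top"
  shows "(\<lambda>z. U z n) holomorphic_on S"
proof -
  have "(\<lambda>z. U z n) field_differentiable at z" for z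
  proof -
    define A where "A y k = pairing w (tail k (U y)) (tail k (\<theta> z))" for y k
    define B where "B y k = pairing w (tail k (U y)) (tail k (\<phi> z))" for y k
    have B_commute: "pairing w (tail k (\<phi> z)) (tail k (U y)) = B y k" for y k
      by (simp add: B_def pairing_def mult.commute)
    have expand: "U y k = \<phi> z k * \<alpha> + \<theta> z k * \<beta> + (y - z) * (\<phi> z k * A y k - \<theta> z k * B y k)" for y k
      using wronskian_expand[of "U y" k a "\<phi> z" "\<theta> z"]
        green[OF sol[of y] bd[of y] theta_sol[of z] theta_bounded alpha, of k]
        green[OF phi_sol[of z] phi_bounded sol[of y] bd[of y] beta, of k]
      by (simp add: W_phi_theta A_def B_commute algebra_simps)
    then have diff: "U y k - U z k = (y - z) * (\<phi> z k * A y k - \<theta> z k * B y k)" for y k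
      using expand[of z k] by simp
    obtain C1 where C1: "0 < C1" "\<And>k. n \<le> k \<Longrightarrow> cmod (\<phi> z k) \<le> C1"
      using bounded_at_endD[OF phi_bounded, of n] by blast
    obtain C2 where C2: "0 < C2" "\<And>k. n \<le> k \<Longrightarrow> cmod (\<theta> z k) \<le> C2"
      using bounded_at_endD[OF theta_bounded, of n] by blast
    obtain C0 where C0: "0 < C0" "\<And>k. n \<le> k \<Longrightarrow> cmod (U z k) \<le> C0"
      using bounded_at_endD[OF bd, of n] by blast
    define T where "T = infsum w {n..}"
    have T: "0 \<le> T" unfolding T_def by (rule infsum_nonneg) (simp add: w_nonneg)
    have tail_mono: "sq_norm w (tail k u) \<le> M\<^sup>2 * T"
      if "\<And>k. n \<le> k \<Longrightarrow> cmod (u k) \<le> M" "n \<le> k" for k u M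
    proof -
      have "sq_norm w (tail k u) \<le> sq_norm w (tail n u)"
        by (rule sq_summable_mono(2)[OF tail_norm_le(1)]) (use that in \<open>auto simp: tail_def\<close>)
      also have "\<dots> \<le> M\<^sup>2 * T" unfolding T_def by (rule tail_norm_le(2)[OF that(1)])
      finally show ?thesis .
    qed
    have pair_le: "cmod (pairing w (tail k u) (tail k v)) \<le> M * M' * T"
      if "\<And>k. n \<le> k \<Longrightarrow> cmod (u k) \<le> M" "\<And>k. n \<le> k \<Longrightarrow> cmod (v k) \<le> M'" "n \<le> k"
        "0 \<le> M" "0 \<le> M'" for k u v M M'
    proof -
      have "sq_summable w (tail k u)" "sq_summable w (tail k v)"
        using tail_norm_le(1) that by (meson order.trans)+
      then have "cmod (pairing w (tail k u) (tail k v))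
          \<le> sqrt (sq_norm w (tail k u)) * sqrt (sq_norm w (tail k v))"
        by (rule cauchy_schwarz)
      also have "\<dots> \<le> sqrt (M\<^sup>2 * T) * sqrt (M'\<^sup>2 * T)"
        using that T by (intro mult_mono real_sqrt_le_mono tail_mono) (auto simp: sq_norm_nonneg)
      also have "\<dots> = M * M' * T"
        using that T by (simp add: real_sqrt_mult)
      finally show ?thesis .
    qed
    define K where "K = 2 * C1 * C2 * T"
    have step: "cmod (U y k - U z k) \<le> cmod (y - z) * (K * M)"
      if M: "\<And>k. n \<le> k \<Longrightarrow> cmod (U y k) \<le> M" "0 \<le> M" and k: "n \<le> k" for y k M
    proof -
      have "cmod (A y k) \<le> M * C2 * T" unfolding A_def
        by (rule pair_le) (use M C2 k in auto)
      moreover have "cmod (B y k) \<le> M * C1 * T" unfolding B_def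
        by (rule pair_le) (use M C1 k in auto)
      ultimately have "cmod (\<phi> z k) * cmod (A y k) + cmod (\<theta> z k) * cmod (B y k)
          \<le> C1 * (M * C2 * T) + C2 * (M * C1 * T)"
        using C1 C2 k by (intro add_mono mult_mono) auto
      also have "\<dots> = K * M" by (simp add: K_def)
      finally have "cmod (\<phi> z k * A y k - \<theta> z k * B y k) \<le> K * M"
        using norm_triangle_ineq4[of "\<phi> z k * A y k" "\<theta> z k * B y k"] by (simp add: norm_mult)
      then show ?thesis unfolding diff norm_mult by (rule mult_left_mono) simp
    qed
    have K: "0 \<le> K" using C1 C2 T by (simp add: K_def)
    \<comment> \<open>The supremum over the tail is finite, and \<open>step\<close> bounds it by \<open>C0\<close> plus half of itself.\<close>
    have near: "cmod (U y k) \<le> 2 * C0" if y: "cmod (y - z) * K \<le> 1 / 2" and k: "n \<le> k" for y k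
    proof -
      obtain M0 where M0: "\<And>k. n \<le> k \<Longrightarrow> cmod (U y k) \<le> M0"
        using bounded_at_endD[OF bd, of n] by blast
      define M where "M = (SUP k\<in>{n..}. cmod (U y k))"
      have M: "cmod (U y k) \<le> M" if "n \<le> k" for k
        unfolding M_def by (rule cSUP_upper) (use that M0 in \<open>auto intro!: bdd_aboveI2\<close>)
      have M_nn: "0 \<le> M" using M[of n] norm_ge_zero[of "U y n"] by linarith
      have "M \<le> C0 + M / 2"
        unfolding M_def
      proof (rule cSUP_least)
        fix k assume "k \<in> {n..}"
        then have k: "n \<le> k" by simp
        have "cmod (U y k) \<le> cmod (U z k) + cmod (U y k - U z k)"
          by (metis add.commute diff_add_cancel norm_triangle_ineq)
        also have "\<dots> \<le> C0 + cmod (y - z) * (K * M)"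
          by (intro add_mono C0 step M M_nn k)
        also have "\<dots> \<le> C0 + M / 2"
          using mult_right_mono[OF y M_nn] by (simp add: algebra_simps)
        finally show "cmod (U y k) \<le> C0 + (SUP k\<in>{n..}. cmod (U y k)) / 2" by (simp add: M_def)
      qed simp
      then show ?thesis using M[OF k] by simp
    qed
    have ev: "\<forall>\<^sub>F y in at z. cmod (y - z) * K \<le> 1 / 2"
    proof -
      have "((\<lambda>y. cmod (y - z) * K) \<longlongrightarrow> cmod (z - z) * K) (at z)"
        by (intro tendsto_intros)
      then have "\<forall>\<^sub>F y in at z. cmod (y - z) * K < 1 / 2"
        by (rule order_tendstoD) simp
      then show ?thesis by eventually_elim simp
    qed
    have lim_k: "((\<lambda>y. tail n (U y) k) \<longlongrightarrow> tail n (U z) k) (at z)" for k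
    proof (cases "n \<le> k")
      case True
      have "((\<lambda>y. U y k - U z k) \<longlongrightarrow> 0) (at z)"
      proof (rule Lim_null_comparison)
        show "\<forall>\<^sub>F y in at z. cmod (U y k - U z k) \<le> cmod (y - z) * (K * (2 * C0))"
          using ev by eventually_elim (use step near True C0 in auto)
        have "((\<lambda>y. cmod (y - z) * (K * (2 * C0))) \<longlongrightarrow> cmod (z - z) * (K * (2 * C0))) (at z)"
          by (intro tendsto_intros)
        then show "((\<lambda>y. cmod (y - z) * (K * (2 * C0))) \<longlongrightarrow> 0) (at z)" by simp
      qed
      then show ?thesis using True by (simp add: tail_def LIM_zero_iff)
    qed (simp add: tail_def)
    have bdd: "\<forall>\<^sub>F y in at z. sq_summable w (tail n (U y)) \<and> sq_norm w (tail n (U y)) \<le> (2 * C0)\<^sup>2 * T"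
      using ev
    proof eventually_elim
      case (elim y)
      then show ?case using tail_norm_le[of n "U y" "2 * C0"] near unfolding T_def by blast
    qed
    have "((\<lambda>y. \<phi> z n * A y n - \<theta> z n * B y n) \<longlongrightarrow> \<phi> z n * A z n - \<theta> z n * B z n) (at z)"
      unfolding A_def B_def
      by (intro tendsto_intros weak_limit[OF _ bdd lim_k] tail_sq_summable phi_bounded theta_bounded) auto
    moreover have "\<forall>\<^sub>F y in at z. (U y n - U z n) / (y - z) = \<phi> z n * A y n - \<theta> z n * B y n"
      using eventually_neq_at_within[of z] by eventually_elim (simp add: diff)
    ultimately have "((\<lambda>y. (U y n - U z n) / (y - z)) \<longlongrightarrow> \<phi> z n * A z n - \<theta> z n * B z n) (at z)"
      using tendsto_cong by fast
    then show ?thesis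
      unfolding field_differentiable_def has_field_derivative_iff by blast
  qed
  then show ?thesis
    by (meson field_differentiable_at_within holomorphic_on_def)
qed

lemma phi_holomorphic [holomorphic_intros]: "(\<lambda>z. \<phi> z n) holomorphic_on S"
  by (rule solution_holomorphic[OF phi_sol phi_bounded phi_theta phi_phi])

lemma theta_holomorphic [holomorphic_intros]: "(\<lambda>z. \<theta> z n) holomorphic_on S"
  by (rule solution_holomorphic[OF theta_sol theta_bounded theta_theta phi_theta])

end

section \<open>Weyl circles and the Green function\<close>

text \<open>The lattice is cut at the indices \<open>N j\<close>, where the real pair \<open>(s j, t j)\<close> describes a self-adjoint
  boundary condition; \<open>m\<close> is the limit of the points of the Weyl circles that belong to these
  conditions.\<close>
locale weyl_problem = regular_pair +
  fixes m :: "complex \<Rightarrow> complex" and N :: "nat \<Rightarrow> int" and s t :: "nat \<Rightarrow> real"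
  assumes phi_cnj: "\<phi> (cnj z) n = cnj (\<phi> z n)" and theta_cnj: "\<theta> (cnj z) n = cnj (\<theta> z n)"
    and N_lim: "filterlim N at_bot sequentially"
    and st_nonzero: "s j \<noteq> 0 \<or> t j \<noteq> 0"
    and m_lim: "z \<notin> \<real> \<Longrightarrow>
      (\<lambda>j. - ((of_real (s j) * \<theta> z (N j) + of_real (t j) * \<theta> z (N j - 1))
         / (of_real (s j) * \<phi> z (N j) + of_real (t j) * \<phi> z (N j - 1)))) \<longlonglongrightarrow> m z"
begin

definition cut_form :: "nat \<Rightarrow> (int \<Rightarrow> complex) \<Rightarrow> complex" where
  "cut_form j u = of_real (s j) * u (N j) + of_real (t j) * u (N j - 1)"

definition l :: "nat \<Rightarrow> complex \<Rightarrow> complex" where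
  "l j z = - (cut_form j (\<theta> z) / cut_form j (\<phi> z))"

text \<open>The coefficient is kept as a parameter: it is a point of a circle at a cut, or \<open>m z\<close> in the limit.\<close>
definition psi :: "complex \<Rightarrow> complex \<Rightarrow> int \<Rightarrow> complex" where
  "psi c z = (\<lambda>k. \<theta> z k + c * \<phi> z k)"

lemma l_lim: "z \<notin> \<real> \<Longrightarrow> (\<lambda>j. l j z) \<longlonglongrightarrow> m z"
  using m_lim by (simp add: l_def cut_form_def)

lemma cut_form_wronskian:
  assumes "cut_form j u = 0" "cut_form j v = 0"
  shows "W u v (N j) = 0"
proof -
  let ?D = "u (N j) * v (N j - 1) - v (N j) * u (N j - 1)"
  have "of_real (s j) * ?D = cut_form j u * v (N j - 1) - cut_form j v * u (N j - 1)"
    "of_real (t j) * ?D = cut_form j v * u (N j) - cut_form j u * v (N j)"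
    by (simp_all add: cut_form_def algebra_simps)
  then have "?D = 0" using assms st_nonzero[of j] by auto
  then show ?thesis by (simp add: wronskian_def)
qed

lemma cut_form_cnj: "cut_form j (\<lambda>k. cnj (u k)) = cnj (cut_form j u)"
  by (simp add: cut_form_def)

lemma psi_sol: "sol z (psi c z)"
  unfolding psi_def by (rule solution_lin[OF theta_sol phi_sol])

lemma psi_bounded: "bounded_at_end (psi c z)"
  unfolding psi_def by (rule bounded_at_end_lin[OF theta_bounded phi_bounded])

lemma psi_cnj: "(\<lambda>k. cnj (psi c z k)) = psi (cnj c) (cnj z)"
  by (simp add: psi_def phi_cnj theta_cnj)

lemma phi_cnj_fun: "(\<lambda>k. cnj (\<phi> z k)) = \<phi> (cnj z)"
  by (rule ext) (simp add: phi_cnj)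

lemma psi_shift: "psi c z = (\<lambda>k. psi c' z k + (c - c') * \<phi> z k)"
  by (simp add: psi_def algebra_simps)

lemma W_phi_psi_lim: "(W (\<phi> z) (psi c z') \<longlongrightarrow> 1) at_top"
proof -
  have "((\<lambda>n. W (\<phi> z) (\<theta> z') n + c * W (\<phi> z) (\<phi> z') n) \<longlongrightarrow> 1 + c * 0) at_top"
    by (intro tendsto_intros phi_theta phi_phi)
  then show ?thesis unfolding psi_def wronskian_lin_right by simp
qed

lemma W_psi_psi_lim: "(W (psi c z) (psi c' z') \<longlongrightarrow> c - c') at_top"
proof -
  have "W (psi c z) (psi c' z') n
      = W (\<theta> z) (\<theta> z') n - c' * W (\<phi> z') (\<theta> z) n + c * W (\<phi> z) (psi c' z') n" for n
    using wronskian_swap[of a "\<theta> z" "\<phi> z'" n]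
    by (simp add: psi_def wronskian_lin_right wronskian_lin_left algebra_simps)
  moreover have "((\<lambda>n. W (\<theta> z) (\<theta> z') n - c' * W (\<phi> z') (\<theta> z) n + c * W (\<phi> z) (psi c' z') n)
      \<longlongrightarrow> 0 - c' * 1 + c * 1) at_top"
    by (intro tendsto_intros phi_theta theta_theta W_phi_psi_lim)
  ultimately have "((\<lambda>n. W (psi c z) (psi c' z') n) \<longlongrightarrow> 0 - c' * 1 + c * 1) at_top"
    by (simp only:)
  then show ?thesis by simp
qed

lemma W_phi_psi: "W (\<phi> z) (psi c z) n = 1"
  by (simp add: psi_def wronskian_lin_right wronskian_same W_phi_theta)

lemma green_psi_psi:
  "W (psi c z) (psi c' z') n = (c - c') + (z - z') * pairing w (tail n (psi c z)) (tail n (psi c' z'))"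
  by (rule green[OF psi_sol psi_bounded psi_sol psi_bounded W_psi_psi_lim])

lemma green_phi_psi:
  "W (\<phi> z) (psi c z') n = 1 + (z - z') * pairing w (tail n (\<phi> z)) (tail n (psi c z'))"
  by (rule green[OF phi_sol phi_bounded psi_sol psi_bounded W_phi_psi_lim])

lemma green_norm_psi:
  "W (psi c z) (\<lambda>k. cnj (psi c z k)) n
     = of_real (2 * (Im c + Im z * sq_norm w (tail n (psi c z)))) * \<i>"
proof -
  have "W (psi c z) (\<lambda>k. cnj (psi c z k)) n
      = (c - cnj c) + (z - cnj z) * of_real (sq_norm w (tail n (psi c z)))"
    using green_psi_psi[of c z "cnj c" "cnj z" n]
      pairing_cnj[OF tail_sq_summable[OF psi_bounded], of n c z]
    by (simp flip: psi_cnj tail_cnj)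
  then show ?thesis by (simp add: complex_eq_iff)
qed

lemma green_norm_phi:
  "W (\<phi> z) (\<lambda>k. cnj (\<phi> z k)) n = of_real (2 * Im z * sq_norm w (tail n (\<phi> z))) * \<i>"
proof -
  have "W (\<phi> z) (\<lambda>k. cnj (\<phi> z k)) n = (z - cnj z) * of_real (sq_norm w (tail n (\<phi> z)))"
    using green[OF phi_sol phi_bounded phi_sol phi_bounded phi_phi, of z "cnj z" n]
      pairing_cnj[OF tail_sq_summable[OF phi_bounded], of n z]
    by (simp flip: phi_cnj_fun tail_cnj)
  then show ?thesis by (simp add: complex_eq_iff)
qed

text \<open>A solution that satisfies real boundary conditions at both ends has a real parameter.\<close>
lemma cut_form_phi_nonzero:
  assumes z: "z \<notin> \<real>"
  shows "cut_form j (\<phi> z) \<noteq> 0"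
proof
  assume 0: "cut_form j (\<phi> z) = 0"
  then have "W (\<phi> z) (\<lambda>k. cnj (\<phi> z k)) (N j) = 0"
    by (intro cut_form_wronskian) (simp_all add: cut_form_cnj)
  then have "sq_norm w (tail (N j) (\<phi> z)) = 0"
    using z by (simp add: green_norm_phi complex_is_Real_iff)
  then have "w k * (cmod (tail (N j) (\<phi> z) k))\<^sup>2 \<le> 0" for k
    using sum_le_sq_norm[OF tail_sq_summable[OF phi_bounded], of "{k}" "N j" z] by simp
  then have "(cmod (tail (N j) (\<phi> z) k))\<^sup>2 \<le> 0" for k
    using w_pos by (meson mult_le_0_iff not_less zero_le_power2 leD order_antisym_conv mult_pos_pos not_le)
  then have "tail (N j) (\<phi> z) k = 0" for k by simp
  then have "\<phi> z k = 0" if "N j \<le> k" for k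
    using that by (metis tail_def)
  then have "W (\<phi> z) (\<theta> z) (N j + 1) = 0" by (simp add: wronskian_def)
  then show False by (simp add: W_phi_theta)
qed

lemma cut_form_psi: "z \<notin> \<real> \<Longrightarrow> cut_form j (psi (l j z) z) = 0"
proof -
  assume "z \<notin> \<real>"
  then have "cut_form j (\<theta> z) + l j z * cut_form j (\<phi> z) = 0"
    using cut_form_phi_nonzero by (simp add: l_def)
  then show ?thesis by (simp add: psi_def cut_form_def algebra_simps)
qed

text \<open>The boundary condition at the cut is real, so the solution and its conjugate have Wronskian zero
  there, and Green's formula leaves the contribution of the regular end.\<close>
lemma cut_psi_norm:
  assumes z: "z \<notin> \<real>"
  shows "sq_norm w (tail (N j) (psi (l j z) z)) = - Im (l j z) / Im z"
proof -
  have "W (psi (l j z) z) (\<lambda>k. cnj (psi (l j z) z k)) (N j) = 0"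
    by (intro cut_form_wronskian) (simp_all add: cut_form_cnj cut_form_psi[OF z])
  then have "Im (l j z) + Im z * sq_norm w (tail (N j) (psi (l j z) z)) = 0"
    by (simp only: green_norm_psi mult_eq_0_iff of_real_eq_0_iff) simp
  then show ?thesis using z by (simp add: complex_is_Real_iff field_simps)
qed

lemma eventually_tail: "\<forall>\<^sub>F j in sequentially. tail (N j) u k = u k"
proof -
  have "\<forall>\<^sub>F j in sequentially. N j \<le> k"
    using N_lim by (simp add: filterlim_at_bot)
  then show ?thesis by eventually_elim (simp add: tail_def)
qed

lemma psi_norm:
  assumes z: "z \<notin> \<real>"
  shows "sq_summable w (psi (m z) z)" "sq_norm w (psi (m z) z) \<le> - Im (m z) / Im z"
proof -
  have bd: "\<forall>\<^sub>F j in sequentially. sq_summable w (tail (N j) (psi (l j z) z)) \<and>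
      sq_norm w (tail (N j) (psi (l j z) z)) \<le> - Im (l j z) / Im z"
    by (simp add: tail_sq_summable[OF psi_bounded] cut_psi_norm[OF z])
  have B: "(\<lambda>j. - Im (l j z) / Im z) \<longlonglongrightarrow> - Im (m z) / Im z"
    using z by (intro tendsto_intros l_lim) (auto simp: complex_is_Real_iff)
  have lim: "(\<lambda>j. tail (N j) (psi (l j z) z) k) \<longlonglongrightarrow> psi (m z) z k" for k
  proof (rule Lim_transform_eventually)
    show "(\<lambda>j. psi (l j z) z k) \<longlonglongrightarrow> psi (m z) z k"
      unfolding psi_def by (intro tendsto_intros l_lim z)
    show "\<forall>\<^sub>F j in sequentially. psi (l j z) z k = tail (N j) (psi (l j z) z) k"
      using N_lim[unfolded filterlim_at_bot, rule_format, of k]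
      by eventually_elim (simp add: tail_def)
  qed
  show "sq_summable w (psi (m z) z)" "sq_norm w (psi (m z) z) \<le> - Im (m z) / Im z"
    using bounded_pointwise_limit[OF _ bd B lim] by auto
qed

lemma tail_norm_le_norm:
  assumes "sq_summable w u"
  shows "sq_summable w (tail n u)" "sq_norm w (tail n u) \<le> sq_norm w u"
  using sq_summable_mono[OF assms, of "tail n u"] by (auto simp: tail_def)

text \<open>By \<open>psi_norm\<close> the point \<open>m z\<close> lies in the closed disc of the circle at each cut, and the
  radius of the circle is of the order of the inverse of the squared norm of \<open>\<phi> z\<close> up to the cut. The estimate is meaningful both if
  this norm is bounded (limit circle) and if it tends to infinity (limit point).\<close>
lemma circle_distance:
  assumes z: "z \<notin> \<real>"
  shows "(cmod (m z - l j z))\<^sup>2 * sq_norm w (tail (N j) (\<phi> z)) \<le> cmod (m z - l j z) / \<bar>Im z\<bar>"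
proof -
  define d where "d = m z - l j z"
  let ?p = "psi (l j z) z" and ?c = "\<lambda>u k. cnj (u k :: complex)"
  define e where "e = W (\<phi> z) (?c ?p) (N j)"
  define D where "D = sq_norm w (tail (N j) (\<phi> z))"
  define S where "S = sq_norm w (tail (N j) (psi (m z) z))"
  have Im: "Im z \<noteq> 0" using z by (simp add: complex_is_Real_iff)
  have p0: "W ?p (?c ?p) (N j) = 0"
    by (intro cut_form_wronskian) (simp_all add: cut_form_cnj cut_form_psi[OF z])

  \<comment> \<open>Up to a factor the solution is real at the cut, so that \<open>e\<close> is the quotient of that factor
    and its conjugate.\<close>
  have 1: "W (?c ?p) (?c (\<phi> z)) (N j) = - 1"
    unfolding wronskian_cnj wronskian_swap[of a ?p "\<phi> z"] by (simp add: W_phi_psi)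
  have 2: "W (?c ?p) ?p (N j) = 0"
    unfolding wronskian_swap[of a "?c ?p" ?p] by (simp add: p0)
  have "e * W ?p (?c (\<phi> z)) (N j) = - 1"
    unfolding e_def wronskian_pluecker[of a "\<phi> z" "?c ?p" "N j" ?p "?c (\<phi> z)"] 1 2
    by (simp add: W_phi_psi)
  moreover have e': "W ?p (?c (\<phi> z)) (N j) = - cnj e"
    unfolding e_def wronskian_cnj[of a "\<phi> z" "?c ?p" "N j", symmetric]
      wronskian_swap[of a ?p "?c (\<phi> z)"] by simp
  ultimately have "e * cnj e = 1" by simp
  then have "complex_of_real ((cmod e)\<^sup>2) = 1" by (simp only: complex_norm_square)
  then have "(cmod e)\<^sup>2 = 1" by (simp only: of_real_eq_1_iff)
  then have e: "cmod e = 1" using norm_ge_zero[of e] power2_eq_1_iff[of "cmod e"] by linarith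
  have "W (psi (m z) z) (?c (psi (m z) z)) (N j)
      = d * e + cnj d * (- cnj e) + d * cnj d * W (\<phi> z) (?c (\<phi> z)) (N j)"
  proof -
    have p: "psi (m z) z = (\<lambda>k. ?p k + d * \<phi> z k)"
      unfolding d_def by (rule psi_shift)
    then have cp: "?c (psi (m z) z) = (\<lambda>k. cnj (?p k) + cnj d * cnj (\<phi> z k))" by simp
    show ?thesis
      unfolding cp unfolding p wronskian_lin_left wronskian_lin_right e'
      by (simp add: e_def[symmetric] p0 algebra_simps)
  qed
  then have "of_real (2 * (Im (m z) + Im z * S)) * \<i>
      = d * e - cnj (d * e) + of_real ((cmod d)\<^sup>2) * (of_real (2 * Im z * D) * \<i>)"
    by (simp only: green_norm_psi green_norm_phi S_def D_def complex_norm_square) simp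
  then have "2 * (Im (m z) + Im z * S) = 2 * Im (d * e) + (cmod d)\<^sup>2 * (2 * Im z * D)"
    by (simp add: complex_eq_iff)
  moreover have "A / y + S = B / y + C * D"
    if "2 * (A + y * S) = 2 * B + C * (2 * y * D)" "y \<noteq> 0" for A B C D S y :: real
    using that by (simp add: field_simps)
  ultimately have eq: "Im (m z) / Im z + S = Im (d * e) / Im z + (cmod d)\<^sup>2 * D"
    using Im by blast
  have "S \<le> - Im (m z) / Im z"
    unfolding S_def using tail_norm_le_norm(2)[OF psi_norm(1)[OF z]] psi_norm(2)[OF z]
    by (rule order.trans)
  then have "(cmod d)\<^sup>2 * D \<le> - Im (d * e) / Im z" 
    using eq unfolding minus_divide_left[symmetric] by linarith
  also have "\<dots> \<le> \<bar>- Im (d * e) / Im z\<bar>" by (rule abs_ge_self)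
  also have "\<dots> = \<bar>Im (d * e)\<bar> / \<bar>Im z\<bar>" by (simp only: abs_divide abs_minus_cancel)
  also have "\<dots> \<le> cmod (d * e) / \<bar>Im z\<bar>" by (intro divide_right_mono abs_Im_le_cmod) simp
  finally show ?thesis by (simp add: norm_mult e d_def D_def)
qed

text \<open>The Wronskian grows at most like the norm of \<open>\<phi> z\<close> up to the cut, and \<open>circle_distance\<close> shows that the
  factor tends to zero faster.\<close>
lemma cut_wronskian_vanishes:
  assumes z: "z \<notin> \<real>" and K: "K \<longlonglongrightarrow> K0"
    and bd: "\<And>j. sq_norm w (tail (N j) (psi (c j) z')) \<le> K j"
  shows "(\<lambda>j. (m z - l j z) * W (\<phi> z) (psi (c j) z') (N j)) \<longlonglongrightarrow> 0"
proof (rule Lim_null_comparison)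
  let ?d = "\<lambda>j. m z - l j z"
  show "\<forall>\<^sub>F j in sequentially. cmod (?d j * W (\<phi> z) (psi (c j) z') (N j))
      \<le> cmod (?d j) + cmod (z - z') * (sqrt (cmod (?d j) / \<bar>Im z\<bar>) * sqrt (K j))"
  proof (rule always_eventually, rule allI)
    fix j
    let ?P = "pairing w (tail (N j) (\<phi> z)) (tail (N j) (psi (c j) z'))"
    have "cmod (?d j) * cmod ?P \<le> cmod (?d j) *
        (sqrt (sq_norm w (tail (N j) (\<phi> z))) * sqrt (sq_norm w (tail (N j) (psi (c j) z'))))"
      by (intro mult_left_mono cauchy_schwarz tail_sq_summable psi_bounded phi_bounded) auto
    also have "\<dots> = sqrt ((cmod (?d j))\<^sup>2 * sq_norm w (tail (N j) (\<phi> z)))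
        * sqrt (sq_norm w (tail (N j) (psi (c j) z')))"
      by (simp add: real_sqrt_mult)
    also have "\<dots> \<le> sqrt (cmod (?d j) / \<bar>Im z\<bar>) * sqrt (K j)"
      by (intro mult_mono real_sqrt_le_mono circle_distance z bd) (auto simp: sq_norm_nonneg)
    finally have 1: "cmod (?d j) * cmod ?P \<le> sqrt (cmod (?d j) / \<bar>Im z\<bar>) * sqrt (K j)" .
    have "cmod (?d j * W (\<phi> z) (psi (c j) z') (N j))
        = cmod (?d j + (z - z') * (?d j * ?P))"
      by (simp add: green_phi_psi algebra_simps)
    also have "\<dots> \<le> cmod (?d j) + cmod (z - z') * (cmod (?d j) * cmod ?P)"
      by (metis norm_mult norm_triangle_ineq)
    also have "\<dots> \<le> cmod (?d j) + cmod (z - z') * (sqrt (cmod (?d j) / \<bar>Im z\<bar>) * sqrt (K j))"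
      using 1 by (intro add_left_mono mult_left_mono) auto
    finally show "cmod (?d j * W (\<phi> z) (psi (c j) z') (N j))
      \<le> cmod (?d j) + cmod (z - z') * (sqrt (cmod (?d j) / \<bar>Im z\<bar>) * sqrt (K j))" .
  qed
  have "(\<lambda>j. cmod (?d j) + cmod (z - z') * (sqrt (cmod (?d j) / \<bar>Im z\<bar>) * sqrt (K j)))
      \<longlonglongrightarrow> cmod (m z - m z) + cmod (z - z') * (sqrt (cmod (m z - m z) / \<bar>Im z\<bar>) * sqrt K0)"
    using z by (intro tendsto_intros l_lim K) (auto simp: complex_is_Real_iff)
  then show "(\<lambda>j. cmod (?d j) + cmod (z - z') * (sqrt (cmod (?d j) / \<bar>Im z\<bar>) * sqrt (K j)))
      \<longlonglongrightarrow> 0" by simp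
qed

text \<open>At the cut, the two functions \<open>psi\<close> with coefficients on the circles have Wronskian zero. Replacing
  these coefficients by the values of \<open>m\<close> produces only terms that vanish in the limit, so Green's
  formula holds with no contribution from the singular end.\<close>
lemma pairing_psi_psi:
  assumes z: "z \<notin> \<real>" and z': "z' \<notin> \<real>"
  shows "(z - z') * pairing w (psi (m z) z) (psi (m z') z') = m z' - m z"
proof -
  let ?p = "psi (m z) z" and ?p' = "psi (m z') z'"
  have "(\<lambda>j. pairing w (tail (N j) ?p) (tail (N j) ?p')) \<longlonglongrightarrow> pairing w ?p ?p'"
  proof -
    have "pairing w (tail (N j) ?p) (tail (N j) ?p') = pairing w (tail (N j) ?p) ?p'" for j
      unfolding pairing_def by (rule infsum_cong) (simp add: tail_def)
    moreover have "(\<lambda>j. pairing w (tail (N j) ?p) ?p') \<longlonglongrightarrow> pairing w ?p ?p'"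
      by (rule weak_limit[where B = "sq_norm w ?p"])
         (use tail_norm_le_norm[OF psi_norm(1)[OF z]] psi_norm(1)[OF z']
           in \<open>auto intro: tendsto_eventually eventually_tail\<close>)
    ultimately show ?thesis by simp
  qed
  then have "(\<lambda>j. (m z - m z') + (z - z') * pairing w (tail (N j) ?p) (tail (N j) ?p'))
      \<longlonglongrightarrow> (m z - m z') + (z - z') * pairing w ?p ?p'"
    by (intro tendsto_intros)
  then have 1: "(\<lambda>j. W ?p ?p' (N j)) \<longlonglongrightarrow> (m z - m z') + (z - z') * pairing w ?p ?p'"
    by (simp only: green_psi_psi)
  have "W ?p ?p' (N j) = (m z - l j z) * W (\<phi> z) ?p' (N j)
      - (m z' - l j z') * W (\<phi> z') (psi (l j z) z) (N j)" for j
  proof -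
    have "W (psi (l j z) z) (psi (l j z') z') (N j) = 0"
      by (intro cut_form_wronskian cut_form_psi z z')
    then have "W (psi (l j z) z) ?p' (N j) = (m z' - l j z') * W (psi (l j z) z) (\<phi> z') (N j)"
      unfolding psi_shift[of "m z'" z' "l j z'"] wronskian_lin_right by simp
    moreover have "W ?p ?p' (N j) = W (psi (l j z) z) ?p' (N j) + (m z - l j z) * W (\<phi> z) ?p' (N j)"
      unfolding psi_shift[of "m z" z "l j z"] wronskian_lin_left by simp
    ultimately show ?thesis using wronskian_swap[of a "psi (l j z) z" "\<phi> z'" "N j"] by simp
  qed
  moreover have "(\<lambda>j. (m z - l j z) * W (\<phi> z) ?p' (N j)
      - (m z' - l j z') * W (\<phi> z') (psi (l j z) z) (N j)) \<longlonglongrightarrow> 0 - 0"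
  proof (intro tendsto_diff)
    show "(\<lambda>j. (m z - l j z) * W (\<phi> z) ?p' (N j)) \<longlonglongrightarrow> 0"
      by (rule cut_wronskian_vanishes[OF z tendsto_const tail_norm_le_norm(2)[OF psi_norm(1)[OF z']]])
    have "(\<lambda>j. - Im (l j z) / Im z) \<longlonglongrightarrow> - Im (m z) / Im z"
      using z by (intro tendsto_intros l_lim) (auto simp: complex_is_Real_iff)
    then show "(\<lambda>j. (m z' - l j z') * W (\<phi> z') (psi (l j z) z) (N j)) \<longlonglongrightarrow> 0"
      by (rule cut_wronskian_vanishes[OF z']) (simp add: cut_psi_norm[OF z])
  qed
  ultimately have "(\<lambda>j. W ?p ?p' (N j)) \<longlonglongrightarrow> 0" by simp
  then have "(m z - m z') + (z - z') * pairing w ?p ?p' = 0"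
    using 1 LIMSEQ_unique by blast
  then show ?thesis by (simp add: algebra_simps eq_neg_iff_add_eq_0)
qed

definition green_fun :: "int \<Rightarrow> complex \<Rightarrow> int \<Rightarrow> complex" where
  "green_fun x z k = (if x \<le> k then psi (m z) z x * \<phi> z k else \<phi> z x * psi (m z) z k)"

lemma sum_below_le:
  assumes u: "sq_summable w u" and F: "finite F"
  shows "(\<Sum>i\<in>F \<inter> {..<n}. w i * (cmod (u i))\<^sup>2) \<le> sq_norm w u - sq_norm w (tail n u)"
proof -
  have "(\<Sum>i\<in>G. w i * (cmod (tail n u i))\<^sup>2)
      \<le> sq_norm w u - (\<Sum>i\<in>F \<inter> {..<n}. w i * (cmod (u i))\<^sup>2)" if G: "finite G" for G
  proof -
    have "(\<Sum>i\<in>G. w i * (cmod (tail n u i))\<^sup>2) = (\<Sum>i\<in>G \<inter> {n..}. w i * (cmod (tail n u i))\<^sup>2)"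
      by (rule sum.mono_neutral_right) (use G in \<open>auto simp: tail_def\<close>)
    also have "\<dots> = (\<Sum>i\<in>G \<inter> {n..}. w i * (cmod (u i))\<^sup>2)"
      by (rule sum.cong) (auto simp: tail_def)
    also have "\<dots> + (\<Sum>i\<in>F \<inter> {..<n}. w i * (cmod (u i))\<^sup>2)
        = (\<Sum>i\<in>(G \<inter> {n..}) \<union> (F \<inter> {..<n}). w i * (cmod (u i))\<^sup>2)"
      by (rule sum.union_disjoint[symmetric]) (use F G in auto)
    also have "\<dots> \<le> sq_norm w u"
      by (rule sum_le_sq_norm[OF u]) (use F G in auto)
    finally show ?thesis by simp
  qed
  from sq_summable_boundI(2)[OF this] show ?thesis by simp
qed

lemma wronskian_diagonal:
  "u n * cnj (u n) * W v (\<lambda>k. cnj (v k)) n - v n * cnj (v n) * W u (\<lambda>k. cnj (u k)) n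
     = cnj (u n * v n) * W v u n - u n * v n * cnj (W v u n)"
  by (simp add: wronskian_def algebra_simps)

text \<open>On each side of the index \<open>x\<close> the squared norm is given or bounded by a Wronskian at \<open>x\<close>, and \<open>wronskian_diagonal\<close> combines
  the two terms into the value of the Green function on the diagonal.\<close>
lemma green_fun_norm:
  assumes z: "z \<notin> \<real>"
  shows "sq_summable w (green_fun x z)"
    "sq_norm w (green_fun x z) \<le> - Im (\<phi> z x * psi (m z) z x) / Im z"
proof -
  define p where "p = psi (m z) z"
  have Im: "Im z \<noteq> 0" using z by (simp add: complex_is_Real_iff)
  have p: "sq_summable w p" "sq_norm w p \<le> - Im (m z) / Im z"
    using psi_norm[OF z] by (simp_all add: p_def)
  define D where "D = sq_norm w (tail x (\<phi> z))"
  define S where "S = sq_norm w (tail x p)"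
  have "(\<Sum>i\<in>F. w i * (cmod (green_fun x z i))\<^sup>2) \<le> - Im (\<phi> z x * p x) / Im z"
    if F: "finite F" for F
  proof -
    have "(\<Sum>i\<in>F. w i * (cmod (green_fun x z i))\<^sup>2)
        = (\<Sum>i\<in>(F \<inter> {x..}) \<union> (F \<inter> {..<x}). w i * (cmod (green_fun x z i))\<^sup>2)"
      by (rule sum.cong) auto
    also have "\<dots> = (\<Sum>i\<in>F \<inter> {x..}. w i * (cmod (green_fun x z i))\<^sup>2)
        + (\<Sum>i\<in>F \<inter> {..<x}. w i * (cmod (green_fun x z i))\<^sup>2)"
      by (rule sum.union_disjoint) (use F in auto)
    also have "(\<Sum>i\<in>F \<inter> {x..}. w i * (cmod (green_fun x z i))\<^sup>2)
        = (cmod (p x))\<^sup>2 * (\<Sum>i\<in>F \<inter> {x..}. w i * (cmod (tail x (\<phi> z) i))\<^sup>2)"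
      unfolding sum_distrib_left
      by (rule sum.cong) (auto simp: green_fun_def tail_def norm_mult power_mult_distrib p_def)
    also have "(\<Sum>i\<in>F \<inter> {..<x}. w i * (cmod (green_fun x z i))\<^sup>2)
        = (cmod (\<phi> z x))\<^sup>2 * (\<Sum>i\<in>F \<inter> {..<x}. w i * (cmod (p i))\<^sup>2)"
      unfolding sum_distrib_left
      by (rule sum.cong) (auto simp: green_fun_def norm_mult power_mult_distrib p_def)
    also have "(cmod (p x))\<^sup>2 * (\<Sum>i\<in>F \<inter> {x..}. w i * (cmod (tail x (\<phi> z) i))\<^sup>2)
          + (cmod (\<phi> z x))\<^sup>2 * (\<Sum>i\<in>F \<inter> {..<x}. w i * (cmod (p i))\<^sup>2)
        \<le> (cmod (p x))\<^sup>2 * D + (cmod (\<phi> z x))\<^sup>2 * (sq_norm w p - S)"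
      unfolding D_def S_def
      by (intro add_mono mult_left_mono sum_le_sq_norm sum_below_le p tail_sq_summable phi_bounded)
         (use F in auto)
    also have "\<dots> \<le> (cmod (p x))\<^sup>2 * D + (cmod (\<phi> z x))\<^sup>2 * (- Im (m z) / Im z - S)"
      using p(2) by (intro add_left_mono mult_left_mono) auto
    also have "\<dots> = - Im (\<phi> z x * p x) / Im z"
    proof -
      have "of_real ((cmod (p x))\<^sup>2) * (of_real (2 * Im z * D) * \<i>)
          - of_real ((cmod (\<phi> z x))\<^sup>2) * (of_real (2 * (Im (m z) + Im z * S)) * \<i>)
          = cnj (p x * \<phi> z x) - p x * \<phi> z x"
        using wronskian_diagonal[of p x "\<phi> z"]
        unfolding complex_norm_square p_def green_norm_phi green_norm_psi W_phi_psi D_def S_def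
        by simp
      then have "(cmod (p x))\<^sup>2 * (2 * Im z * D) - (cmod (\<phi> z x))\<^sup>2 * (2 * (Im (m z) + Im z * S))
          = - 2 * Im (\<phi> z x * p x)"
        by (simp add: complex_eq_iff algebra_simps)
      moreover have "2 * Im z * ((cmod (p x))\<^sup>2 * D + (cmod (\<phi> z x))\<^sup>2 * (- Im (m z) / Im z - S))
          = (cmod (p x))\<^sup>2 * (2 * Im z * D) - (cmod (\<phi> z x))\<^sup>2 * (2 * (Im (m z) + Im z * S))"
        using Im by (simp add: field_simps)
      ultimately have "2 * Im z * ((cmod (p x))\<^sup>2 * D + (cmod (\<phi> z x))\<^sup>2 * (- Im (m z) / Im z - S))
          = - 2 * Im (\<phi> z x * p x)"
        by simp
      moreover have "A = - B / y" if "2 * y * A = - 2 * B" "y \<noteq> 0" for A B y :: real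
        using that by (simp add: field_simps)
      ultimately show ?thesis using Im by blast
    qed
    finally show ?thesis .
  qed
  then show "sq_summable w (green_fun x z)"
    "sq_norm w (green_fun x z) \<le> - Im (\<phi> z x * psi (m z) z x) / Im z"
    using sq_summable_boundI unfolding p_def by blast+
qed

text \<open>This is the bound of the resolvent by \<open>1 / \<bar>Im z\<bar>\<close>: the norm dominates the diagonal value,
  which by \<open>green_fun_norm\<close> in turn dominates the square of the norm, up to factors.\<close>
lemma green_fun_bound:
  assumes z: "z \<notin> \<real>"
  shows "sqrt (sq_norm w (green_fun x z)) \<le> (1 / sqrt (w x)) / \<bar>Im z\<bar>"
proof -
  define g where "g = cmod (green_fun x z x)"
  define n where "n = sq_norm w (green_fun x z)"
  have Im: "\<bar>Im z\<bar> > 0" using z by (simp add: complex_is_Real_iff)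
  have "n \<le> \<bar>- Im (\<phi> z x * psi (m z) z x) / Im z\<bar>"
    using green_fun_norm(2)[OF z, of x] unfolding n_def by linarith
  also have "\<dots> = \<bar>Im (\<phi> z x * psi (m z) z x)\<bar> / \<bar>Im z\<bar>"
    by (simp only: abs_divide abs_minus_cancel)
  also have "\<dots> \<le> cmod (\<phi> z x * psi (m z) z x) / \<bar>Im z\<bar>"
    by (intro divide_right_mono abs_Im_le_cmod) simp
  finally have "n \<le> g / \<bar>Im z\<bar>" by (simp add: g_def green_fun_def mult.commute)
  then have ng: "n * \<bar>Im z\<bar> \<le> g" using Im by (simp add: field_simps)
  have n0: "0 \<le> n" unfolding n_def by (rule sq_norm_nonneg)
  have gn: "w x * g\<^sup>2 \<le> n"
    using sum_le_sq_norm[OF green_fun_norm(1)[OF z], of "{x}" x] by (simp add: g_def n_def)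
  have "w x * (n * \<bar>Im z\<bar>)\<^sup>2 \<le> w x * g\<^sup>2"
    using ng n0 Im w_nonneg[of x] by (intro mult_left_mono power_mono) auto
  then have "w x * (n * \<bar>Im z\<bar>)\<^sup>2 \<le> n" using gn by simp
  then have "n * (w x * n * \<bar>Im z\<bar>\<^sup>2) \<le> n * 1"
    by (simp add: power2_eq_square algebra_simps)
  then have "w x * n * \<bar>Im z\<bar>\<^sup>2 \<le> 1 \<or> n = 0" using n0 by (auto simp: mult_le_cancel_left)
  then have "n \<le> 1 / (w x * \<bar>Im z\<bar>\<^sup>2)"
    using w_pos[of x] Im by (auto simp: field_simps)
  then have "sqrt n \<le> sqrt (1 / (w x * \<bar>Im z\<bar>\<^sup>2))" by (rule real_sqrt_le_mono)
  then show ?thesis using Im by (simp add: n_def real_sqrt_divide real_sqrt_mult)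
qed

end

section \<open>Orthogonality and completeness of the eigenfunctions\<close>

locale discrete_spectrum = weyl_problem +
  fixes eig :: "nat \<Rightarrow> real"
  assumes m_meromorphic: "m meromorphic_on UNIV"
    and m_analytic: "m analytic_on - {z. is_pole m z}"
    and eig_poles: "bij_betw (\<lambda>k. complex_of_real (eig k)) UNIV {z. is_pole m z}"
begin

lemma poles_real: "is_pole m z \<Longrightarrow> z \<in> \<real>"
proof -
  assume "is_pole m z"
  then have "z \<in> range (\<lambda>k. complex_of_real (eig k))"
    using eig_poles unfolding bij_betw_def by blast
  then show ?thesis by auto
qed

lemma m_holomorphic: "m holomorphic_on - \<real>"
  using m_analytic analytic_imp_holomorphic holomorphic_on_subset poles_real
  by (metis (mono_tags, lifting) Compl_subset_Compl_iff mem_Collect_eq subsetI)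

lemma psi_holomorphic: "(\<lambda>z. psi (m z) z n) holomorphic_on - \<real>"
  unfolding psi_def by (intro holomorphic_intros m_holomorphic)

lemma m_cnj:
  assumes z: "z \<notin> \<real>"
  shows "m (cnj z) = cnj (m z)"
proof -
  have "l j (cnj z) = cnj (l j z)" for j
    by (simp add: l_def cut_form_def phi_cnj theta_cnj)
  moreover have "(\<lambda>j. cnj (l j z)) \<longlonglongrightarrow> cnj (m z)"
    by (intro tendsto_intros l_lim z)
  moreover have "(\<lambda>j. l j (cnj z)) \<longlonglongrightarrow> m (cnj z)"
    using z by (intro l_lim) (simp add: complex_is_Real_iff)
  ultimately show ?thesis using LIMSEQ_unique by simp
qed

text \<open>At an index where \<open>\<phi>\<close> does not vanish, the norm of \<open>psi\<close> is bounded below by the value there, which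
  is of the order of \<open>\<bar>m\<bar>\<close>; its square is bounded above by \<open>\<bar>m\<bar> / \<bar>y\<bar>\<close>. So \<open>m\<close> is of the order of
  \<open>1 / \<bar>y\<bar>\<close> at most. This makes the poles of \<open>m\<close> simple.\<close>
lemma m_growth: "((\<lambda>y. of_real y ^ 2 * m (of_real x + \<i> * of_real y)) \<longlongrightarrow> 0) (at (0::real))"
proof -
  let ?z = "\<lambda>y. complex_of_real x + \<i> * of_real y"
  obtain n where n: "\<phi> (of_real x) n \<noteq> 0"
    using W_phi_theta[of "of_real x" 0] by (force simp: wronskian_def)
  define C where "C = cmod (\<phi> (of_real x) n) / 2"
  define T where "T = cmod (\<theta> (of_real x) n) + 1"
  have C: "0 < C" using n by (simp add: C_def)
  have "((\<lambda>y. cmod (\<phi> (?z y) n)) \<longlongrightarrow> cmod (\<phi> (of_real x) n)) (at (0::real))"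
    by (intro tendsto_intros tendsto_along_line[OF phi_holomorphic open_UNIV]) simp
  moreover have "C < cmod (\<phi> (of_real x) n)" using n by (simp add: C_def)
  ultimately have ev1: "\<forall>\<^sub>F y in at (0::real). C < cmod (\<phi> (?z y) n)"
    by (rule order_tendstoD)
  have "((\<lambda>y. cmod (\<theta> (?z y) n)) \<longlongrightarrow> cmod (\<theta> (of_real x) n)) (at (0::real))"
    by (intro tendsto_intros tendsto_along_line[OF theta_holomorphic open_UNIV]) simp
  then have ev2: "\<forall>\<^sub>F y in at (0::real). cmod (\<theta> (?z y) n) < T"
    by (rule order_tendstoD) (simp add: T_def)
  show ?thesis
  proof (rule Lim_null_comparison)
    show "\<forall>\<^sub>F y in at (0::real). cmod (of_real y ^ 2 * m (?z y))
        \<le> y\<^sup>2 * (2 * T / C) + \<bar>y\<bar> * (1 / (C\<^sup>2 * w n))"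
      using ev1 ev2 eventually_neq_at_within[of 0]
    proof eventually_elim
      case (elim y)
      define M where "M = cmod (m (?z y))"
      have y: "\<bar>y\<bar> > 0" using elim by simp
      have z: "?z y \<notin> \<real>" using elim by (simp add: complex_is_Real_iff)
      have "w n * (cmod (psi (m (?z y)) (?z y) n))\<^sup>2 \<le> - Im (m (?z y)) / Im (?z y)"
        using sum_le_sq_norm[OF psi_norm(1)[OF z], of "{n}"] psi_norm(2)[OF z] by simp
      also have "\<dots> \<le> \<bar>- Im (m (?z y)) / Im (?z y)\<bar>" by (rule abs_ge_self)
      also have "\<dots> = \<bar>Im (m (?z y))\<bar> / \<bar>y\<bar>" by (simp add: abs_divide)
      also have "\<dots> \<le> M / \<bar>y\<bar>" unfolding M_def by (intro divide_right_mono abs_Im_le_cmod) simp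
      finally have 1: "(cmod (psi (m (?z y)) (?z y) n))\<^sup>2 \<le> M / (w n * \<bar>y\<bar>)"
        using w_pos[of n] y by (simp add: field_simps)
      define p where "p = cmod (psi (m (?z y)) (?z y) n)"
      have "M * cmod (\<phi> (?z y) n) = cmod (psi (m (?z y)) (?z y) n - \<theta> (?z y) n)"
        by (simp add: psi_def M_def norm_mult)
      also have "\<dots> \<le> p + cmod (\<theta> (?z y) n)" unfolding p_def by (rule norm_triangle_ineq4)
      finally have 2: "C * M \<le> T + p"
        using elim mult_left_mono[of C "cmod (\<phi> (?z y) n)" M] by (simp add: M_def mult.commute)
      \<comment> \<open>The inequality of the means absorbs one half of \<open>C * M\<close>; what remains is of order \<open>1 / \<bar>y\<bar>\<close>.\<close>
      define h where "h = 1 / (C * w n * \<bar>y\<bar>)"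
      have "p\<^sup>2 \<le> (C * M) * h" using 1 C by (simp add: p_def h_def)
      also have "\<dots> \<le> ((C * M + h) / 2)\<^sup>2"
        using sum_squares_bound[of "C * M" h] by (simp add: power2_sum power_divide)
      finally have "p \<le> (C * M + h) / 2"
        by (rule power2_le_imp_le) (use C y w_pos[of n] in \<open>auto simp: M_def h_def intro!: add_nonneg_nonneg\<close>)
      with 2 have "C * M \<le> 2 * T + h" by simp
      then have "M \<le> 2 * T / C + h / C" using C by (simp add: field_simps)
      then have "y\<^sup>2 * M \<le> y\<^sup>2 * (2 * T / C + h / C)" by (rule mult_left_mono) simp
      also have "\<dots> = y\<^sup>2 * (2 * T / C) + \<bar>y\<bar> * (1 / (C\<^sup>2 * w n))"
      proof -
        have "t * t * (1 / (C * v * t) / C) = t * (1 / (C\<^sup>2 * v))" if "0 < t" "0 < v" for t v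
          using that C by (simp add: field_simps power2_eq_square)
        from this[OF y w_pos[of n]] have "y\<^sup>2 * (h / C) = \<bar>y\<bar> * (1 / (C\<^sup>2 * w n))"
          by (simp only: h_def power2_eq_square abs_mult_self_eq)
        then show ?thesis by (simp only: distrib_left)
      qed
      finally show ?case by (simp add: norm_mult norm_power M_def)
    qed
    have "((\<lambda>y. y\<^sup>2 * (2 * T / C) + \<bar>y\<bar> * (1 / (C\<^sup>2 * w n)))
        \<longlongrightarrow> 0\<^sup>2 * (2 * T / C) + \<bar>0\<bar> * (1 / (C\<^sup>2 * w n))) (at (0::real))"
      by (intro tendsto_intros)
    then show "((\<lambda>y. y\<^sup>2 * (2 * T / C) + \<bar>y\<bar> * (1 / (C\<^sup>2 * w n))) \<longlongrightarrow> 0) (at (0::real))"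
      by simp
  qed
qed

text \<open>Poles and regular points on the real axis are treated alike, with residue zero at the latter.\<close>
lemma m_local_form:
  obtains d M where "0 < d" "M holomorphic_on ball (of_real x) d"
    "M (of_real x) = residue m (of_real x)"
    "\<And>z. z \<in> ball (of_real x) d - {of_real x} \<Longrightarrow> m z = M z / (z - of_real x)"
    "\<And>z. z \<in> ball (of_real x) d \<Longrightarrow> z \<notin> \<real> \<Longrightarrow> M (cnj z) = cnj (M z)"
proof -
  obtain d M where dM: "0 < d" "M holomorphic_on ball (of_real x) d"
    "M (of_real x) = residue m (of_real x)"
    "\<And>z. z \<in> ball (of_real x) d - {of_real x} \<Longrightarrow> m z = M z / (z - of_real x)"
  proof (cases "is_pole m (of_real x)")
    case True
    show thesis
      by (rule simple_pole_real[OF m_meromorphic True m_growth]) (rule that)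
  next
    case False
    then have "m analytic_on {of_real x}" using m_analytic analytic_on_subset by blast
    then obtain d where d: "0 < d" "m holomorphic_on ball (of_real x) d"
      by (auto simp: analytic_on_def)
    show thesis
    proof (rule that[of d "\<lambda>z. (z - of_real x) * m z"])
      show "(of_real x - of_real x) * m (of_real x) = residue m (of_real x)"
        using residue_holo[OF open_ball _ d(2)] d(1) by simp
    qed (use d in \<open>auto intro!: holomorphic_intros\<close>)
  qed
  moreover have "M (cnj z) = cnj (M z)" if z: "z \<in> ball (of_real x) d" "z \<notin> \<real>" for z
  proof -
    have cz: "cnj z \<in> ball (of_real x) d"
      using z(1) complex_mod_cnj[of "of_real x - z"] by (simp add: dist_norm)
    have ne: "z \<noteq> of_real x" "cnj z \<noteq> of_real x"
      using z(2) by (auto, metis complex_cnj_cnj complex_cnj_complex_of_real Reals_of_real)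
    have "M z = (z - of_real x) * m z" using dM(4)[of z] z ne by simp
    moreover have "M (cnj z) = (cnj z - of_real x) * m (cnj z)" using dM(4)[of "cnj z"] cz ne by simp
    ultimately show ?thesis using m_cnj[OF z(2)] by simp
  qed
  ultimately show thesis using that by blast
qed

lemma m_residue_limit:
  "((\<lambda>s. \<i> * of_real s * m (of_real x + \<i> * of_real s)) \<longlongrightarrow> residue m (of_real x)) (at 0)"
proof -
  obtain r M where r: "0 < r" and M: "M holomorphic_on ball (of_real x) r"
    "M (of_real x) = residue m (of_real x)"
    "\<And>z. z \<in> ball (of_real x) r - {of_real x} \<Longrightarrow> m z = M z / (z - of_real x)"
    "\<And>z. z \<in> ball (of_real x) r \<Longrightarrow> z \<notin> \<real> \<Longrightarrow> M (cnj z) = cnj (M z)"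
    using m_local_form by blast
  have x: "complex_of_real x \<in> ball (of_real x) r" using r by simp
  show ?thesis
  proof (rule Lim_transform_eventually)
    show "((\<lambda>s. M (of_real x + \<i> * of_real s)) \<longlongrightarrow> residue m (of_real x)) (at (0::real))"
      using tendsto_along_line[OF M(1) open_ball x] by (simp only: M(2))
    show "\<forall>\<^sub>F s in at (0::real). M (of_real x + \<i> * of_real s)
        = \<i> * of_real s * m (of_real x + \<i> * of_real s)"
      using eventually_vertical[OF open_ball x] eventually_neq_at_within[of 0]
    proof eventually_elim
      case (elim s)
      then show ?case using M(3)[of "of_real x + \<i> * of_real s"] by simp
    qed
  qed
qed

text \<open>At a real point the factor removes the singularity of \<open>psi\<close>, and likewise of the Green function; the
  value at the point itself is the one that continuity prescribes.\<close>
definition scaled_psi :: "real \<Rightarrow> complex \<Rightarrow> int \<Rightarrow> complex" where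
  "scaled_psi x z k = (if z = of_real x then residue m z * \<phi> z k
     else (z - of_real x) * psi (m z) z k)"

definition scaled_green_fun :: "real \<Rightarrow> int \<Rightarrow> complex \<Rightarrow> int \<Rightarrow> complex" where
  "scaled_green_fun x n z k = (if z = of_real x then residue m z * \<phi> z n * \<phi> z k
     else (z - of_real x) * green_fun n z k)"

lemma scaled_psi_local_form:
  assumes M: "M (of_real x) = residue m (of_real x)"
      "\<And>z. z \<in> ball (of_real x) r - {of_real x} \<Longrightarrow> m z = M z / (z - of_real x)"
    and z: "z \<in> ball (of_real x) r"
  shows "scaled_psi x z k = (z - of_real x) * \<theta> z k + M z * \<phi> z k"
proof (cases "z = of_real x")
  case True
  then show ?thesis using M(1) by (simp add: scaled_psi_def)
next
  case False
  then have Mz: "M z = (z - of_real x) * m z" using M(2)[of z] z by simp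
  show ?thesis unfolding Mz using False by (simp add: scaled_psi_def psi_def algebra_simps)
qed

lemma scaled_psi_simps:
  "scaled_psi x (of_real x) = (\<lambda>k. residue m (of_real x) * \<phi> (of_real x) k)"
  "z \<notin> \<real> \<Longrightarrow> scaled_psi x z = (\<lambda>k. (z - of_real x) * psi (m z) z k)"
  by (auto simp: scaled_psi_def fun_eq_iff)

lemma scaled_green_fun_simps:
  "scaled_green_fun x n (of_real x)
     = (\<lambda>k. residue m (of_real x) * \<phi> (of_real x) n * \<phi> (of_real x) k)"
  "z \<notin> \<real> \<Longrightarrow> scaled_green_fun x n z = (\<lambda>k. (z - of_real x) * green_fun n z k)"
  by (auto simp: scaled_green_fun_def fun_eq_iff)

lemma scaled_psi_near_real:
  obtains r where "0 < r" "sq_summable w (scaled_psi x (of_real x))"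
    "\<And>v. sq_summable w v \<Longrightarrow>
       (\<lambda>z. pairing w (scaled_psi x z) v) holomorphic_on ball (of_real x) r"
proof -
  obtain r M where r: "0 < r" and M: "M holomorphic_on ball (of_real x) r"
    "M (of_real x) = residue m (of_real x)"
    "\<And>z. z \<in> ball (of_real x) r - {of_real x} \<Longrightarrow> m z = M z / (z - of_real x)"
    "\<And>z. z \<in> ball (of_real x) r \<Longrightarrow> z \<notin> \<real> \<Longrightarrow> M (cnj z) = cnj (M z)"
    using m_local_form by blast
  have bd: "sq_summable w (scaled_psi x z) \<and>
      sq_norm w (scaled_psi x z) \<le> - Im (M z * cnj (z - of_real x)) / Im z"
    if z: "z \<in> ball (of_real x) r" "z \<notin> \<real>" for z
  proof
    have ne: "z \<noteq> of_real x" using z by auto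
    note eq = scaled_psi_simps(2)[OF z(2)]
    show "sq_summable w (scaled_psi x z)"
      unfolding eq by (rule sq_summable_cmult[OF psi_norm(1)[OF z(2)]])
    have "sq_norm w (scaled_psi x z) \<le> (cmod (z - of_real x))\<^sup>2 * (- Im (m z) / Im z)"
      unfolding eq sq_norm_cmult by (intro mult_left_mono psi_norm z) simp
    also have "\<dots> = - ((cmod (z - of_real x))\<^sup>2 * Im (M z / (z - of_real x))) / Im z"
      using M(3)[of z] z ne by simp
    finally show "sq_norm w (scaled_psi x z) \<le> - Im (M z * cnj (z - of_real x)) / Im z"
      unfolding Im_divide_shift[OF ne] .
  qed
  have hol: "(\<lambda>z. scaled_psi x z k) holomorphic_on ball (of_real x) r" for k
  proof (rule holomorphic_transform)
    show "(\<lambda>z. (z - of_real x) * \<theta> z k + M z * \<phi> z k) holomorphic_on ball (of_real x) r"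
      by (intro holomorphic_intros M)
  qed (rule scaled_psi_local_form[OF M(2) M(3), symmetric])
  show thesis
  proof (rule pairing_holomorphic_near_real[OF r M(1) _ hol bd])
    fix e
    assume e: "0 < e" "sq_summable w (scaled_psi x (of_real x))"
      "\<And>v. sq_summable w v \<Longrightarrow> (\<lambda>z. pairing w (scaled_psi x z) v) holomorphic_on ball (of_real x) e"
    show thesis by (rule that[OF e])
  qed (rule M(4))
qed

lemma scaled_green_fun_near_real:
  obtains r where "0 < r"
    "\<And>v. sq_summable w v \<Longrightarrow>
       (\<lambda>z. pairing w (scaled_green_fun x n z) v) holomorphic_on ball (of_real x) r"
proof -
  obtain r M where r: "0 < r" and M: "M holomorphic_on ball (of_real x) r"
    "M (of_real x) = residue m (of_real x)"
    "\<And>z. z \<in> ball (of_real x) r - {of_real x} \<Longrightarrow> m z = M z / (z - of_real x)"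
    "\<And>z. z \<in> ball (of_real x) r \<Longrightarrow> z \<notin> \<real> \<Longrightarrow> M (cnj z) = cnj (M z)"
    using m_local_form by blast
  have local_form: "scaled_psi x z k = (z - of_real x) * \<theta> z k + M z * \<phi> z k"
    if "z \<in> ball (of_real x) r" for z k
    by (rule scaled_psi_local_form[OF M(2) M(3) that])
  have psi_hol: "(\<lambda>z. scaled_psi x z k) holomorphic_on ball (of_real x) r" for k
  proof (rule holomorphic_transform)
    show "(\<lambda>z. (z - of_real x) * \<theta> z k + M z * \<phi> z k) holomorphic_on ball (of_real x) r"
      by (intro holomorphic_intros M)
  qed (rule local_form[symmetric])
  define P where "P z = \<phi> z n * scaled_psi x z n" for z
  have P_hol: "P holomorphic_on ball (of_real x) r"
    unfolding P_def by (intro holomorphic_intros psi_hol)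
  have P_refl: "P (cnj z) = cnj (P z)" if z: "z \<in> ball (of_real x) r" "z \<notin> \<real>" for z
  proof -
    have cz: "cnj z \<in> ball (of_real x) r"
      using z(1) complex_mod_cnj[of "of_real x - z"] by (simp add: dist_norm)
    show ?thesis
      unfolding P_def local_form[OF z(1)] local_form[OF cz]
      by (simp add: M(4)[OF z] phi_cnj theta_cnj)
  qed
  have eq: "scaled_green_fun x n z k
      = (if n \<le> k then scaled_psi x z n * \<phi> z k else \<phi> z n * scaled_psi x z k)" for z k
    by (simp add: scaled_green_fun_def scaled_psi_def green_fun_def)
  have hol: "(\<lambda>z. scaled_green_fun x n z k) holomorphic_on ball (of_real x) r" for k
    unfolding eq by (cases "n \<le> k") (auto intro!: holomorphic_intros psi_hol)
  have bd: "sq_summable w (scaled_green_fun x n z) \<and>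
      sq_norm w (scaled_green_fun x n z) \<le> - Im (P z * cnj (z - of_real x)) / Im z"
    if z: "z \<in> ball (of_real x) r" "z \<notin> \<real>" for z
  proof
    have ne: "z \<noteq> of_real x" using z by auto
    note eq = scaled_green_fun_simps(2)[OF z(2)]
    show "sq_summable w (scaled_green_fun x n z)"
      unfolding eq by (rule sq_summable_cmult[OF green_fun_norm(1)[OF z(2)]])
    have "sq_norm w (scaled_green_fun x n z)
        \<le> (cmod (z - of_real x))\<^sup>2 * (- Im (\<phi> z n * psi (m z) z n) / Im z)"
      unfolding eq sq_norm_cmult by (intro mult_left_mono green_fun_norm z) simp
    also have "\<phi> z n * psi (m z) z n = P z / (z - of_real x)"
      using ne by (simp add: P_def scaled_psi_def)
    also have "(cmod (z - of_real x))\<^sup>2 * (- Im (P z / (z - of_real x)) / Im z)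
        = - ((cmod (z - of_real x))\<^sup>2 * Im (P z / (z - of_real x))) / Im z"
      by (simp only: mult_minus_right times_divide_eq_right)
    finally show "sq_norm w (scaled_green_fun x n z) \<le> - Im (P z * cnj (z - of_real x)) / Im z"
      unfolding Im_divide_shift[OF ne] .
  qed
  show thesis
  proof (rule pairing_holomorphic_near_real[OF r P_hol _ hol bd])
    fix e
    assume e: "0 < e"
      "\<And>v. sq_summable w v \<Longrightarrow> (\<lambda>z. pairing w (scaled_green_fun x n z) v) holomorphic_on ball (of_real x) e"
    show thesis by (rule that[OF e])
  qed (rule P_refl)
qed

lemma residue_nonzero: "residue m (of_real (eig k)) \<noteq> 0"
proof -
  have "is_pole m (of_real (eig k))" using eig_poles by (auto simp: bij_betw_def)
  then show ?thesis
    by (rule simple_pole_real[OF m_meromorphic _ m_growth])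
qed

lemma eig_inj: "eig j = eig k \<longleftrightarrow> j = k"
  using eig_poles by (auto simp: bij_betw_def inj_on_def)

lemma phi_summable: "sq_summable w (\<phi> (of_real (eig k)))"
proof -
  have "sq_summable w (scaled_psi (eig k) (of_real (eig k)))"
    by (rule scaled_psi_near_real)
  then have "sq_summable w (\<lambda>i. residue m (of_real (eig k)) * \<phi> (of_real (eig k)) i)"
    unfolding scaled_psi_simps .
  then have "sq_summable w (\<lambda>i. inverse (residue m (of_real (eig k))) *
      (residue m (of_real (eig k)) * \<phi> (of_real (eig k)) i))"
    by (rule sq_summable_cmult)
  then show ?thesis using residue_nonzero by (simp flip: mult.assoc)
qed

text \<open>The residue of \<open>pairing_psi_psi\<close> in the first variable.\<close>
lemma pairing_phi_psi:
  assumes y: "y \<notin> \<real>"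
  shows "(y - of_real (eig k)) * pairing w (\<phi> (of_real (eig k))) (psi (m y) y) = 1"
proof -
  let ?x = "complex_of_real (eig k)"
  let ?X = "scaled_psi (eig k)"
  obtain d where d: "0 < d"
    and hol: "\<And>v. sq_summable w v \<Longrightarrow> (\<lambda>z. pairing w (?X z) v) holomorphic_on ball ?x d"
    using scaled_psi_near_real[of "eig k"] by blast
  note X = scaled_psi_simps
  have in_ball: "?x \<in> ball ?x d" using d by auto
  let ?z = "\<lambda>s. ?x + \<i> * complex_of_real s"
  have z_lim: "(?z \<longlongrightarrow> ?x) (at 0)"
    by (auto intro!: tendsto_eq_intros)
  have "((\<lambda>s. (?z s - y) * pairing w (?X (?z s)) (psi (m y) y))
      \<longlongrightarrow> (?x - y) * pairing w (?X ?x) (psi (m y) y)) (at 0)"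
    by (intro tendsto_mult tendsto_diff z_lim tendsto_const
        tendsto_along_line[OF hol[OF psi_norm(1)[OF y]] open_ball in_ball])
  moreover have "((\<lambda>s. (?z s - ?x) * m y - \<i> * of_real s * m (?z s))
      \<longlongrightarrow> (?x - ?x) * m y - residue m ?x) (at 0)"
    by (intro tendsto_mult tendsto_diff z_lim tendsto_const m_residue_limit)
  moreover have "\<forall>\<^sub>F s in at (0::real). (?z s - y) * pairing w (?X (?z s)) (psi (m y) y)
      = (?z s - ?x) * m y - \<i> * of_real s * m (?z s)"
    using eventually_neq_at_within[of 0]
  proof eventually_elim
    case (elim s)
    then have z: "?z s \<notin> \<real>" by (auto simp: complex_is_Real_iff)
    have "(?z s - y) * pairing w (?X (?z s)) (psi (m y) y)
        = (?z s - ?x) * ((?z s - y) * pairing w (psi (m (?z s)) (?z s)) (psi (m y) y))"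
      unfolding X(2)[OF z] pairing_cmult by (simp add: mult_ac)
    also have "\<dots> = (?z s - ?x) * (m y - m (?z s))"
      unfolding pairing_psi_psi[OF z y] ..
    also have "\<dots> = (?z s - ?x) * m y - \<i> * of_real s * m (?z s)"
      by (simp add: algebra_simps)
    finally show ?case .
  qed
  ultimately have "(?x - y) * pairing w (?X ?x) (psi (m y) y) = (?x - ?x) * m y - residue m ?x"
    by (rule limits_eq)
  then have "residue m ?x * ((y - ?x) * pairing w (\<phi> ?x) (psi (m y) y)) = residue m ?x * 1"
    unfolding X(1) pairing_cmult by (simp add: algebra_simps)
  then show ?thesis using residue_nonzero[of k] mult_left_cancel by blast
qed

text \<open>The residue of \<open>pairing_phi_psi\<close> in the remaining variable. The factors \<open>z - eig j\<close> and
  \<open>z - eig k\<close> cancel exactly if the two eigenvalues coincide.\<close>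
lemma pairing_phi_phi:
  "residue m (of_real (eig j)) * pairing w (\<phi> (of_real (eig j))) (\<phi> (of_real (eig k)))
     = (if j = k then 1 else 0)"
proof -
  let ?x = "complex_of_real (eig j)" and ?y = "complex_of_real (eig k)"
  let ?X = "scaled_psi (eig j)"
  obtain d where d: "0 < d"
    and hol: "\<And>v. sq_summable w v \<Longrightarrow> (\<lambda>z. pairing w (?X z) v) holomorphic_on ball ?x d"
    using scaled_psi_near_real[of "eig j"] by blast
  note X = scaled_psi_simps
  have in_ball: "?x \<in> ball ?x d" using d by auto
  let ?z = "\<lambda>s. ?x + \<i> * complex_of_real s"
  have lim: "((\<lambda>s. pairing w (?X (?z s)) (\<phi> ?y)) \<longlongrightarrow> pairing w (?X ?x) (\<phi> ?y)) (at 0)"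
    by (rule tendsto_along_line[OF hol[OF phi_summable] open_ball in_ball])
  have ev: "\<forall>\<^sub>F s in at (0::real). (?z s - ?y) * pairing w (?X (?z s)) (\<phi> ?y) = ?z s - ?x \<and> s \<noteq> 0"
    using eventually_vertical[OF open_ball in_ball] eventually_neq_at_within[of 0]
  proof eventually_elim
    case (elim s)
    then have z: "?z s \<notin> \<real>" by (auto simp: complex_is_Real_iff)
    have "(?z s - ?y) * pairing w (?X (?z s)) (\<phi> ?y)
        = (?z s - ?x) * ((?z s - ?y) * pairing w (\<phi> ?y) (psi (m (?z s)) (?z s)))"
      unfolding X(2)[OF z] pairing_cmult
      by (simp add: mult_ac pairing_commute[of "psi (m (?z s)) (?z s)"])
    then show ?case unfolding pairing_phi_psi[OF z] using elim by simp
  qed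
  have "pairing w (?X ?x) (\<phi> ?y) = (if j = k then 1 else 0)"
  proof (cases "j = k")
    case True
    have "\<forall>\<^sub>F s in at (0::real). pairing w (?X (?z s)) (\<phi> ?y) = 1"
      using ev by eventually_elim (use True in auto)
    from limits_eq[OF lim tendsto_const this] show ?thesis using True by simp
  next
    case False
    have "((\<lambda>s. (?z s - ?y) * pairing w (?X (?z s)) (\<phi> ?y))
        \<longlongrightarrow> (?x - ?y) * pairing w (?X ?x) (\<phi> ?y)) (at 0)"
      by (intro tendsto_intros lim) (auto intro!: tendsto_eq_intros)
    moreover have "((\<lambda>s. ?z s - ?x) \<longlongrightarrow> 0) (at 0)"
      by (auto intro!: tendsto_eq_intros)
    moreover have "\<forall>\<^sub>F s in at (0::real). (?z s - ?y) * pairing w (?X (?z s)) (\<phi> ?y) = ?z s - ?x"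
      using ev by eventually_elim simp
    ultimately have "(?x - ?y) * pairing w (?X ?x) (\<phi> ?y) = 0"
      by (rule limits_eq)
    then show ?thesis using False eig_inj[of j k] by simp
  qed
  then show ?thesis unfolding X(1) pairing_cmult .
qed

definition eigfun :: "nat \<Rightarrow> int \<Rightarrow> complex" where
  "eigfun k n = csqrt (residue m (of_real (eig k))) * \<phi> (of_real (eig k)) n"

lemma eigfun_summable: "sq_summable w (eigfun k)"
  unfolding eigfun_def by (rule sq_summable_cmult[OF phi_summable])

lemma eigfun_pairing: "pairing w (eigfun j) (eigfun k) = (if j = k then 1 else 0)"
proof -
  let ?r = "\<lambda>k. residue m (complex_of_real (eig k))"
  have "residue m (of_real (eig j)) * pairing w (eigfun j) (eigfun k)
      = csqrt (?r j) * csqrt (?r k) *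
        (?r j * pairing w (\<phi> (of_real (eig j))) (\<phi> (of_real (eig k))))"
    unfolding eigfun_def pairing_cmult pairing_cmult_right by (simp add: mult_ac)
  also have "\<dots> = (if j = k then ?r j else 0)"
    unfolding pairing_phi_phi using power2_csqrt[of "?r k"] by (auto simp: power2_eq_square)
  finally show ?thesis using residue_nonzero[of j] by (auto split: if_splits)
qed

text \<open>The residue is the inverse of the squared norm of \<open>\<phi>\<close>, hence positive, and its root is real.\<close>
lemma eigfun_real: "cnj (eigfun k n) = eigfun k n"
proof -
  let ?x = "complex_of_real (eig k)"
  have phi: "cnj (\<phi> ?x i) = \<phi> ?x i" for i by (metis phi_cnj complex_cnj_complex_of_real)
  then have "residue m ?x * of_real (sq_norm w (\<phi> ?x)) = 1"
    using pairing_phi_phi[of k k] pairing_cnj[OF phi_summable, of k] by simp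
  then have "residue m ?x = of_real (1 / sq_norm w (\<phi> ?x))"
    by (simp add: field_simps) (metis mult_zero_right of_real_0 zero_neq_one eq_divide_eq)
  then have "csqrt (residue m ?x) = of_real (sqrt (1 / sq_norm w (\<phi> ?x)))"
    using of_real_sqrt[of "1 / sq_norm w (\<phi> ?x)"] sq_norm_nonneg[of "\<phi> ?x"] by simp
  then show ?thesis by (simp add: eigfun_def phi)
qed

sublocale orthonormal w eigfun
  by unfold_locales (simp_all add: eigfun_summable eigfun_pairing eigfun_real w_pos)

text \<open>Away from the diagonal both branches solve the recurrence; on the diagonal the defect is the
  Wronskian of \<open>\<phi>\<close> and \<open>psi\<close>.\<close>
lemma green_fun_equation:
  assumes z: "z \<notin> \<real>"
  shows "of_real (a n) * green_fun (n - 1) z k + of_real (a (n + 1)) * green_fun (n + 1) z k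
      - (of_real (b n) - z * of_real (w n)) * green_fun n z k = (if k = n then 1 else 0)"
proof -
  define p where "p = psi (m z) z"
  have p: "of_real (a n) * p (n - 1) + of_real (a (n + 1)) * p (n + 1)
      = (of_real (b n) - z * of_real (w n)) * p n"
    and f: "of_real (a n) * \<phi> z (n - 1) + of_real (a (n + 1)) * \<phi> z (n + 1)
      = (of_real (b n) - z * of_real (w n)) * \<phi> z n"
    using psi_sol[of z "m z"] phi_sol[of z] by (auto simp: solution_def p_def)
  consider "k > n" | "k < n" | "k = n" by linarith
  then show ?thesis
  proof cases
    case 1
    then have "of_real (a n) * green_fun (n - 1) z k + of_real (a (n + 1)) * green_fun (n + 1) z k
      - (of_real (b n) - z * of_real (w n)) * green_fun n z k
      = \<phi> z k * ((of_real (a n) * p (n - 1) + of_real (a (n + 1)) * p (n + 1))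
        - (of_real (b n) - z * of_real (w n)) * p n)"
      by (simp add: green_fun_def p_def algebra_simps)
    then show ?thesis unfolding p using 1 by simp
  next
    case 2
    then have "green_fun (n - 1) z k = \<phi> z (n - 1) * p k"
      by (cases "k = n - 1") (auto simp: green_fun_def p_def)
    then have "of_real (a n) * green_fun (n - 1) z k + of_real (a (n + 1)) * green_fun (n + 1) z k
      - (of_real (b n) - z * of_real (w n)) * green_fun n z k
      = p k * ((of_real (a n) * \<phi> z (n - 1) + of_real (a (n + 1)) * \<phi> z (n + 1))
        - (of_real (b n) - z * of_real (w n)) * \<phi> z n)"
      using 2 by (simp add: green_fun_def p_def algebra_simps)
    then show ?thesis unfolding f using 2 by simp
  next
    case 3
    have "of_real (a n) * green_fun (n - 1) z k + of_real (a (n + 1)) * green_fun (n + 1) z k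
      - (of_real (b n) - z * of_real (w n)) * green_fun n z k
      = \<phi> z n * (of_real (a n) * p (n - 1)) + of_real (a (n + 1)) * \<phi> z (n + 1) * p n
        - \<phi> z n * ((of_real (b n) - z * of_real (w n)) * p n)"
      using 3 by (simp add: green_fun_def p_def algebra_simps)
    also have "\<dots> = W (\<phi> z) p (n + 1)"
      unfolding p[symmetric] by (simp add: wronskian_def algebra_simps)
    also have "\<dots> = 1" unfolding p_def by (rule W_phi_psi)
    finally show ?thesis using 3 by simp
  qed
qed

text \<open>Orthogonality to the eigenfunctions removes all poles of the resolvent, so it is entire.\<close>
lemma pairing_green_fun_zero:
  assumes g: "sq_summable w g" and orth: "\<And>k. pairing w (\<phi> (of_real (eig k))) g = 0"
    and z: "z \<notin> \<real>"
  shows "pairing w (green_fun n z) g = 0"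
proof -
  define F where "F z = pairing w (green_fun n z) g" for z
  have "F holomorphic_on - \<real>"
  proof -
    have "F field_differentiable at y" if y: "y \<notin> \<real>" for y
    proof -
      define U where "U = ball y (\<bar>Im y\<bar> / 2)"
      have Imy: "\<bar>Im y\<bar> > 0" using y by (simp add: complex_is_Real_iff)
      have Im: "\<bar>Im y\<bar> / 2 \<le> \<bar>Im v\<bar>" if "v \<in> U" for v
        using that abs_Im_le_cmod[of "y - v"] by (auto simp: U_def dist_norm)
      have U: "U \<subseteq> - \<real>" using Im Imy by (force simp: complex_is_Real_iff)
      have "F holomorphic_on U" unfolding F_def
      proof (rule pairing_holomorphic[OF _ _ _ g])
        show "open U" by (simp add: U_def)
        show "(\<lambda>z. green_fun n z i) holomorphic_on U" for i
          using holomorphic_on_subset[OF psi_holomorphic U] unfolding green_fun_def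
          by (cases "n \<le> i") (auto intro!: holomorphic_intros)
        fix v and S :: "int set" assume v: "v \<in> U" "v \<notin> \<real>" and S: "finite S"
        have "(\<Sum>i\<in>S. w i * (cmod (green_fun n v i))\<^sup>2) \<le> (sqrt (sq_norm w (green_fun n v)))\<^sup>2"
          using sum_le_sq_norm[OF green_fun_norm(1)[OF v(2)] S] by (simp add: sq_norm_nonneg)
        also have "\<dots> \<le> ((1 / sqrt (w n)) / \<bar>Im v\<bar>)\<^sup>2"
          by (intro power_mono green_fun_bound v) (simp add: sq_norm_nonneg)
        also have "\<dots> \<le> ((1 / sqrt (w n)) / (\<bar>Im y\<bar> / 2))\<^sup>2"
          using Im[OF v(1)] Imy w_pos[of n] by (intro power_mono divide_left_mono) auto
        finally show "(\<Sum>i\<in>S. w i * (cmod (green_fun n v i))\<^sup>2) \<le> ((1 / sqrt (w n)) / (\<bar>Im y\<bar> / 2))\<^sup>2" .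
      qed
      then show ?thesis
        by (rule holomorphic_on_imp_differentiable_at) (use Imy in \<open>auto simp: U_def\<close>)
    qed
    then show ?thesis
      unfolding holomorphic_on_def using field_differentiable_at_within by blast
  qed
  moreover have "\<exists>d H. 0 < d \<and> H holomorphic_on ball (of_real x) d \<and>
      (\<forall>z \<in> ball (of_real x) d - \<real>. H z = F z)" for x :: real
  proof -
    let ?x = "complex_of_real x"
    let ?X = "scaled_green_fun x n"
    obtain d where d: "0 < d"
      and hol: "\<And>v. sq_summable w v \<Longrightarrow> (\<lambda>z. pairing w (?X z) v) holomorphic_on ball ?x d"
      using scaled_green_fun_near_real[of x n] by blast
    note X = scaled_green_fun_simps
    define G where "G z = pairing w (?X z) g" for z
    define H where "H z = (if z = ?x then deriv G ?x else G z / (z - ?x))" for z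
    have G0: "G ?x = 0"
    proof (cases "is_pole m ?x")
      case True
      then have "?x \<in> range (\<lambda>k. complex_of_real (eig k))"
        using eig_poles unfolding bij_betw_def by blast
      then obtain k where "?x = of_real (eig k)" by blast
      then have "pairing w (\<phi> ?x) g = 0" using orth by metis
      then show ?thesis unfolding G_def X(1) pairing_cmult by simp
    next
      case False
      then have "m analytic_on {?x}" using m_analytic analytic_on_subset by blast
      then obtain r where "0 < r" "m holomorphic_on ball ?x r" by (auto simp: analytic_on_def)
      then have "residue m ?x = 0" by (intro residue_holo[of "ball ?x r"]) auto
      then show ?thesis unfolding G_def X(1) pairing_cmult by simp
    qed
    have G_hol: "G holomorphic_on ball ?x d" unfolding G_def by (rule hol[OF g])
    have "H holomorphic_on ball ?x d"
      by (rule pole_theorem_open_0[OF G_hol open_ball, of ?x]) (auto simp: H_def G0)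
    moreover have "H z = F z" if "z \<in> ball ?x d - \<real>" for z
    proof -
      have z: "z \<in> ball ?x d" "z \<notin> \<real>" "z \<noteq> ?x" using that by auto
      then show ?thesis by (simp add: H_def G_def F_def X(2)[OF z(2)] pairing_cmult)
    qed
    ultimately show ?thesis using d by blast
  qed
  ultimately obtain E where E: "E holomorphic_on UNIV" "\<And>z. z \<notin> \<real> \<Longrightarrow> E z = F z"
    using glue_across_reals by blast
  have "cmod (E y) \<le> (1 / sqrt (w n) * sqrt (sq_norm w g)) / \<bar>Im y\<bar>" if y: "y \<notin> \<real>" for y
  proof -
    have "cmod (E y) \<le> sqrt (sq_norm w (green_fun n y)) * sqrt (sq_norm w g)"
      unfolding E(2)[OF y] F_def by (rule cauchy_schwarz[OF green_fun_norm(1)[OF y] g])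
    also have "\<dots> \<le> ((1 / sqrt (w n)) / \<bar>Im y\<bar>) * sqrt (sq_norm w g)"
      by (intro mult_right_mono green_fun_bound y) (simp add: sq_norm_nonneg)
    finally show ?thesis by simp
  qed
  from entire_Im_bound_zero[OF E(1) this] show ?thesis using E(2)[OF z] by (simp add: F_def)
qed

lemma eigfun_complete:
  assumes g: "sq_summable w g" and orth: "\<And>k. pairing w (eigfun k) g = 0"
  shows "g n = 0"
proof -
  have z: "\<i> \<notin> \<real>" by (simp add: complex_is_Real_iff)
  have "pairing w (\<phi> (of_real (eig k))) g = 0" for k
    using orth[of k] residue_nonzero[of k] unfolding eigfun_def pairing_cmult by simp
  then have 0: "pairing w g (green_fun j \<i>) = 0" for j
    using pairing_green_fun_zero[OF g _ z, of j] by (subst pairing_commute) blast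
  have G: "sq_summable w (green_fun j \<i>)" for j by (rule green_fun_norm(1)[OF z])
  let ?b = "of_real (b n) - \<i> * of_real (w n)"
  have "(\<lambda>k. (of_real (a n) * green_fun (n - 1) \<i> k + of_real (a (n + 1)) * green_fun (n + 1) \<i> k)
      + (- ?b) * green_fun n \<i> k) = (\<lambda>k. if k = n then 1 else 0)"
    using green_fun_equation[OF z, of n] by (intro ext) (simp only: mult_minus_left add_uminus_conv_diff)
  moreover have "pairing w g (\<lambda>k. (of_real (a n) * green_fun (n - 1) \<i> k
      + of_real (a (n + 1)) * green_fun (n + 1) \<i> k) + (- ?b) * green_fun n \<i> k) = 0"
    by (simp only: pairing_lin[OF g sq_summable_lin[OF sq_summable_cmult[OF G] G] G]
        pairing_lin[OF g sq_summable_cmult[OF G] G] pairing_cmult_right 0) simp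
  ultimately have "pairing w g (\<lambda>k. if k = n then 1 else 0) = 0" by simp
  then show ?thesis using w_pos[of n] by (simp add: pairing_single)
qed

theorem eigenfunction_expansion:
  assumes f: "sq_summable w f"
  shows "(\<lambda>k. pairing w (eigfun k) f * eigfun k n) sums f n"
proof -
  obtain g where "sq_summable w g" "\<And>k. pairing w (eigfun k) g = 0"
    "\<And>x. (\<lambda>k. pairing w (eigfun k) f * eigfun k x) sums (f x - g x)"
    using fourier_remainder[OF f] by blast
  then show ?thesis using eigfun_complete[of g n] by (metis diff_zero)
qed

end

section \<open>Functions on the lattice of powers of q\<close>

definition samples :: "real \<Rightarrow> (real \<Rightarrow> complex) \<Rightarrow> int \<Rightarrow> complex" where
  "samples q f n = f (q powi n)"

definition lattice_weight :: "real \<Rightarrow> int \<Rightarrow> real" where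
  "lattice_weight q n = (1 - q) * q powi n"

text \<open>The equation at \<open>x = q powi n\<close>, multiplied by \<open>(1 - q) x\<close>, is symmetric with these coefficients, for the
  weight of Jackson's integral.\<close>
definition lattice_offdiag :: "real \<Rightarrow> int \<Rightarrow> real" where
  "lattice_offdiag q n = (1 - q) / q powi n"

definition lattice_diag :: "real \<Rightarrow> (real \<Rightarrow> real) \<Rightarrow> int \<Rightarrow> real" where
  "lattice_diag q V n = (1 - q) * ((1 + q) / (q * q powi n) + q powi n * V (q powi n))"

lemma powi_succ: "0 < q \<Longrightarrow> (q::real) powi (n + 1) = q * q powi n"
  by (simp add: power_int_add_1')

lemma powi_pred: "0 < q \<Longrightarrow> (q::real) powi (n - 1) = q powi n / q"
  by (simp add: power_int_diff)

lemma samples_solution: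
  assumes q: "0 < q" and f: "SL_solution q V z f"
  shows "solution (lattice_offdiag q) (lattice_weight q) (lattice_diag q V) z (samples q f)"
  unfolding solution_def
proof
  fix n
  define x where "x = complex_of_real (q powi n)"
  define c where "c = complex_of_real q"
  define v where "v = complex_of_real (V (q powi n))"
  have nz: "x \<noteq> 0" "c \<noteq> 0" using q by (auto simp: x_def c_def)
  define um u0 up where "um = samples q f (n - 1)" and "u0 = samples q f n" and "up = samples q f (n + 1)"
  have "q_laplace q f (q powi n) + (z - v) * f (q powi n) = 0"
    using f by (auto simp: SL_solution_def q_lattice_def v_def)
  then have "(1 / x\<^sup>2) * (um - ((1 + c) / c) * u0 + (1 / c) * up) + (z - v) * u0 = 0"
    using q by (simp add: q_laplace_def um_def u0_def up_def samples_def powi_succ powi_pred x_def c_def)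
  then have "um - ((1 + c) / c) * u0 + (1 / c) * up = x\<^sup>2 * ((v - z) * u0)"
    using nz by (simp add: field_simps)
  then have "um + (1 / c) * up = ((1 + c) / c) * u0 + x\<^sup>2 * ((v - z) * u0)"
    by (simp add: algebra_simps)
  then have "(1 - c) / x * (um + (1 / c) * up) = (1 - c) / x * (((1 + c) / c) * u0 + x\<^sup>2 * ((v - z) * u0))"
    by simp
  also have "\<dots> = ((1 - c) * ((1 + c) / (c * x) + x * v) - z * ((1 - c) * x)) * u0"
    using nz by (simp add: field_simps power2_eq_square)
  also have "(1 - c) / x * (um + (1 / c) * up) = (1 - c) / x * um + (1 - c) / (c * x) * up"
    using nz by (simp add: field_simps)
  finally have "(1 - c) / x * um + (1 - c) / (c * x) * up
      = ((1 - c) * ((1 + c) / (c * x) + x * v) - z * ((1 - c) * x)) * u0" .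
  then show "complex_of_real (lattice_offdiag q n) * samples q f (n - 1)
      + complex_of_real (lattice_offdiag q (n + 1)) * samples q f (n + 1)
      = (complex_of_real (lattice_diag q V n) - z * complex_of_real (lattice_weight q n)) * samples q f n"
    using q by (simp add: lattice_offdiag_def lattice_weight_def lattice_diag_def powi_succ
        um_def u0_def up_def x_def c_def v_def)
qed

lemma tendsto_int_at_top:
  fixes h :: "int \<Rightarrow> 'a :: topological_space"
  assumes "(\<lambda>k. h (int k)) \<longlonglongrightarrow> L"
  shows "(h \<longlongrightarrow> L) at_top"
proof -
  have "filterlim nat at_top at_top"
    unfolding filterlim_at_top
  proof
    fix Z :: nat
    show "\<forall>\<^sub>F x in at_top. Z \<le> nat x"
      using eventually_ge_at_top[of "int Z"] by eventually_elim linarith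
  qed
  then have "((\<lambda>n. h (int (nat n))) \<longlongrightarrow> L) at_top"
    by (rule filterlim_compose[OF assms])
  then show ?thesis
    by (rule Lim_transform_eventually)
       (rule eventually_mono[OF eventually_ge_at_top[of 0]], simp)
qed

text \<open>In the limit the difference quotients of the lattice, which have step \<open>(1 - q) x\<close>, turn into the
  derivatives at the origin.\<close>
lemma samples_wronskian_limit:
  assumes q: "0 < q" and F: "has_values_at_0 q F F0 F1" and G: "has_values_at_0 q G G0 G1"
  shows "(wronskian (lattice_offdiag q) (samples q F) (samples q G)
    \<longlongrightarrow> of_real ((1 - q)\<^sup>2 / q) * (F0 * G1 - G0 * F1)) at_top"
proof -
  define quot where "quot H H0 n = (samples q H n - H0) / of_real (q powi n)" for H and H0 :: complex and n
  have val: "(samples q H \<longlongrightarrow> H0) at_top" and slope: "(quot H H0 \<longlongrightarrow> H1) at_top"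
    if "has_values_at_0 q H H0 H1" for H H0 H1
    using that unfolding has_values_at_0_def
    by (auto intro!: tendsto_int_at_top simp: samples_def quot_def)
  have shift: "((\<lambda>n. quot H H0 (n - 1)) \<longlongrightarrow> H1) at_top" if "has_values_at_0 q H H0 H1" for H H0 H1
  proof (rule filterlim_compose[OF slope[OF that]])
    show "filterlim (\<lambda>n::int. n - 1) at_top at_top"
      unfolding filterlim_at_top
    proof
      fix Z :: int
      show "\<forall>\<^sub>F n in at_top. Z \<le> n - 1"
        using eventually_ge_at_top[of "Z + 1"] by eventually_elim linarith
    qed
  qed
  let ?d = "\<lambda>H H0 n. quot H H0 (n - 1) / of_real q - quot H H0 n"
  have diff: "(samples q H (n - 1) - samples q H n) / of_real (q powi n) = ?d H H0 n" for H H0 n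
    using q by (simp add: quot_def powi_pred field_simps)
  have "wronskian (lattice_offdiag q) (samples q F) (samples q G) n
      = of_real (1 - q) * (samples q F n * ((samples q G (n - 1) - samples q G n) / of_real (q powi n))
        - samples q G n * ((samples q F (n - 1) - samples q F n) / of_real (q powi n)))" for n
    using q by (simp add: wronskian_def lattice_offdiag_def field_simps)
  then have eq: "wronskian (lattice_offdiag q) (samples q F) (samples q G)
      = (\<lambda>n. of_real (1 - q) * (samples q F n * ?d G G0 n - samples q G n * ?d F F0 n))"
    unfolding diff[of G _ G0] diff[of F _ F0] by (rule ext)
  have "((\<lambda>n. of_real (1 - q) * (samples q F n * ?d G G0 n - samples q G n * ?d F F0 n)) \<longlongrightarrow>
      of_real (1 - q) * (F0 * (G1 / of_real q - G1) - G0 * (F1 / of_real q - F1))) at_top"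
    using q by (intro tendsto_intros val[OF F] val[OF G] slope[OF F] slope[OF G] shift[OF F] shift[OF G]) auto
  moreover have "of_real (1 - q) * (F0 * (G1 / of_real q - G1) - G0 * (F1 / of_real q - F1))
      = of_real ((1 - q)\<^sup>2 / q) * (F0 * G1 - G0 * F1)"
    using q by (simp add: field_simps power2_eq_square)
  ultimately show ?thesis unfolding eq by simp
qed

lemma lattice_regular_end:
  assumes q: "0 < q" "q < 1"
  shows "regular_end (lattice_weight q)"
proof
  show "0 < lattice_weight q n" for n
    using q by (simp add: lattice_weight_def)
  have "summable (\<lambda>k. (1 - q) * q ^ k)"
    using q by (intro summable_mult summable_geometric) simp
  then have "summable (\<lambda>k. norm ((1 - q) * q ^ k))"
    using q by (simp add: abs_mult)
  then have "(\<lambda>k. lattice_weight q (int k)) summable_on UNIV"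
    by (intro norm_summable_imp_summable_on) (simp add: lattice_weight_def)
  moreover have "bij_betw int UNIV {0..}"
    by (rule bij_betwI[where g = nat]) auto
  ultimately show "lattice_weight q summable_on {0..}"
    by (simp add: summable_on_reindex_bij_betw)
qed

lemma samples_bounded:
  assumes "has_values_at_0 q f f0 f1"
  shows "bounded (samples q f ` {0..})"
proof -
  have "(\<lambda>k. samples q f (int k)) \<longlonglongrightarrow> f0"
    using assms by (simp add: has_values_at_0_def samples_def)
  then have "bounded (range (\<lambda>k. samples q f (int k)))"
    by (rule convergent_imp_bounded)
  moreover have "samples q f ` {0..} = range (\<lambda>k. samples q f (int k))"
    by (auto simp: image_iff) (metis nonneg_int_cases)
  ultimately show ?thesis by simp
qed

lemma has_values_at_0_cnj:
  assumes "has_values_at_0 q f (of_real x) (of_real y)"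
  shows "has_values_at_0 q (\<lambda>x. cnj (f x)) (of_real x) (of_real y)"
proof -
  have "(\<lambda>n. f (q ^ n)) \<longlonglongrightarrow> of_real x"
    "(\<lambda>n. (f (q ^ n) - of_real x) / of_real (q ^ n)) \<longlonglongrightarrow> of_real y"
    using assms by (simp_all only: has_values_at_0_def)
  from this[THEN tendsto_cnj] show ?thesis by (simp add: has_values_at_0_def)
qed

lemma SL_solution_cnj:
  assumes "SL_solution q V (cnj z) f"
  shows "SL_solution q V z (\<lambda>x. cnj (f x))"
  unfolding SL_solution_def
proof
  fix x assume "x \<in> q_lattice q"
  then have "cnj (q_laplace q f x + (cnj z - of_real (V x)) * f x) = 0"
    using assms by (simp only: SL_solution_def) simp
  then show "q_laplace q (\<lambda>x. cnj (f x)) x + (z - of_real (V x)) * cnj (f x) = 0"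
    by (simp add: q_laplace_def)
qed

definition shifted_deriv_factor :: "real \<Rightarrow> int \<Rightarrow> real" where
  "shifted_deriv_factor q n = q / ((1 - q) * q powi n)"

lemma weyl_l_samples:
  fixes q \<beta> :: real and n :: int
  assumes q: "0 < q" "q < 1"
  defines "\<kappa> \<equiv> shifted_deriv_factor q n"
  shows "weyl_l q \<theta> \<phi> z (q powi n) \<beta> =
    - ((of_real (cos \<beta> - \<kappa> * sin \<beta>) * \<theta> (q powi n) z + of_real (\<kappa> * sin \<beta>) * \<theta> (q powi (n - 1)) z)
     / (of_real (cos \<beta> - \<kappa> * sin \<beta>) * \<phi> (q powi n) z + of_real (\<kappa> * sin \<beta>) * \<phi> (q powi (n - 1)) z))"
proof -
  have key: "u (q powi n) * of_real (cos \<beta>) + shifted_q_deriv q u (q powi n) * of_real (sin \<beta>)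
    = of_real (cos \<beta> - \<kappa> * sin \<beta>) * u (q powi n) + of_real (\<kappa> * sin \<beta>) * u (q powi (n - 1))" for u
  proof -
    have "shifted_q_deriv q u (q powi n) = of_real (\<kappa>) * (u (q powi (n - 1)) - u (q powi n))"
      using q by (simp add: shifted_q_deriv_def q_deriv_def \<kappa>_def shifted_deriv_factor_def powi_pred)
    then show ?thesis by (simp only:) (simp add: algebra_simps)
  qed
  show ?thesis
    unfolding weyl_l_def key[of "\<lambda>x. \<theta> x z"] key[of "\<lambda>x. \<phi> x z"] ..
qed

text \<open>The two alternatives in the definition of \<open>m\<close> merge: circles that shrink to a point converge
  uniformly, in particular along the prescribed sequence.\<close>
lemma weyl_m_function_limit:
  assumes q: "0 < q" "q < 1" and m: "weyl_m_function q \<theta> \<phi> m"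
  obtains N \<beta> where "filterlim N at_bot sequentially"
    "\<And>z. z \<notin> \<real> \<Longrightarrow> (\<lambda>j. weyl_l q \<theta> \<phi> z (q powi (N j)) (\<beta> j)) \<longlonglongrightarrow> m z"
proof -
  obtain bs \<beta> where bs: "range bs \<subseteq> q_lattice q" "filterlim bs at_top sequentially"
    and alt: "\<And>z. z \<notin> \<real> \<Longrightarrow> weyl_limit_point q \<theta> \<phi> z (m z) \<or>
           (\<lambda>j. weyl_l q \<theta> \<phi> z (bs j) (\<beta> j)) \<longlonglongrightarrow> m z"
    using m unfolding weyl_m_function_def by blast
  have "\<exists>n. bs j = q powi n" for j
    using bs(1) by (auto simp: q_lattice_def)
  then obtain N where N: "\<And>j. bs j = q powi (N j)" by metis
  have N_lim: "filterlim N at_bot sequentially"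
    unfolding filterlim_at_bot
  proof
    fix Z
    show "\<forall>\<^sub>F j in sequentially. N j \<le> Z"
      using bs(2)[unfolded filterlim_at_top_dense, rule_format, of "q powi Z"]
    proof eventually_elim
      case (elim j)
      show ?case
      proof (rule ccontr)
        assume "\<not> N j \<le> Z"
        then have "q powi (N j) < q powi Z" using q by (intro power_int_strict_decreasing) auto
        then show False using elim N by simp
      qed
    qed
  qed
  have "(\<lambda>j. weyl_l q \<theta> \<phi> z (q powi (N j)) (\<beta> j)) \<longlonglongrightarrow> m z" if z: "z \<notin> \<real>" for z
  proof (cases "weyl_limit_point q \<theta> \<phi> z (m z)")
    case True
    show ?thesis
    proof (rule tendstoI)
      fix e :: real assume "0 < e"
      then have ev: "\<forall>\<^sub>F k in sequentially. \<forall>\<beta>. dist (weyl_l q \<theta> \<phi> z (q powi (- int k)) \<beta>) (m z) < e"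
        using True unfolding weyl_limit_point_def by (auto dest: uniform_limitD)
      have "filterlim (\<lambda>j. nat (- N j)) at_top sequentially"
        unfolding filterlim_at_top
      proof
        fix Z :: nat
        show "\<forall>\<^sub>F j in sequentially. Z \<le> nat (- N j)"
          using N_lim[unfolded filterlim_at_bot, rule_format, of "- int Z"] by eventually_elim linarith
      qed
      then have "\<forall>\<^sub>F j in sequentially. \<forall>\<beta>.
          dist (weyl_l q \<theta> \<phi> z (q powi (- int (nat (- N j)))) \<beta>) (m z) < e"
        using ev by (rule eventually_compose_filterlim[rotated])
      then show "\<forall>\<^sub>F j in sequentially. dist (weyl_l q \<theta> \<phi> z (q powi (N j)) (\<beta> j)) (m z) < e"
        using N_lim[unfolded filterlim_at_bot, rule_format, of 0]
        by eventually_elim simp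
    qed
  next
    case False
    then show ?thesis using alt[OF z] N by simp
  qed
  with N_lim show thesis using that by blast
qed

lemma q_L2_sq_summable:
  assumes "f \<in> q_L2 q"
  shows "sq_summable (lattice_weight q) (samples q f)"
  using assms summable_on_cmult_right[of "\<lambda>n. q powi n * (cmod (f (q powi n)))\<^sup>2" UNIV "1 - q"]
  by (simp add: q_L2_def sq_summable_def lattice_weight_def samples_def mult.assoc)

lemma jackson_integral_pairing:
  "jackson_integral q (\<lambda>x. f x * g x) = pairing (lattice_weight q) (samples q f) (samples q g)"
  unfolding jackson_integral_def pairing_def infsum_cmult_right'[symmetric]
  by (simp add: lattice_weight_def samples_def mult.assoc)

theorem theorem3:
  fixes q \<alpha> :: real
    and V :: "real \<Rightarrow> real"
    and \<phi> \<theta> :: "real \<Rightarrow> complex \<Rightarrow> complex"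
    and m :: "complex \<Rightarrow> complex"
    and eig :: "nat \<Rightarrow> real"
    and f :: "real \<Rightarrow> complex"
    and c :: "nat \<Rightarrow> complex"
  assumes "0 < q" and "q < 1"
    and "\<And>\<mu>. SL_solution q V \<mu> (\<lambda>x. \<phi> x \<mu>)"
    and "\<And>\<mu>. has_values_at_0 q (\<lambda>x. \<phi> x \<mu>)
           (complex_of_real (sqrt q / (1 - q) * sin \<alpha>))
           (complex_of_real (- (sqrt q / (1 - q) * cos \<alpha>)))"
    and "\<And>\<mu>. SL_solution q V \<mu> (\<lambda>x. \<theta> x \<mu>)"
    and "\<And>\<mu>. has_values_at_0 q (\<lambda>x. \<theta> x \<mu>)
           (complex_of_real (sqrt q / (1 - q) * cos \<alpha>))
           (complex_of_real (sqrt q / (1 - q) * sin \<alpha>))"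
    and "weyl_m_function q \<theta> \<phi> m"
    and "m meromorphic_on UNIV"
    and "m analytic_on - {z. is_pole m z}"
    and "bij_betw (\<lambda>n. complex_of_real (eig n)) UNIV {z. is_pole m z}"
    and "f \<in> SL_domain q V \<alpha> (weyl_psi \<theta> \<phi> m)"
    and "\<And>n. c n = jackson_integral q (\<lambda>y. eigenfun \<phi> m (complex_of_real (eig n)) y * f y)"
  shows "\<forall>x\<in>q_lattice q. (\<lambda>n. c n * eigenfun \<phi> m (complex_of_real (eig n)) x) sums f x"
proof
  note q = assms(1,2) and phi = assms(3,4) and theta = assms(5,6)
  define \<Phi> where "\<Phi> z = samples q (\<lambda>x. \<phi> x z)" for z
  define \<Theta> where "\<Theta> z = samples q (\<lambda>x. \<theta> x z)" for z
  let ?a = "lattice_offdiag q" and ?w = "lattice_weight q" and ?b = "lattice_diag q V"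
  interpret regular_end ?a ?w ?b using lattice_regular_end[OF q] .
  define s where "s = sqrt q / (1 - q)"
  have s2: "of_real ((1 - q)\<^sup>2 / q) * (of_real (s * s) :: complex) = 1"
  proof -
    have "(1 - q)\<^sup>2 / q * (s * s) = 1"
      using q by (simp add: s_def power2_eq_square)
    then show ?thesis by (metis of_real_1 of_real_mult)
  qed
  have WW: "(W (samples q F) (samples q G) \<longlongrightarrow> of_real ((1 - q)\<^sup>2 / q) * (F0 * G1 - G0 * F1)) at_top"
    if "has_values_at_0 q F F0 F1" "has_values_at_0 q G G0 G1" for F G F0 F1 G0 G1
    using samples_wronskian_limit[OF q(1) that] .
  have phi_theta_lim: "(W (samples q F) (samples q G) \<longlongrightarrow> 1) at_top"
    if "has_values_at_0 q F (of_real (s * sin \<alpha>)) (of_real (- (s * cos \<alpha>)))"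
       "has_values_at_0 q G (of_real (s * cos \<alpha>)) (of_real (s * sin \<alpha>))" for F G
  proof -
    have "s * sin \<alpha> * (s * sin \<alpha>) - s * cos \<alpha> * - (s * cos \<alpha>) = s * s"
      using sin_cos_squared_add[of \<alpha>] by algebra
    then have "of_real (s * sin \<alpha>) * of_real (s * sin \<alpha>) - of_real (s * cos \<alpha>) * of_real (- (s * cos \<alpha>))
        = complex_of_real (s * s)"
      by (metis of_real_diff of_real_mult)
    then show ?thesis using WW[OF that] s2 by (simp only:)
  qed
  have same_lim: "(W (samples q F) (samples q G) \<longlongrightarrow> 0) at_top"
    if "has_values_at_0 q F x y" "has_values_at_0 q G x y" for F G x y
    using WW[OF that] by simp
  note phi' = phi(2)[folded s_def] and theta' = theta(2)[folded s_def]
  interpret regular_pair ?a ?w ?b \<Phi> \<Theta>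
  proof
    fix z z'
    show "sol z (\<Phi> z)" "sol z (\<Theta> z)"
      unfolding \<Phi>_def \<Theta>_def by (intro samples_solution q phi theta)+
    show "bounded_at_end (\<Phi> z)" "bounded_at_end (\<Theta> z)"
      unfolding \<Phi>_def \<Theta>_def bounded_at_end_def by (rule samples_bounded[OF phi'], rule samples_bounded[OF theta'])
    show "(W (\<Phi> z) (\<Phi> z') \<longlongrightarrow> 0) at_top" "(W (\<Theta> z) (\<Theta> z') \<longlongrightarrow> 0) at_top"
      unfolding \<Phi>_def \<Theta>_def by (rule same_lim[OF phi' phi'], rule same_lim[OF theta' theta'])
    show "(W (\<Phi> z) (\<Theta> z') \<longlongrightarrow> 1) at_top"
      unfolding \<Phi>_def \<Theta>_def by (rule phi_theta_lim[OF phi' theta'])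
  qed
  \<comment> \<open>The conjugate solutions have the same values at \<open>0\<close>.\<close>
  have cnj_phi: "\<Phi> (cnj z) n = cnj (\<Phi> z n)" for z n
  proof -
    let ?F = "\<lambda>x. cnj (\<phi> x z)"
    have F: "has_values_at_0 q ?F (of_real (s * sin \<alpha>)) (of_real (- (s * cos \<alpha>)))"
      by (rule has_values_at_0_cnj[OF phi'])
    have sol: "SL_solution q V (cnj z) ?F"
      by (rule SL_solution_cnj) (simp add: phi(1))
    have "samples q ?F n = \<Phi> (cnj z) n * 1 + \<Theta> (cnj z) n * 0"
    proof (rule solution_coordinates)
      show "bounded_at_end (samples q ?F)"
        unfolding bounded_at_end_def by (rule samples_bounded[OF F])
      show "(W (samples q ?F) (\<Theta> (cnj z)) \<longlongrightarrow> 1) at_top"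
        unfolding \<Theta>_def by (rule phi_theta_lim[OF F theta'])
      show "(W (\<Phi> (cnj z)) (samples q ?F) \<longlongrightarrow> 0) at_top"
        unfolding \<Phi>_def by (rule same_lim[OF phi' F])
    qed (rule samples_solution[OF q(1) sol])
    then show ?thesis by (simp add: samples_def \<Phi>_def)
  qed
  have cnj_theta: "\<Theta> (cnj z) n = cnj (\<Theta> z n)" for z n
  proof -
    let ?F = "\<lambda>x. cnj (\<theta> x z)"
    have F: "has_values_at_0 q ?F (of_real (s * cos \<alpha>)) (of_real (s * sin \<alpha>))"
      by (rule has_values_at_0_cnj[OF theta'])
    have sol: "SL_solution q V (cnj z) ?F"
      by (rule SL_solution_cnj) (simp add: theta(1))
    have "samples q ?F n = \<Phi> (cnj z) n * 0 + \<Theta> (cnj z) n * 1"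
    proof (rule solution_coordinates)
      show "bounded_at_end (samples q ?F)"
        unfolding bounded_at_end_def by (rule samples_bounded[OF F])
      show "(W (samples q ?F) (\<Theta> (cnj z)) \<longlongrightarrow> 0) at_top"
        unfolding \<Theta>_def by (rule same_lim[OF F theta'])
      show "(W (\<Phi> (cnj z)) (samples q ?F) \<longlongrightarrow> 1) at_top"
        unfolding \<Phi>_def by (rule phi_theta_lim[OF phi' F])
    qed (rule samples_solution[OF q(1) sol])
    then show ?thesis by (simp add: samples_def \<Theta>_def)
  qed
  obtain N \<beta> where N: "filterlim N at_bot sequentially"
    and m_lim: "\<And>z. z \<notin> \<real> \<Longrightarrow> (\<lambda>j. weyl_l q \<theta> \<phi> z (q powi (N j)) (\<beta> j)) \<longlonglongrightarrow> m z"
    using weyl_m_function_limit[OF q assms(7)] by blast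
  let ?k = "\<lambda>j. shifted_deriv_factor q (N j)"
  have k_nonzero: "?k j \<noteq> 0" for j using q by (simp add: shifted_deriv_factor_def)
  interpret discrete_spectrum ?a ?w ?b \<Phi> \<Theta> m N
    "\<lambda>j. cos (\<beta> j) - ?k j * sin (\<beta> j)" "\<lambda>j. ?k j * sin (\<beta> j)" eig
  proof
    show "cos (\<beta> j) - ?k j * sin (\<beta> j) \<noteq> 0 \<or> ?k j * sin (\<beta> j) \<noteq> 0" for j
      using k_nonzero[of j] sin_zero_abs_cos_one[of "\<beta> j"] by auto
    show "(\<lambda>j. - ((of_real (cos (\<beta> j) - ?k j * sin (\<beta> j)) * \<Theta> z (N j)
          + of_real (?k j * sin (\<beta> j)) * \<Theta> z (N j - 1))
        / (of_real (cos (\<beta> j) - ?k j * sin (\<beta> j)) * \<Phi> z (N j)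
          + of_real (?k j * sin (\<beta> j)) * \<Phi> z (N j - 1)))) \<longlonglongrightarrow> m z" if "z \<notin> \<real>" for z
      using m_lim[OF that] by (simp only: weyl_l_samples[OF q] \<Phi>_def \<Theta>_def samples_def)
    show "\<Phi> (cnj z) n = cnj (\<Phi> z n)" "\<Theta> (cnj z) n = cnj (\<Theta> z n)" for z n
      by (rule cnj_phi, rule cnj_theta)
    show "filterlim N at_bot sequentially" by (rule N)
    show "m meromorphic_on UNIV" by (rule assms(8))
    show "m analytic_on - {z. is_pole m z}" by (rule assms(9))
    show "bij_betw (\<lambda>k. complex_of_real (eig k)) UNIV {z. is_pole m z}" by (rule assms(10))
  qed
  have eigfun: "eigfun k = samples q (eigenfun \<phi> m (complex_of_real (eig k)))" for k
    by (rule ext) (simp add: eigfun_def eigenfun_def samples_def \<Phi>_def)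
  have f: "sq_summable ?w (samples q f)"
    using assms(11) by (intro q_L2_sq_summable) (simp add: SL_domain_def)
  fix x assume "x \<in> q_lattice q"
  then obtain n where x: "x = q powi n" by (auto simp: q_lattice_def)
  have "c k = pairing ?w (eigfun k) (samples q f)" for k
    unfolding assms(12) eigfun by (rule jackson_integral_pairing)
  then have "(\<lambda>k. c k * eigfun k n) sums samples q f n"
    using eigenfunction_expansion[OF f, of n] by (simp only:)
  then show "(\<lambda>n. c n * eigenfun \<phi> m (complex_of_real (eig n)) x) sums f x"
    by (simp only: eigfun samples_def x)
qed

end
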